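(* Let $(\Omega,\mathcal{F},(\mathcal{F}_t)_{t\ge0},\mathbb{P})$ be a filtered probability space satisfying the usual conditions, $B$ an $\ell$-dimensional $(\mathcal{F}_t)$-Brownian motion, and $A\colon\mathbb{R}^d\rightrightarrows\mathbb{R}^d$ a maximal monotone operator with $\mathcal{S}:=\{x:0\in A(x)\}\neq\emptyset$. Let $\sigma\colon\Omega\times\mathbb{R}_+\times\mathbb{R}^d\to\mathbb{R}^{d\times\ell}$ satisfy: (i) $\sigma(\cdot,\cdot,x)$ is progressively measurable for each $x$; (ii) there is $\kappa\in L^2_{\mathrm{loc}}(\mathbb{R}_+;\mathbb{R})$ with $\|\sigma(t,x)-\sigma(t,y)\|\le\kappa(t)\|x-y\|$ for all $x,y,t$; (iii) $\mathbb{E}\int_0^\infty\sigma_\infty(t)^2dt<\infty$, where $\sigma_\infty(t):=\sup_{x\in\mathbb{R}^d}\|\sigma(t,x)\|$. Let $X_0$ be an $\mathcal{F}_0$-measurable, square-integrable random variable with values in $\operatorname{cl}\operatorname{dom}A$, and let $(X,Y,M)$ be the unique solution of $dX_t\in -A(X_t)dt+\sigma(t,X_t)dB_t$ with initial value $X_0$. Then: (a) for all $x^\star\in\mathcal{S}$ and $0\le s<t$, $\mathbb{E}\|X_t-x^\star\|^2\le\mathbb{E}\|X_s-x^\star\|^2-2\mathbb{E}\big(\int_s^t\langle X_\tau-x^\star,dY_\tau\rangle\big)+\mathbb{E}\big(\int_s^t\sigma_\infty(\tau)^2d\tau\big)$; (b) for all $x^\star\in\mathcal{S}$, $\mathbb{E}\big(\sup_{t\ge0}\|X_t-x^\star\|^2\big)<\infty$;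 (c) $\mathbb{P}$-a.s., for all $x^\star\in\mathcal{S}$, $\lim_{t\to\infty}\|X_t-x^\star\|$ exists; moreover for all $x^\star\in\mathcal{S}$, $\lim_{t\to\infty}\mathbb{E}\|X_t-x^\star\|^2=\mathbb{E}\big(\lim_{t\to\infty}\|X_t-x^\star\|^2\big)$; (d) there is a random variable $X^\star\in L^2_{\mathbb{P}}(\Omega;\mathbb{R}^d)$ with $\mathbb{P}(X^\star\in\mathcal{S})=1$ such that $\mathbb{P}$-a.s. $\lim_{t\to\infty}\bar X_t=X^\star$ and $\lim_{t\to\infty}\mathbb{E}\|\bar X_t-X^\star\|^2=0$, where $\bar X_t:=\frac1t\int_0^tX_s\,ds$.
   Context: Solution concept: a triplet $(X,Y,M)$ of $\mathbb{R}^d$-valued processes solves $dX_t\in -A(X_t)dt+\sigma(t,X_t)dB_t$, $X_0\in\operatorname{cl}\operatorname{dom}A$, if: $X,Y,M$ are continuous progressively measurable with $Y_0=M_0=0$; $X_t\in\operatorname{cl}\operatorname{dom}A$ for all $t$ a.s., $(\omega,t)\mapsto\sigma(\omega,t,X_t(\omega))$ is progressively measurable with $\int_0^T\|\sigma(t,X_t)\|^2dt<\infty$ a.s. for all $T$; $Y$ has paths of bounded variation on compacts and for every pair of continuous adapted processes $(\alpha,\beta)$ with $(\alpha_t,\beta_t)\in\operatorname{gph}A$ for all $t$, a.s. $\int_a^b\langle X_t-\alpha_t,dY_t\rangle\ge\int_a^b\langle X_t-\alpha_t,\beta_t\rangle dt$ for all $0\le a\le b$; $M$ is a continuous local martingale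 with $\langle M_t,x-y\rangle=0$ for all $x,y\in\operatorname{dom}A$, all $t$, a.s.; and a.s. $X_t=X_0-Y_t+M_t+\int_0^t\sigma(s,X_s)dB_s$ for all $t\ge0$. Under the stated assumptions such a solution exists and is unique. Matrix norms are Frobenius norms. *)

theory Defs
  imports "HOL-Probability.Probability"
begin

definition is_partition :: "real \<Rightarrow> real \<Rightarrow> nat \<Rightarrow> (nat \<Rightarrow> real) \<Rightarrow> bool" where
  "is_partition a b n p \<longleftrightarrow> p 0 = a \<and> p n = b \<and> (\<forall>k<n. p k < p (Suc k))"

definition bounded_variation_on :: "(real \<Rightarrow> 'v::real_normed_vector) \<Rightarrow> real \<Rightarrow> real \<Rightarrow> bool" where
  "bounded_variation_on g a b \<longleftrightarrow>
     (\<exists>K. \<forall>n p. is_partition a b n p \<longrightarrow> (\<Sum>k<n. norm (g (p (Suc k)) - g (p k))) \<le> K)"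

definition rs_has_integral :: "(real \<Rightarrow> 'v::real_inner) \<Rightarrow> (real \<Rightarrow> 'v) \<Rightarrow> real \<Rightarrow> real \<Rightarrow> real \<Rightarrow> bool" where
  "rs_has_integral f g a b I \<longleftrightarrow>
     (\<forall>e>0. \<exists>d>0. \<forall>n p xi. is_partition a b n p \<longrightarrow> (\<forall>k<n. p (Suc k) - p k < d)
        \<longrightarrow> (\<forall>k<n. p k \<le> xi k \<and> xi k \<le> p (Suc k))
        \<longrightarrow> \<bar>(\<Sum>k<n. inner (f (xi k)) (g (p (Suc k)) - g (p k))) - I\<bar> < e)"

definition rs_integral :: "(real \<Rightarrow> 'v::real_inner) \<Rightarrow> (real \<Rightarrow> 'v) \<Rightarrow> real \<Rightarrow> real \<Rightarrow> real" where
  "rs_integral f g a b = (THE I. rs_has_integral f g a b I)"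

text \<open>Set-valued operators on R^d given by their graph.\<close>
definition monotone_op :: "('v::real_inner \<times> 'v) set \<Rightarrow> bool" where
  "monotone_op A \<longleftrightarrow> (\<forall>(x,u)\<in>A. \<forall>(y,v)\<in>A. inner (x - y) (u - v) \<ge> 0)"

definition maximal_monotone :: "('v::real_inner \<times> 'v) set \<Rightarrow> bool" where
  "maximal_monotone A \<longleftrightarrow> monotone_op A \<and> (\<forall>B. monotone_op B \<longrightarrow> A \<subseteq> B \<longrightarrow> B = A)"

definition op_dom :: "('v \<times> 'v) set \<Rightarrow> 'v set" where
  "op_dom A = fst ` A"

definition zeros :: "('v \<times> 'v::zero) set \<Rightarrow> 'v set" where
  "zeros A = {x. (x, 0) \<in> A}"

definition filtration_usual :: "'a measure \<Rightarrow> (real \<Rightarrow> 'a measure) \<Rightarrow> bool" where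
  "filtration_usual M F \<longleftrightarrow>
     (\<forall>t. space (F t) = space M \<and> sets (F t) \<subseteq> sets M)
   \<and> (\<forall>s t. 0 \<le> s \<longrightarrow> s \<le> t \<longrightarrow> sets (F s) \<subseteq> sets (F t))
   \<comment> \<open>completeness: F 0 contains all P-null sets\<close>
   \<and> (\<forall>N A. A \<in> sets M \<longrightarrow> emeasure M A = 0 \<longrightarrow> N \<subseteq> A \<longrightarrow> N \<in> sets (F 0))
   \<comment> \<open>right continuity\<close>
   \<and> (\<forall>t\<ge>0. sets (F t) = (\<Inter>u\<in>{t<..}. sets (F u)))"

definition adapted :: "(real \<Rightarrow> 'a measure) \<Rightarrow> (real \<Rightarrow> 'a \<Rightarrow> 'b::topological_space) \<Rightarrow> bool" where
  "adapted F X \<longleftrightarrow> (\<forall>t\<ge>0. X t \<in> borel_measurable (F t))"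

definition progressive :: "(real \<Rightarrow> 'a measure) \<Rightarrow> (real \<Rightarrow> 'a \<Rightarrow> 'b::topological_space) \<Rightarrow> bool" where
  "progressive F X \<longleftrightarrow>
     (\<forall>t\<ge>0. (\<lambda>(s, \<omega>). X s \<omega>) \<in> borel_measurable (restrict_space borel {0..t} \<Otimes>\<^sub>M F t))"

definition continuous_paths :: "'a measure \<Rightarrow> (real \<Rightarrow> 'a \<Rightarrow> 'b::topological_space) \<Rightarrow> bool" where
  "continuous_paths M X \<longleftrightarrow> (\<forall>\<omega>\<in>space M. continuous_on {0..} (\<lambda>t. X t \<omega>))"

definition martingale :: "'a measure \<Rightarrow> (real \<Rightarrow> 'a measure) \<Rightarrow> (real \<Rightarrow> 'a \<Rightarrow> real) \<Rightarrow> bool" where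
  "martingale M F Z \<longleftrightarrow> adapted F Z \<and> (\<forall>t\<ge>0. integrable M (Z t))
     \<and> (\<forall>s t. 0 \<le> s \<longrightarrow> s \<le> t \<longrightarrow> (\<forall>A\<in>sets (F s).
           (\<integral>\<omega>\<in>A. Z t \<omega> \<partial>M) = (\<integral>\<omega>\<in>A. Z s \<omega> \<partial>M)))"

definition stopping_time_r :: "(real \<Rightarrow> 'a measure) \<Rightarrow> ('a \<Rightarrow> real) \<Rightarrow> bool" where
  "stopping_time_r F T \<longleftrightarrow> (\<forall>t\<ge>0. {\<omega>\<in>space (F t). T \<omega> \<le> t} \<in> sets (F t))"

definition local_martingale :: "'a measure \<Rightarrow> (real \<Rightarrow> 'a measure) \<Rightarrow> (real \<Rightarrow> 'a \<Rightarrow> real) \<Rightarrow> bool" where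
  "local_martingale M F Z \<longleftrightarrow>
     (\<exists>\<tau> :: nat \<Rightarrow> 'a \<Rightarrow> real.
        (\<forall>n. stopping_time_r F (\<tau> n) \<and> (\<forall>\<omega>\<in>space M. 0 \<le> \<tau> n \<omega>))
      \<and> (\<forall>\<omega>\<in>space M. mono (\<lambda>n. \<tau> n \<omega>) \<and> filterlim (\<lambda>n. \<tau> n \<omega>) at_top sequentially)
      \<and> (\<forall>n. martingale M F (\<lambda>t \<omega>. Z (min t (\<tau> n \<omega>)) \<omega>)))"

definition vec_local_martingale :: "'a measure \<Rightarrow> (real \<Rightarrow> 'a measure) \<Rightarrow> (real \<Rightarrow> 'a \<Rightarrow> real^'d) \<Rightarrow> bool" where
  "vec_local_martingale M F Z \<longleftrightarrow> (\<forall>i. local_martingale M F (\<lambda>t \<omega>. Z t \<omega> $ i))"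

definition gauss_density :: "real \<Rightarrow> real^'l \<Rightarrow> real" where
  "gauss_density h x = (2 * pi * h) powr (- real CARD('l) / 2) * exp (- (norm x)\<^sup>2 / (2 * h))"

definition brownian_motion :: "'a measure \<Rightarrow> (real \<Rightarrow> 'a measure) \<Rightarrow> (real \<Rightarrow> 'a \<Rightarrow> real^'l) \<Rightarrow> bool" where
  "brownian_motion M F B \<longleftrightarrow> adapted F B \<and> continuous_paths M B \<and> (\<forall>\<omega>\<in>space M. B 0 \<omega> = 0)
     \<and> (\<forall>s t. 0 \<le> s \<longrightarrow> s < t \<longrightarrow> (\<forall>A\<in>sets (F s). \<forall>U\<in>sets (borel :: (real^'l) measure).
          measure M ({\<omega>\<in>space M. B t \<omega> - B s \<omega> \<in> U} \<inter> A)
            = measure M A * (\<integral>x\<in>U. gauss_density (t - s) x \<partial>lborel)))"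

text \<open>Ito integral I = \<integral> H dB of a progressive R^(d x l)-valued integrand, characterised (as in
  Revuz--Yor, Prop. IV.2.4) as the unique continuous local martingale with I 0 = 0 and
  <I^i, B^j> = \<integral> H^{ij} ds, <I^i> = \<integral> \<Sum>_j (H^{ij})^2 ds.\<close>
definition ito_integral :: "'a measure \<Rightarrow> (real \<Rightarrow> 'a measure) \<Rightarrow> (real \<Rightarrow> 'a \<Rightarrow> real^'l)
     \<Rightarrow> (real \<Rightarrow> 'a \<Rightarrow> real^'l^'d) \<Rightarrow> (real \<Rightarrow> 'a \<Rightarrow> real^'d) \<Rightarrow> bool" where
  "ito_integral M F B H I \<longleftrightarrow> adapted F I \<and> continuous_paths M I \<and> (\<forall>\<omega>\<in>space M. I 0 \<omega> = 0)
     \<and> vec_local_martingale M F I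
     \<and> (\<forall>i j. local_martingale M F
           (\<lambda>t \<omega>. I t \<omega> $ i * B t \<omega> $ j - (\<integral>s\<in>{0..t}. H s \<omega> $ i $ j \<partial>lborel)))
     \<and> (\<forall>i. local_martingale M F
           (\<lambda>t \<omega>. (I t \<omega> $ i)\<^sup>2 - (\<integral>s\<in>{0..t}. (\<Sum>j\<in>UNIV. (H s \<omega> $ i $ j)\<^sup>2) \<partial>lborel)))"

definition sde_solution :: "'a measure \<Rightarrow> (real \<Rightarrow> 'a measure) \<Rightarrow> (real \<Rightarrow> 'a \<Rightarrow> real^'l)
    \<Rightarrow> ((real^'d) \<times> (real^'d)) set \<Rightarrow> ('a \<Rightarrow> real \<Rightarrow> real^'d \<Rightarrow> real^'l^'d) \<Rightarrow> ('a \<Rightarrow> real^'d)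
    \<Rightarrow> (real \<Rightarrow> 'a \<Rightarrow> real^'d) \<Rightarrow> (real \<Rightarrow> 'a \<Rightarrow> real^'d) \<Rightarrow> (real \<Rightarrow> 'a \<Rightarrow> real^'d) \<Rightarrow> bool" where
  "sde_solution M F B A \<sigma> X0 X Y Mt \<longleftrightarrow>
     continuous_paths M X \<and> continuous_paths M Y \<and> continuous_paths M Mt
   \<and> progressive F X \<and> progressive F Y \<and> progressive F Mt
   \<and> (\<forall>\<omega>\<in>space M. Y 0 \<omega> = 0 \<and> Mt 0 \<omega> = 0)
   \<and> (AE \<omega> in M. \<forall>t\<ge>0. X t \<omega> \<in> closure (op_dom A))
   \<and> progressive F (\<lambda>t \<omega>. \<sigma> \<omega> t (X t \<omega>))
   \<and> (AE \<omega> in M. \<forall>T\<ge>0. set_integrable lborel {0..T} (\<lambda>t. (norm (\<sigma> \<omega> t (X t \<omega>)))\<^sup>2))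
   \<and> (AE \<omega> in M. \<forall>T\<ge>0. bounded_variation_on (\<lambda>t. Y t \<omega>) 0 T)
   \<and> (\<forall>\<alpha> \<beta>. continuous_paths M \<alpha> \<and> continuous_paths M \<beta> \<and> adapted F \<alpha> \<and> adapted F \<beta>
        \<and> (\<forall>\<omega>\<in>space M. \<forall>t\<ge>0. (\<alpha> t \<omega>, \<beta> t \<omega>) \<in> A) \<longrightarrow>
        (AE \<omega> in M. \<forall>a b. 0 \<le> a \<longrightarrow> a \<le> b \<longrightarrow>
            rs_integral (\<lambda>t. X t \<omega> - \<alpha> t \<omega>) (\<lambda>t. Y t \<omega>) a b
              \<ge> (\<integral>t\<in>{a..b}. inner (X t \<omega> - \<alpha> t \<omega>) (\<beta> t \<omega>) \<partial>lborel)))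
   \<and> vec_local_martingale M F Mt
   \<and> (AE \<omega> in M. \<forall>t\<ge>0. \<forall>x\<in>op_dom A. \<forall>y\<in>op_dom A. inner (Mt t \<omega>) (x - y) = 0)
   \<and> (\<exists>I. ito_integral M F B (\<lambda>t \<omega>. \<sigma> \<omega> t (X t \<omega>)) I
        \<and> (AE \<omega> in M. \<forall>t\<ge>0. X t \<omega> = X0 \<omega> - Y t \<omega> + Mt t \<omega> + I t \<omega>))"

text \<open>\<sigma>_\<infinity>(\<omega>,t) = sup_x \<parallel>\<sigma>(\<omega>,t,x)\<parallel> (Frobenius norm = the norm of real^'l^'d), in [0,\<infinity>].\<close>
definition sigma_inf :: "('a \<Rightarrow> real \<Rightarrow> real^'d \<Rightarrow> real^'l^'d) \<Rightarrow> 'a \<Rightarrow> real \<Rightarrow> ennreal" where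
  "sigma_inf \<sigma> \<omega> t = (SUP x. ennreal (norm (\<sigma> \<omega> t x)))"

end

theory Submission
  imports Defs
begin

text \<open>
  Let \<open>S\<close> be the span of the differences of points of the domain of \<open>A\<close> and \<open>P\<close> the orthogonal
  projection onto \<open>S\<close>.  For a zero \<open>xs\<close> the process \<open>Z = X - xs\<close> lives in \<open>S\<close>, the term \<open>Mt\<close> is
  orthogonal to \<open>S\<close>, and \<open>V = Z - P I\<close>, where \<open>I\<close> is the stochastic integral, has bounded variation.
  Summation by parts therefore evaluates the limit \<open>N\<close> of the Riemann sums of \<open>V\<close> against \<open>I\<close>
  pathwise, as half the increment of \<open>norm Z ^ 2 - norm (P I) ^ 2\<close> plus the Stieltjes integral of
  \<open>Z\<close> against \<open>Y\<close>; no stochastic calculus is involved.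

  A Riemann sum of \<open>V\<close> is bounded by twice the maximum of \<open>norm V\<close> times the maximum of the discrete
  martingale transform of \<open>V\<close> divided by its running maximum, and the latter is controlled in \<open>L\<^sup>2\<close>
  by Doob's inequality.  By Fatou this bounds \<open>N\<close> linearly in the supremum of \<open>norm Z\<close>, which gives
  the moment bound (b) without localisation.  Uniform integrability then shows that \<open>N\<close> has
  expectation zero, hence (a), and the same bound on the tails makes \<open>N\<close> converge almost surely;
  since the Stieltjes integral of \<open>Z\<close> against \<open>Y\<close> is nondecreasing, \<open>norm Z\<close> converges, hence (c).
  Finally, monotonicity against arbitrary points of the graph makes every cluster point of the time
  averages a zero, and an Opial argument gives (d).
\<close>

section \<open>Riemann--Stieltjes integrals\<close>

text \<open>Two obstacles shape the proof. The term \<open>Mt\<close> comes with no bound at all,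
  and nothing is known in advance about the integrability of \<open>V\<close>. Projecting by
  \<open>P\<close> removes \<open>Mt\<close> at no cost: \<open>Z\<close> is fixed by
  \<open>P\<close>, so the integral of \<open>Z\<close> against \<open>Y\<close> sees only
  \<open>P Y\<close>. The second obstacle is met by a normalisation whose constant depends on the
  energy of \<open>I\<close> alone, whatever \<open>V\<close> is. This leaves an inequality of the
  type z^2 <= const + z * kappa with kappa in L2, which Young's inequality closes. Computed on
  \<open>{s..}\<close>, the same constant is the tail of a convergent integral, and this is the
  smallness behind almost sure convergence. The grids are dyadic because they are nested: one
  majorant serves all dyadic times after \<open>s\<close>, and path continuity supplies the other
  times. The square integrability of \<open>I\<close> has to be derived, since the Ito integral is
  characterised by local martingale properties; optional stopping enters to give the two kinds of
  local martingale a common localising sequence.\<close>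

lemma is_partition_mono:
  assumes "is_partition a b n p" "i \<le> j" "j \<le> n"
  shows "p i \<le> p j"
  using assms(2,3)
proof (induction j rule: dec_induct)
  case (step k)
  with assms(1) have "p k < p (Suc k)" by (auto simp: is_partition_def)
  with step show ?case by auto
qed auto

lemma is_partition_le: "is_partition a b n p \<Longrightarrow> a \<le> b"
  using is_partition_mono[of a b n p 0 n] by (auto simp: is_partition_def)

lemma is_partition_snoc:
  assumes "is_partition a s n p" "s < t"
  shows "is_partition a t (Suc n) (p(Suc n := t))"
  using assms by (auto simp: is_partition_def less_Suc_eq)

lemma is_partition_trivial: "is_partition a a n p \<longleftrightarrow> n = 0 \<and> p 0 = a"
proof
  assume *: "is_partition a a n p"
  have "n = 0"
  proof (rule ccontr)
    assume "n \<noteq> 0"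
    then have "p 0 < p 1" using * by (auto simp: is_partition_def)
    moreover have "p 1 \<le> p n" using is_partition_mono[OF *, of 1 n] \<open>n \<noteq> 0\<close> by auto
    ultimately show False using * by (auto simp: is_partition_def)
  qed
  then show "n = 0 \<and> p 0 = a" using * by (auto simp: is_partition_def)
qed (auto simp: is_partition_def)

lemma is_partition_uniform:
  fixes a b :: real
  assumes "a < b" "0 < n"
  shows "is_partition a b n (\<lambda>k. a + (b - a) * real k / real n)"
  using assms by (auto simp: is_partition_def field_simps)

text \<open>Partitions increase strictly, so a partition of the shorter interval can be extended by
  the point \<open>c\<close> only if \<open>b < c\<close>; this forces the case split.\<close>

lemma bounded_variation_on_subinterval:
  fixes g :: "real \<Rightarrow> 'v::real_normed_vector"
  assumes "bounded_variation_on g a c" "b \<le> c"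
  shows "bounded_variation_on g a b"
proof (cases "b = c")
  case False
  then have "b < c" using assms by simp
  obtain K where K: "\<And>n p. is_partition a c n p \<Longrightarrow> (\<Sum>k<n. norm (g (p (Suc k)) - g (p k))) \<le> K"
    using assms by (auto simp: bounded_variation_on_def)
  show ?thesis unfolding bounded_variation_on_def
  proof (intro exI[of _ K] allI impI)
    fix n p assume p: "is_partition a b n p"
    have "(\<Sum>k<n. norm (g (p (Suc k)) - g (p k)))
        = (\<Sum>k<n. norm (g ((p(Suc n := c)) (Suc k)) - g ((p(Suc n := c)) k)))"
      by (intro sum.cong) auto
    also have "\<dots> \<le> (\<Sum>k<Suc n. norm (g ((p(Suc n := c)) (Suc k)) - g ((p(Suc n := c)) k)))"
      by simp
    also have "\<dots> \<le> K" by (rule K[OF is_partition_snoc[OF p \<open>b < c\<close>]])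
    finally show "(\<Sum>k<n. norm (g (p (Suc k)) - g (p k))) \<le> K" .
  qed
qed (use assms in auto)

lemma bounded_variation_on_subinterval_left:
  fixes g :: "real \<Rightarrow> 'v::real_normed_vector"
  assumes "bounded_variation_on g a c" "a \<le> b"
  shows "bounded_variation_on g b c"
proof (cases "a = b")
  case False
  then have "a < b" using assms by simp
  obtain K where K: "\<And>n p. is_partition a c n p \<Longrightarrow> (\<Sum>k<n. norm (g (p (Suc k)) - g (p k))) \<le> K"
    using assms by (auto simp: bounded_variation_on_def)
  show ?thesis unfolding bounded_variation_on_def
  proof (intro exI[of _ K] allI impI)
    fix n p assume p: "is_partition b c n p"
    let ?q = "\<lambda>k. case k of 0 \<Rightarrow> a | Suc j \<Rightarrow> p j"
    have q: "is_partition a c (Suc n) ?q"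
      using p \<open>a < b\<close> by (auto simp: is_partition_def split: nat.split)
    have "(\<Sum>k<n. norm (g (p (Suc k)) - g (p k)))
       \<le> norm (g (?q 1) - g (?q 0)) + (\<Sum>k<n. norm (g (?q (Suc (Suc k))) - g (?q (Suc k))))"
      by simp
    also have "\<dots> = (\<Sum>k<Suc n. norm (g (?q (Suc k)) - g (?q k)))"
      by (simp only: sum.lessThan_Suc_shift) simp
    also have "\<dots> \<le> K" by (rule K[OF q])
    finally show "(\<Sum>k<n. norm (g (p (Suc k)) - g (p k))) \<le> K" .
  qed
qed (use assms in auto)

text \<open>Taking the right limits of the total variation makes it right continuous without a proof that
  the total variation of a continuous function is continuous.\<close>
lemma bounded_variation_on_dominating:
  fixes g :: "real \<Rightarrow> 'v::real_normed_vector"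
  assumes bv: "bounded_variation_on g a b" and cont: "continuous_on {a..b} g" and "a \<le> b"
  obtains w :: "real \<Rightarrow> real" where "mono w" "\<And>x. continuous (at_right x) w"
    "\<And>s t. s \<le> t \<Longrightarrow> norm (g (max a (min b t)) - g (max a (min b s))) \<le> w t - w s"
proof -
  obtain K where K: "\<And>n p. is_partition a b n p \<Longrightarrow> (\<Sum>k<n. norm (g (p (Suc k)) - g (p k))) \<le> K"
    using bv by (auto simp: bounded_variation_on_def)
  \<comment> \<open>Clamping extends \<open>g\<close> by constants beyond \<open>{a..b}\<close>, so
    that the dominating function is monotone on the whole line, as \<open>interval_measure\<close>
    demands.\<close>
  define c where "c t = max a (min b t)" for t
  have c: "a \<le> c t" "c t \<le> b" for t using \<open>a \<le> b\<close> by (auto simp: c_def)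
  have c_mono: "s \<le> t \<Longrightarrow> c s \<le> c t" for s t by (auto simp: c_def)
  define S where "S t = {\<Sum>k<n. norm (g (p (Suc k)) - g (p k)) | n p. is_partition a t n p}" for t
  define v where "v t = Sup (S (c t))" for t
  have bdd: "bdd_above (S t)" if tb: "t \<le> b" for t
  proof -
    obtain K where "\<And>n p. is_partition a t n p \<Longrightarrow> (\<Sum>k<n. norm (g (p (Suc k)) - g (p k))) \<le> K"
      using bounded_variation_on_subinterval[OF bv tb] by (auto simp: bounded_variation_on_def)
    then show ?thesis by (auto simp: S_def intro!: bdd_aboveI[of _ K])
  qed
  have ne: "S t \<noteq> {}" if "a \<le> t" for t
  proof (cases "a = t")
    case True
    then have "is_partition a t 0 (\<lambda>_. a)" by (simp add: is_partition_def)
    then show ?thesis by (auto simp: S_def)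
  next
    case False
    then show ?thesis using is_partition_uniform[of a t 1] that by (auto simp: S_def)
  qed
  have Sup_incr: "Sup (S s) + norm (g t - g s) \<le> Sup (S t)" if "a \<le> s" "s \<le> t" "t \<le> b" for s t
  proof (cases "s = t")
    case False
    then have st: "s < t" using that by simp
    have "x \<le> Sup (S t) - norm (g t - g s)" if "x \<in> S s" for x
    proof -
      from that obtain n p where p: "is_partition a s n p"
        and x: "x = (\<Sum>k<n. norm (g (p (Suc k)) - g (p k)))" by (auto simp: S_def)
      let ?q = "p(Suc n := t)"
      have "(\<Sum>k<Suc n. norm (g (?q (Suc k)) - g (?q k))) \<in> S t"
        unfolding S_def using is_partition_snoc[OF p st] by blast
      then have "(\<Sum>k<Suc n. norm (g (?q (Suc k)) - g (?q k))) \<le> Sup (S t)"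
        by (rule cSup_upper) (use bdd \<open>t \<le> b\<close> in auto)
      moreover have "(\<Sum>k<Suc n. norm (g (?q (Suc k)) - g (?q k))) = x + norm (g t - g s)"
        using p by (auto simp: x is_partition_def intro!: sum.cong)
      ultimately show ?thesis by simp
    qed
    then have "Sup (S s) \<le> Sup (S t) - norm (g t - g s)" by (intro cSup_least ne that)
    then show ?thesis by simp
  qed simp
  have v_incr: "norm (g (c t) - g (c s)) \<le> v t - v s" if "s \<le> t" for s t
    using Sup_incr[of "c s" "c t"] c c_mono[OF that] by (auto simp: v_def)
  have v_mono: "v s \<le> v t" if "s \<le> t" for s t
    using v_incr[OF that] norm_ge_zero[of "g (c t) - g (c s)"] by linarith
  \<comment> \<open>To the left of \<open>a\<close> the function \<open>v\<close> is constant. It is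
    therefore bounded below, and the infimum that defines \<open>w\<close> is a genuine one.\<close>
  have v_lower: "v (min s a) \<le> v s" for s by (intro v_mono) auto
  have va: "v (min s a) = v a" for s
  proof -
    have "c (min s a) = c a" using \<open>a \<le> b\<close> by (auto simp: c_def)
    then show ?thesis by (simp add: v_def)
  qed
  have v_ge: "v a \<le> v s" for s using v_lower[of s] va by simp
  have bddv: "bdd_below (v ` {t<..})" for t by (rule bdd_belowI[of _ "v a"]) (use v_ge in auto)
  define w where "w t = (INF s\<in>{t<..}. v s)" for t
  have w_le: "w t \<le> v s" if "t < s" for t s
    unfolding w_def by (rule cINF_lower[OF bddv]) (use that in auto)
  have w_less: "\<exists>s>t. v s < y" if "w t < y" for t y
  proof (rule ccontr)
    assume "\<not> ?thesis"
    then have *: "y \<le> v s" if "s > t" for s using that by (meson not_less)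
    have "y \<le> w t" unfolding w_def
      by (intro cINF_greatest) (auto intro: *)
    with that show False by simp
  qed
  have v_ge_w: "v t \<le> w t" for t
    unfolding w_def by (intro cINF_greatest) (auto intro: v_mono)
  have lim: "(v \<longlongrightarrow> w t) (at_right t)" for t
  proof (rule order_tendstoI)
    fix y assume "y < w t"
    then show "\<forall>\<^sub>F s in at_right t. y < v s"
      by (auto simp: eventually_at_filter intro!: always_eventually intro: less_le_trans w_le)
  next
    fix y assume "w t < y"
    then obtain s where "s > t" "v s < y" using w_less by blast
    then show "\<forall>\<^sub>F s in at_right t. v s < y"
      by (subst eventually_at_right[of _ s]) (auto intro!: exI[of _ s] le_less_trans[OF v_mono \<open>v s < y\<close>])
  qed
  have w_mono: "mono w"
  proof (rule monoI)
    fix s t :: real assume "s \<le> t"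
    show "w s \<le> w t" unfolding w_def[of t]
      by (rule cINF_greatest) (use \<open>s \<le> t\<close> in \<open>auto intro!: w_le\<close>)
  qed
  have w_right: "continuous (at_right t) w" for t
    unfolding continuous_within
  proof (rule order_tendstoI)
    fix y assume "y < w t"
    then show "\<forall>\<^sub>F s in at_right t. y < w s"
      using w_mono by (auto simp: eventually_at_filter mono_def intro!: always_eventually
          intro: less_le_trans)
  next
    fix y assume "w t < y"
    then obtain s where "s > t" "v s < y" using w_less by blast
    then show "\<forall>\<^sub>F s in at_right t. w s < y"
      by (subst eventually_at_right[of _ s]) (auto intro!: exI[of _ s] le_less_trans[OF w_le \<open>v s < y\<close>])
  qed
  \<comment> \<open>The increment bound holds for \<open>v\<close>. It is applied at times shifted
    to the right by \<open>e n\<close>: as the shift vanishes, \<open>v\<close> tends to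
    \<open>w\<close>, while \<open>g\<close> is continuous and returns its unshifted values.\<close>
  have w_incr: "norm (g (c t) - g (c s)) \<le> w t - w s" if "s \<le> t" for s t
  proof -
    define e where "e n = 1 / real (Suc n)" for n
    have e: "e \<longlonglongrightarrow> 0" unfolding e_def by (rule LIMSEQ_Suc[OF lim_1_over_n])
    have "e n > 0" for n by (simp add: e_def)
    then have fl: "filterlim (\<lambda>n. x + e n) (at_right x) sequentially" for x
      unfolding filterlim_at using tendsto_add[OF tendsto_const e, of x] by (auto simp: less_le)
    have lim1: "(\<lambda>n. v (t + e n) - v (s + e n)) \<longlonglongrightarrow> w t - w s"
      by (intro tendsto_diff filterlim_compose[OF lim fl])
    have lim2: "(\<lambda>n. norm (g (c (t + e n)) - g (c (s + e n)))) \<longlonglongrightarrow> norm (g (c t) - g (c s))"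
    proof -
      have "(\<lambda>n. g (c (x + e n))) \<longlonglongrightarrow> g (c x)" for x
      proof (rule continuous_on_tendsto_compose[OF cont])
        have "(\<lambda>n. max a (min b (x + e n))) \<longlonglongrightarrow> max a (min b (x + 0))"
          by (intro tendsto_intros e)
        then show "(\<lambda>n. c (x + e n)) \<longlonglongrightarrow> c x" by (simp add: c_def)
      qed (use c in auto)
      then show ?thesis by (intro tendsto_intros)
    qed
    show ?thesis
      by (rule LIMSEQ_le[OF lim2 lim1]) (use v_incr \<open>s \<le> t\<close> in \<open>auto intro!: exI[of _ 0]\<close>)
  qed
  show ?thesis by (rule that[OF w_mono w_right w_incr[unfolded c_def]])
qed


section \<open>Existence of the Riemann--Stieltjes integral\<close>

lemma set_integrable_continuous_finite:
  fixes f :: "real \<Rightarrow> real"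
  assumes "continuous_on {a..b} f" "sets \<mu> = sets borel" "emeasure \<mu> {a<..b} < \<infinity>"
  shows "set_integrable \<mu> {a<..b} f"
proof -
  obtain C where C: "\<And>x. x \<in> {a..b} \<Longrightarrow> norm (f x) \<le> C"
    using compact_imp_bounded[OF compact_continuous_image[OF assms(1) compact_Icc]]
    unfolding bounded_iff by blast
  have "(\<lambda>x. indicator {a<..b} x *\<^sub>R f x) \<in> borel_measurable borel"
    by (rule borel_measurable_continuous_on_indicator)
       (use assms(1) in \<open>auto intro: continuous_on_subset\<close>)
  then have m: "(\<lambda>x. indicator {a<..b} x *\<^sub>R f x) \<in> borel_measurable \<mu>"
    using measurable_cong_sets[OF assms(2) refl] by blast
  show ?thesis unfolding set_integrable_def
  proof (rule Bochner_Integration.integrable_bound[OF _ m])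
    show "integrable \<mu> (\<lambda>x. indicator {a<..b} x * C)"
      using assms by (intro integrable_mult_left) auto
    show "AE x in \<mu>. norm (indicator {a<..b} x *\<^sub>R f x) \<le> norm (indicator {a<..b} x * C)"
    proof (rule AE_I2)
      fix x
      show "norm (indicator {a<..b} x *\<^sub>R f x) \<le> norm (indicator {a<..b} x * C)"
        using C[of x] by (cases "x \<in> {a<..b}") auto
    qed
  qed
qed

text \<open>Half-open cells tile \<open>{a<..b}\<close> without overlap, so an atom of
  \<open>\<mu>\<close> is counted exactly once.\<close>

lemma set_integral_partition:
  fixes f :: "real \<Rightarrow> real"
  assumes p: "is_partition a b n p" and int: "set_integrable \<mu> {a<..b} f"
    and sets: "sets \<mu> = sets borel"
  shows "(LINT x:{a<..b}|\<mu>. f x) = (\<Sum>k<n. LINT x:{p k<..p (Suc k)}|\<mu>. f x)"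
proof -
  have "(LINT x:{a<..p m}|\<mu>. f x) = (\<Sum>k<m. LINT x:{p k<..p (Suc k)}|\<mu>. f x)" if "m \<le> n" for m
    using that
  proof (induction m)
    case 0
    then show ?case using p by (simp add: is_partition_def set_lebesgue_integral_def)
  next
    case (Suc m)
    have le: "a \<le> p m" "p m \<le> p (Suc m)" "p (Suc m) \<le> b"
      using is_partition_mono[OF p, of 0 m] is_partition_mono[OF p, of m "Suc m"]
        is_partition_mono[OF p, of "Suc m" n] Suc.prems p by (auto simp: is_partition_def)
    have eq: "{a<..p (Suc m)} = {a<..p m} \<union> {p m<..p (Suc m)}" using le by auto
    have "(LINT x:{a<..p (Suc m)}|\<mu>. f x)
       = (LINT x:{a<..p m}|\<mu>. f x) + (LINT x:{p m<..p (Suc m)}|\<mu>. f x)"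
      unfolding eq
      by (intro set_integral_Un set_integrable_subset[OF int]) (use le sets in auto)
    with Suc show ?case by simp
  qed
  from this[of n] p show ?thesis by (simp add: is_partition_def)
qed

text \<open>A cell has mass \<open>w (p (Suc k)) - w (p k)\<close> under
  \<open>interval_measure w\<close>, so each term of the sum is the integral of the constant
  \<open>f (\<xi> k)\<close> over its cell. The error per cell is at most the oscillation
  \<open>e\<close> times the mass, and the masses telescope.\<close>

lemma stieltjes_sum_approx:
  fixes f w :: "real \<Rightarrow> real"
  assumes f: "continuous_on {a..b} f" and w: "mono w" "\<And>x. continuous (at_right x) w"
    and osc: "\<And>x y. x \<in> {a..b} \<Longrightarrow> y \<in> {a..b} \<Longrightarrow> \<bar>x - y\<bar> < d \<Longrightarrow> \<bar>f x - f y\<bar> \<le> e"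
    and p: "is_partition a b n p" and mesh: "\<And>k. k < n \<Longrightarrow> p (Suc k) - p k < d"
    and tag: "\<And>k. k < n \<Longrightarrow> p k \<le> \<xi> k \<and> \<xi> k \<le> p (Suc k)"
  shows "\<bar>(\<Sum>k<n. f (\<xi> k) * (w (p (Suc k)) - w (p k))) - (LINT x:{a<..b}|interval_measure w. f x)\<bar>
      \<le> e * (w b - w a)"
proof -
  let ?\<mu> = "interval_measure w"
  have em: "emeasure ?\<mu> {x<..y} = ennreal (w y - w x)" if "x \<le> y" for x y
    using emeasure_interval_measure_Ioc[OF that] w by (auto simp: mono_def)
  have me: "measure ?\<mu> {x<..y} = w y - w x" if "x \<le> y" for x y
    using em[OF that] w(1) that by (simp add: measure_def mono_def)
  have ab: "a \<le> b" using is_partition_le[OF p] .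
  have int: "set_integrable ?\<mu> {a<..b} f"
    by (rule set_integrable_continuous_finite[OF f]) (use em[OF ab] in auto)
  have cell: "\<bar>f (\<xi> k) * (w (p (Suc k)) - w (p k)) - (LINT x:{p k<..p (Suc k)}|?\<mu>. f x)\<bar>
      \<le> e * (w (p (Suc k)) - w (p k))" if k: "k < n" for k
  proof -
    have le: "a \<le> p k" "p k \<le> p (Suc k)" "p (Suc k) \<le> b"
      using is_partition_mono[OF p, of 0 k] is_partition_mono[OF p, of k "Suc k"]
        is_partition_mono[OF p, of "Suc k" n] k p by (auto simp: is_partition_def)
    let ?C = "{p k<..p (Suc k)}"
    have intC: "set_integrable ?\<mu> ?C f"
      by (rule set_integrable_subset[OF int]) (use le in auto)
    have intc: "set_integrable ?\<mu> ?C (\<lambda>_. c)" for c :: real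
      unfolding set_integrable_def using em[OF le(2)] by auto
    have c: "(LINT x:?C|?\<mu>. c) = c * (w (p (Suc k)) - w (p k))" for c :: real
      unfolding set_lebesgue_integral_def using me[OF le(2)] by simp
    have "f (\<xi> k) * (w (p (Suc k)) - w (p k)) - (LINT x:?C|?\<mu>. f x)
        = (LINT x:?C|?\<mu>. f (\<xi> k) - f x)"
      by (subst set_integral_diff(2)[OF intc intC]) (simp add: c)
    also have "\<bar>\<dots>\<bar> \<le> (LINT x:?C|?\<mu>. e)"
      unfolding set_lebesgue_integral_def real_norm_def[symmetric]
    proof (rule order_trans[OF integral_norm_bound integral_mono])
      show "integrable ?\<mu> (\<lambda>x. norm (indicator ?C x *\<^sub>R (f (\<xi> k) - f x)))"
        using set_integral_diff(1)[OF intc intC] by (intro integrable_norm) (simp add: set_integrable_def)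
      show "integrable ?\<mu> (\<lambda>x. indicator ?C x *\<^sub>R e)"
        using intc by (simp add: set_integrable_def)
      fix x
      show "norm (indicator ?C x *\<^sub>R (f (\<xi> k) - f x)) \<le> indicator ?C x *\<^sub>R e"
      proof (cases "x \<in> ?C")
        case True
        have "\<bar>f (\<xi> k) - f x\<bar> \<le> e"
          by (rule osc) (use True tag[OF k] mesh[OF k] le in auto)
        then show ?thesis using True by simp
      qed simp
    qed
    finally show ?thesis by (simp add: c)
  qed
  have "(\<Sum>k<n. f (\<xi> k) * (w (p (Suc k)) - w (p k))) - (LINT x:{a<..b}|?\<mu>. f x)
      = (\<Sum>k<n. f (\<xi> k) * (w (p (Suc k)) - w (p k)) - (LINT x:{p k<..p (Suc k)}|?\<mu>. f x))"
    by (simp add: set_integral_partition[OF p int] sum_subtractf)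
  also have "\<bar>\<dots>\<bar> \<le> (\<Sum>k<n. e * (w (p (Suc k)) - w (p k)))"
    by (rule order_trans[OF sum_abs]) (use cell in \<open>auto intro!: sum_mono\<close>)
  also have "\<dots> = e * (w b - w a)"
    using p sum_lessThan_telescope[of "\<lambda>k. w (p k)" n]
    by (simp add: sum_distrib_left[symmetric] is_partition_def)
  finally show ?thesis .
qed

lemma rs_has_integral_exists:
  fixes f g :: "real \<Rightarrow> 'v::euclidean_space"
  assumes f: "continuous_on {a..b} f" and g: "continuous_on {a..b} g"
    and bv: "bounded_variation_on g a b" and "a \<le> b"
  shows "\<exists>I. rs_has_integral f g a b I"
proof -
  obtain w where w: "mono w" "\<And>x. continuous (at_right x) w"
    and wg: "\<And>s t. s \<le> t \<Longrightarrow> norm (g (max a (min b t)) - g (max a (min b s))) \<le> w t - w s"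
    using bounded_variation_on_dominating[OF bv g \<open>a \<le> b\<close>] by metis
  define G where "G t = g (max a (min b t))" for t
  have Gg: "G t = g t" if "t \<in> {a..b}" for t using that by (auto simp: G_def)
  have contG: "continuous_on UNIV G" unfolding G_def
    by (rule continuous_on_compose2[OF g]) (use \<open>a \<le> b\<close> in \<open>auto intro!: continuous_intros\<close>)
  \<comment> \<open>Jordan decomposition: the coordinate \<open>i\<close> of \<open>G\<close> is
    \<open>w - u i\<close>, a difference of two nondecreasing right-continuous functions, each of
    which defines a measure.\<close>
  define u where "u i t = w t - G t \<bullet> i" for i t
  have u: "mono (u i)" "continuous (at_right x) (u i)" if "i \<in> Basis" for i x
  proof -
    show "mono (u i)"
    proof (rule monoI)
      fix s t :: real assume "s \<le> t"
      have "(G t - G s) \<bullet> i \<le> norm (G t - G s)"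
        using Basis_le_norm[OF that, of "G t - G s"] by simp
      also have "\<dots> \<le> w t - w s" using wg[OF \<open>s \<le> t\<close>] by (simp add: G_def)
      finally show "u i s \<le> u i t" by (simp add: u_def inner_diff_left)
    qed
    have "continuous (at_right x) G"
      using contG by (auto simp: continuous_on_eq_continuous_at intro: continuous_at_imp_continuous_at_within)
    then show "continuous (at_right x) (u i)" unfolding u_def by (intro continuous_intros w)
  qed
  define I where "I = (\<Sum>i\<in>Basis. (LINT x:{a<..b}|interval_measure w. f x \<bullet> i)
      - (LINT x:{a<..b}|interval_measure (u i). f x \<bullet> i))"
  \<comment> \<open>The total mass of all measures involved. The added 1 makes \<open>C\<close>
    positive and puts the final error \<open>e / C * (C - 1)\<close> strictly below
    \<open>e\<close>.\<close>
  define C where "C = (\<Sum>i\<in>(Basis::'v set). (w b - w a) + (u i b - u i a)) + 1"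
  have Cpos: "C > 0"
  proof -
    have "(\<Sum>i\<in>(Basis::'v set). (w b - w a) + (u i b - u i a)) \<ge> 0"
      using w(1) u(1) \<open>a \<le> b\<close> by (intro sum_nonneg add_nonneg_nonneg) (auto simp: mono_def)
    then show ?thesis by (simp add: C_def)
  qed
  have "rs_has_integral f g a b I" unfolding rs_has_integral_def
  proof (intro allI impI)
    fix e :: real assume "e > 0"
    then have e': "e / C > 0" using Cpos by simp
    have "uniformly_continuous_on {a..b} f" by (rule compact_uniformly_continuous[OF f]) simp
    then obtain d where d: "d > 0" and
      dist: "\<And>x y. x \<in> {a..b} \<Longrightarrow> y \<in> {a..b} \<Longrightarrow> dist y x < d \<Longrightarrow> dist (f y) (f x) < e / C"
      unfolding uniformly_continuous_on_def using e' by metis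
    show "\<exists>d>0. \<forall>n p xi. is_partition a b n p \<longrightarrow> (\<forall>k<n. p (Suc k) - p k < d)
        \<longrightarrow> (\<forall>k<n. p k \<le> xi k \<and> xi k \<le> p (Suc k))
        \<longrightarrow> \<bar>(\<Sum>k<n. inner (f (xi k)) (g (p (Suc k)) - g (p k))) - I\<bar> < e"
    proof (intro exI[of _ d] conjI d allI impI)
      fix n p xi
      assume p: "is_partition a b n p" and m: "\<forall>k<n. p (Suc k) - p k < d"
        and t: "\<forall>k<n. p k \<le> xi k \<and> xi k \<le> p (Suc k)"
      have approx: "\<bar>(\<Sum>k<n. (f (xi k) \<bullet> i) * (v (p (Suc k)) - v (p k)))
          - (LINT x:{a<..b}|interval_measure v. f x \<bullet> i)\<bar> \<le> e / C * (v b - v a)"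
        if i: "i \<in> Basis" and v: "mono v" "\<And>x. continuous (at_right x) v" for v i
      proof (rule stieltjes_sum_approx[OF _ v _ p])
        show "continuous_on {a..b} (\<lambda>x. f x \<bullet> i)" by (intro continuous_intros f)
        fix x y assume xy: "x \<in> {a..b}" "y \<in> {a..b}" "\<bar>x - y\<bar> < d"
        have "\<bar>f x \<bullet> i - f y \<bullet> i\<bar> \<le> norm (f x - f y)"
          using Basis_le_norm[OF i, of "f x - f y"] by (simp add: inner_diff_left)
        also have "\<dots> \<le> e / C" using dist[OF xy(2,1)] xy(3) by (simp add: dist_norm less_imp_le)
        finally show "\<bar>f x \<bullet> i - f y \<bullet> i\<bar> \<le> e / C" .
      qed (use m t in auto)
      have inr: "p k \<in> {a..b}" if "k \<le> n" for k
        using is_partition_mono[OF p, of 0 k] is_partition_mono[OF p, of k n] that p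
        by (auto simp: is_partition_def)
      have "(\<Sum>k<n. inner (f (xi k)) (g (p (Suc k)) - g (p k)))
          = (\<Sum>k<n. \<Sum>i\<in>Basis. (f (xi k) \<bullet> i) * (w (p (Suc k)) - w (p k))
               - (f (xi k) \<bullet> i) * (u i (p (Suc k)) - u i (p k)))"
      proof (rule sum.cong[OF refl])
        fix k assume "k \<in> {..<n}"
        then have "g (p (Suc k)) = G (p (Suc k))" "g (p k) = G (p k)"
          using inr[of k] inr[of "Suc k"] by (auto simp: Gg)
        then show "inner (f (xi k)) (g (p (Suc k)) - g (p k))
          = (\<Sum>i\<in>Basis. (f (xi k) \<bullet> i) * (w (p (Suc k)) - w (p k))
               - (f (xi k) \<bullet> i) * (u i (p (Suc k)) - u i (p k)))"
          by (subst euclidean_inner) (simp add: u_def inner_diff_left algebra_simps)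
      qed
      also have "\<dots> = (\<Sum>i\<in>Basis. (\<Sum>k<n. (f (xi k) \<bullet> i) * (w (p (Suc k)) - w (p k)))
               - (\<Sum>k<n. (f (xi k) \<bullet> i) * (u i (p (Suc k)) - u i (p k))))"
        by (subst sum.swap) (simp add: sum_subtractf)
      finally have eq: "(\<Sum>k<n. inner (f (xi k)) (g (p (Suc k)) - g (p k)))
          = (\<Sum>i\<in>Basis. (\<Sum>k<n. (f (xi k) \<bullet> i) * (w (p (Suc k)) - w (p k)))
               - (\<Sum>k<n. (f (xi k) \<bullet> i) * (u i (p (Suc k)) - u i (p k))))" .
      have "\<bar>(\<Sum>k<n. inner (f (xi k)) (g (p (Suc k)) - g (p k))) - I\<bar>
          = \<bar>\<Sum>i\<in>Basis. ((\<Sum>k<n. (f (xi k) \<bullet> i) * (w (p (Suc k)) - w (p k)))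
                - (LINT x:{a<..b}|interval_measure w. f x \<bullet> i))
              - ((\<Sum>k<n. (f (xi k) \<bullet> i) * (u i (p (Suc k)) - u i (p k)))
                - (LINT x:{a<..b}|interval_measure (u i). f x \<bullet> i))\<bar>"
        unfolding I_def eq
        by (subst sum_subtractf[symmetric], rule arg_cong[of _ _ abs], rule sum.cong) simp_all
      also have "\<dots> \<le> (\<Sum>i\<in>Basis. e / C * (w b - w a) + e / C * (u i b - u i a))"
        by (rule order_trans[OF sum_abs], rule sum_mono, rule order_trans[OF abs_triangle_ineq4],
            rule add_mono) (use approx[OF _ w] approx[OF _ u] in auto)
      also have "\<dots> = e / C * (C - 1)"
        by (simp add: C_def sum_distrib_left distrib_left)
      also have "\<dots> < e" using Cpos \<open>e > 0\<close> by (simp add: field_simps)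
      finally show "\<bar>(\<Sum>k<n. inner (f (xi k)) (g (p (Suc k)) - g (p k))) - I\<bar> < e" .
    qed
  qed
  then show ?thesis ..
qed

section \<open>Uniform partitions, uniqueness and additivity\<close>

lemma rs_has_integralD:
  assumes "rs_has_integral f g a b I" "e > 0"
  obtains d where "d > 0" "\<And>n p xi. is_partition a b n p \<Longrightarrow> (\<forall>k<n. p (Suc k) - p k < d)
        \<Longrightarrow> (\<forall>k<n. p k \<le> xi k \<and> xi k \<le> p (Suc k))
        \<Longrightarrow> \<bar>(\<Sum>k<n. inner (f (xi k)) (g (p (Suc k)) - g (p k))) - I\<bar> < e"
proof -
  from assms have "\<exists>d>0. \<forall>n p xi. is_partition a b n p \<longrightarrow> (\<forall>k<n. p (Suc k) - p k < d)
        \<longrightarrow> (\<forall>k<n. p k \<le> xi k \<and> xi k \<le> p (Suc k))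
        \<longrightarrow> \<bar>(\<Sum>k<n. inner (f (xi k)) (g (p (Suc k)) - g (p k))) - I\<bar> < e"
    unfolding rs_has_integral_def by (elim allE[of _ e]) (rule mp)
  then show thesis by (elim exE conjE) (rule that, assumption, blast)
qed

lemma uniform_mesh_small:
  fixes a b d :: real
  assumes "d > 0"
  shows "\<forall>\<^sub>F q in sequentially. (b - a) / real q < d"
proof -
  have "(\<lambda>q. (b - a) / real q) \<longlonglongrightarrow> 0" by (rule lim_const_over_n)
  from order_tendstoD(2)[OF this \<open>d > 0\<close>] show ?thesis .
qed

text \<open>All later limits run over uniform partitions. The number of pieces may tend to infinity
  along any filter and the tags are free; this covers the dyadic refinements of a fixed interval and
  the right-endpoint tags that summation by parts produces.\<close>

lemma rs_sum_tendsto: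
  fixes f g :: "real \<Rightarrow> 'v::real_inner"
  assumes I: "rs_has_integral f g a b I" and "a < b"
    and q: "filterlim q at_top F"
    and tag: "\<And>x k. k < q x \<Longrightarrow> a + (b - a) * real k / real (q x) \<le> \<xi> x k
        \<and> \<xi> x k \<le> a + (b - a) * real (Suc k) / real (q x)"
  shows "((\<lambda>x. \<Sum>k<q x. f (\<xi> x k) \<bullet> (g (a + (b - a) * real (Suc k) / real (q x))
            - g (a + (b - a) * real k / real (q x)))) \<longlongrightarrow> I) F"
proof (rule tendstoI)
  fix e :: real assume "e > 0"
  then obtain d where "d > 0" and d: "\<And>n p xi. is_partition a b n p \<Longrightarrow> (\<forall>k<n. p (Suc k) - p k < d)
        \<Longrightarrow> (\<forall>k<n. p k \<le> xi k \<and> xi k \<le> p (Suc k))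
        \<Longrightarrow> \<bar>(\<Sum>k<n. inner (f (xi k)) (g (p (Suc k)) - g (p k))) - I\<bar> < e"
    by (rule rs_has_integralD[OF I]) blast
  have "\<forall>\<^sub>F n in sequentially. (b - a) / real n < d \<and> n > 0"
    using uniform_mesh_small[OF \<open>d > 0\<close>] eventually_gt_at_top[of 0] by eventually_elim auto
  then have "\<forall>\<^sub>F x in F. (b - a) / real (q x) < d \<and> q x > 0"
    using q unfolding filterlim_iff by blast
  then show "\<forall>\<^sub>F x in F. dist (\<Sum>k<q x. f (\<xi> x k) \<bullet> (g (a + (b - a) * real (Suc k) / real (q x))
            - g (a + (b - a) * real k / real (q x)))) I < e"
  proof eventually_elim
    case (elim x)
    have "a + (b - a) * real (Suc k) / real (q x) - (a + (b - a) * real k / real (q x)) < d" for k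
    proof -
      have "a + (b - a) * real (Suc k) / real (q x) - (a + (b - a) * real k / real (q x))
          = ((b - a) * real (Suc k) - (b - a) * real k) / real (q x)"
        by (simp add: diff_divide_distrib)
      also have "\<dots> = (b - a) / real (q x)" by (simp add: algebra_simps)
      finally show ?thesis using elim by simp
    qed
    then show ?case unfolding dist_real_def
      by (intro d is_partition_uniform \<open>a < b\<close>) (use elim tag in auto)
  qed
qed

lemma rs_has_integral_trivial: "rs_has_integral f g a a 0"
  unfolding rs_has_integral_def by (auto simp: is_partition_trivial intro: exI[of _ 1])

lemma rs_has_integral_unique:
  fixes f g :: "real \<Rightarrow> 'v::real_inner"
  assumes "rs_has_integral f g a b I" "rs_has_integral f g a b J" "a \<le> b"
  shows "I = J"
proof (cases "a = b")
  case True
  \<comment> \<open>A degenerate interval has only the empty partition, whose sum is 0. With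
    tolerance \<open>\<bar>K\<bar>\<close> a nonzero value \<open>K\<close> would contradict
    this.\<close>
  have *: "K = 0" if "rs_has_integral f g a a K" for K
  proof (rule ccontr)
    assume "K \<noteq> 0"
    then have "\<bar>K\<bar> > 0" by simp
    with that have "\<exists>d>0. \<forall>n p xi. is_partition a a n p \<longrightarrow> (\<forall>k<n. p (Suc k) - p k < d)
        \<longrightarrow> (\<forall>k<n. p k \<le> xi k \<and> xi k \<le> p (Suc k))
        \<longrightarrow> \<bar>(\<Sum>k<n. inner (f (xi k)) (g (p (Suc k)) - g (p k))) - K\<bar> < \<bar>K\<bar>"
      unfolding rs_has_integral_def by blast
    then obtain d where d: "\<And>n p xi. is_partition a a n p \<Longrightarrow> (\<forall>k<n. p (Suc k) - p k < d)
        \<Longrightarrow> (\<forall>k<n. p k \<le> xi k \<and> xi k \<le> p (Suc k))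
        \<Longrightarrow> \<bar>(\<Sum>k<n. inner (f (xi k)) (g (p (Suc k)) - g (p k))) - K\<bar> < \<bar>K\<bar>" by blast
    show False using d[of 0 "\<lambda>_. a"] by (simp add: is_partition_trivial)
  qed
  show ?thesis using assms *[of I] *[of J] True by simp
next
  case False
  then have ab: "a < b" using assms by simp
  have q: "filterlim (\<lambda>q::nat. q) at_top sequentially" by (rule filterlim_ident)
  have tag: "a + (b - a) * real k / real q \<le> a + (b - a) * real k / real q
        \<and> a + (b - a) * real k / real q \<le> a + (b - a) * real (Suc k) / real q" for k q
    using ab by (auto simp: divide_simps)
  show ?thesis
    using rs_sum_tendsto[OF assms(1) ab q tag] rs_sum_tendsto[OF assms(2) ab q tag]
    by (rule LIMSEQ_unique)
qed

lemma rs_integral_eq: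
  fixes f g :: "real \<Rightarrow> 'v::real_inner"
  assumes "rs_has_integral f g a b I" "a \<le> b"
  shows "rs_integral f g a b = I"
  unfolding rs_integral_def using assms rs_has_integral_unique by blast

lemma rs_has_integral_rs_integral:
  fixes f g :: "real \<Rightarrow> 'v::euclidean_space"
  assumes "continuous_on {a..b} f" "continuous_on {a..b} g" "bounded_variation_on g a b" "a \<le> b"
  shows "rs_has_integral f g a b (rs_integral f g a b)"
  using rs_has_integral_exists[OF assms] rs_integral_eq assms(4) by metis

lemma rs_integral_add_const:
  fixes f g :: "real \<Rightarrow> 'v::euclidean_space"
  assumes "continuous_on {a..b} f" "continuous_on {a..b} g" "bounded_variation_on g a b" "a \<le> b"
  shows "rs_integral (\<lambda>x. f x + c) g a b = rs_integral f g a b + c \<bullet> (g b - g a)"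
proof (rule rs_integral_eq[OF _ \<open>a \<le> b\<close>])
  have *: "(\<Sum>k<n. inner (f (xi k) + c) (g (p (Suc k)) - g (p k)))
      = (\<Sum>k<n. inner (f (xi k)) (g (p (Suc k)) - g (p k))) + c \<bullet> (g b - g a)"
    if "is_partition a b n p" for n p xi
    using that sum_lessThan_telescope[of "\<lambda>k. g (p k)" n]
    by (simp add: inner_add_left sum.distrib inner_sum_right[symmetric] is_partition_def)
  show "rs_has_integral (\<lambda>x. f x + c) g a b (rs_integral f g a b + c \<bullet> (g b - g a))"
    using rs_has_integral_rs_integral[OF assms] unfolding rs_has_integral_def
    by (simp add: * cong: conj_cong imp_cong)
qed

lemma sum_up_split: "(\<Sum>k<m + n. F k) = (\<Sum>k<m. F k) + (\<Sum>k<n. F (m + k))"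
  for F :: "nat \<Rightarrow> 'a::comm_monoid_add"
  by (induction n) (simp_all add: add.assoc)

text \<open>Concatenating the uniform partitions into \<open>q\<close> pieces of both intervals gives a
  partition of the whole interval.\<close>
lemma rs_integral_combine:
  fixes f g :: "real \<Rightarrow> 'v::euclidean_space"
  assumes f: "continuous_on {a..c} f" and g: "continuous_on {a..c} g"
    and bv: "bounded_variation_on g a c" and le: "a \<le> b" "b \<le> c"
  shows "rs_integral f g a c = rs_integral f g a b + rs_integral f g b c"
proof (cases "a = b \<or> b = c")
  case True
  then show ?thesis using rs_integral_eq[OF rs_has_integral_trivial] le by auto
next
  case False
  then have ab: "a < b" and bc: "b < c" using le by auto
  have I1: "rs_has_integral f g a b (rs_integral f g a b)"
    by (intro rs_has_integral_rs_integral continuous_on_subset[OF f] continuous_on_subset[OF g]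
        bounded_variation_on_subinterval[OF bv]) (use le in auto)
  have I2: "rs_has_integral f g b c (rs_integral f g b c)"
    by (intro rs_has_integral_rs_integral continuous_on_subset[OF f] continuous_on_subset[OF g]
        bounded_variation_on_subinterval_left[OF bv]) (use le in auto)
  have I: "rs_has_integral f g a c (rs_integral f g a c)"
    by (intro rs_has_integral_rs_integral f g bv) (use le in auto)
  define S1 where "S1 q = (\<Sum>k<q. f (a + (b - a) * real k / real q) \<bullet>
      (g (a + (b - a) * real (Suc k) / real q) - g (a + (b - a) * real k / real q)))" for q
  define S2 where "S2 q = (\<Sum>k<q. f (b + (c - b) * real k / real q) \<bullet>
      (g (b + (c - b) * real (Suc k) / real q) - g (b + (c - b) * real k / real q)))" for q
  have "S1 \<longlonglongrightarrow> rs_integral f g a b" unfolding S1_def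
    by (rule rs_sum_tendsto[OF I1 ab filterlim_ident]) (use ab in \<open>auto simp: divide_simps\<close>)
  moreover have "S2 \<longlonglongrightarrow> rs_integral f g b c" unfolding S2_def
    by (rule rs_sum_tendsto[OF I2 bc filterlim_ident]) (use bc in \<open>auto simp: divide_simps\<close>)
  ultimately have lim: "(\<lambda>q. S1 q + S2 q) \<longlonglongrightarrow> rs_integral f g a b + rs_integral f g b c"
    by (rule tendsto_add)
  have "(\<lambda>q. S1 q + S2 q) \<longlonglongrightarrow> rs_integral f g a c"
  proof (rule tendstoI)
    fix e :: real assume "e > 0"
    then obtain d where "d > 0" and d: "\<And>n p xi. is_partition a c n p \<Longrightarrow> (\<forall>k<n. p (Suc k) - p k < d)
        \<Longrightarrow> (\<forall>k<n. p k \<le> xi k \<and> xi k \<le> p (Suc k))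
        \<Longrightarrow> \<bar>(\<Sum>k<n. inner (f (xi k)) (g (p (Suc k)) - g (p k))) - rs_integral f g a c\<bar> < e"
      by (rule rs_has_integralD[OF I]) blast
    show "\<forall>\<^sub>F q in sequentially. dist (S1 q + S2 q) (rs_integral f g a c) < e"
      using uniform_mesh_small[OF \<open>d > 0\<close>, of b a] uniform_mesh_small[OF \<open>d > 0\<close>, of c b]
        eventually_gt_at_top[of 0]
    proof eventually_elim
      case (elim q)
      define p where "p k = (if k \<le> q then a + (b - a) * real k / real q
          else b + (c - b) * (real k - real q) / real q)" for k
      have p1: "p k = a + (b - a) * real k / real q" if "k \<le> q" for k using that by (simp add: p_def)
      have p2: "p k = b + (c - b) * (real k - real q) / real q" if "k \<ge> q" for k
        using that elim by (cases "k = q") (auto simp: p_def)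
      have diff: "0 < p (Suc k) - p k \<and> p (Suc k) - p k < d" for k
      proof (cases "k < q")
        case True
        then have "p (Suc k) - p k = (b - a) / real q" by (simp add: p1 field_simps)
        then show ?thesis using elim ab by simp
      next
        case False
        then have "p (Suc k) - p k = ((c - b) * (real (Suc k) - real q) - (c - b) * (real k - real q)) / real q"
          by (simp add: p2 diff_divide_distrib)
        also have "\<dots> = (c - b) / real q" by (simp add: algebra_simps)
        finally have "p (Suc k) - p k = (c - b) / real q" .
        then show ?thesis using elim bc by simp
      qed
      have part: "is_partition a c (q + q) p"
        using diff elim by (auto simp: is_partition_def p1 p2)
      have "(\<Sum>k<q + q. inner (f (p k)) (g (p (Suc k)) - g (p k))) = S1 q + S2 q"
      proof -
        have "(\<Sum>k<q + q. inner (f (p k)) (g (p (Suc k)) - g (p k)))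
            = (\<Sum>k<q. inner (f (p k)) (g (p (Suc k)) - g (p k)))
            + (\<Sum>k<q. inner (f (p (q + k))) (g (p (Suc (q + k))) - g (p (q + k))))"
          using sum_up_split[of "\<lambda>k. inner (f (p k)) (g (p (Suc k)) - g (p k))" q q] by simp
        also have "(\<Sum>k<q. inner (f (p k)) (g (p (Suc k)) - g (p k))) = S1 q"
          unfolding S1_def by (intro sum.cong) (auto simp: p1)
        also have "(\<Sum>k<q. inner (f (p (q + k))) (g (p (Suc (q + k))) - g (p (q + k)))) = S2 q"
          unfolding S2_def by (intro sum.cong) (auto simp: p2)
        finally show ?thesis .
      qed
      moreover have "\<bar>(\<Sum>k<q + q. inner (f (p k)) (g (p (Suc k)) - g (p k))) - rs_integral f g a c\<bar> < e"
        by (rule d[OF part]) (use diff in \<open>auto intro: less_imp_le\<close>)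
      ultimately show ?case by (simp add: dist_real_def)
    qed
  qed
  from LIMSEQ_unique[OF this lim] show ?thesis .
qed

section \<open>Convergence of expectations\<close>

text \<open>The hypothesis is a form of uniform integrability; the proof truncates at \<open>\<plusminus>g\<close>.\<close>
lemma integral_tendsto_uniformly_integrable:
  fixes X :: "nat \<Rightarrow> 'a \<Rightarrow> real"
  assumes int: "\<And>n. integrable M (X n)" and meas [measurable]: "X' \<in> borel_measurable M"
    and lim: "AE \<omega> in M. (\<lambda>n. X n \<omega>) \<longlonglongrightarrow> X' \<omega>"
    and ui: "\<And>e. e > 0 \<Longrightarrow> \<exists>g r. integrable M g \<and> (\<forall>n. integrable M (r n) \<and> (\<integral>\<omega>. r n \<omega> \<partial>M) \<le> e
          \<and> (AE \<omega> in M. 0 \<le> r n \<omega> \<and> \<bar>X n \<omega>\<bar> \<le> g \<omega> + r n \<omega>))"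
  shows "integrable M X'" and "(\<lambda>n. \<integral>\<omega>. X n \<omega> \<partial>M) \<longlonglongrightarrow> (\<integral>\<omega>. X' \<omega> \<partial>M)"
proof -
  have [measurable]: "X n \<in> borel_measurable M" for n using int by auto
  \<comment> \<open>One \<open>e\<close> pays for the convergence of the truncated integrals, and
    one each for the truncation errors of \<open>X n\<close> and of \<open>X'\<close>.\<close>
  have key: "integrable M X' \<and> (\<forall>\<^sub>F n in sequentially. \<bar>(\<integral>\<omega>. X n \<omega> \<partial>M) - (\<integral>\<omega>. X' \<omega> \<partial>M)\<bar> < 3 * e)"
    if e: "e > 0" for e
  proof -
    from ui[OF e] obtain g0 r where g0: "integrable M g0" and r: "\<And>n. integrable M (r n)"
      "\<And>n. (\<integral>\<omega>. r n \<omega> \<partial>M) \<le> e" "\<And>n. AE \<omega> in M. 0 \<le> r n \<omega> \<and> \<bar>X n \<omega>\<bar> \<le> g0 \<omega> + r n \<omega>" by blast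
    define g where "g \<omega> = \<bar>g0 \<omega>\<bar>" for \<omega>
    have g: "integrable M g" unfolding g_def using g0 by simp
    then have [measurable]: "g \<in> borel_measurable M" by auto
    define c where "c x \<omega> = max (- g \<omega>) (min (g \<omega>) x)" for x \<omega>
    have cb: "\<bar>c x \<omega>\<bar> \<le> g \<omega>" for x \<omega> by (auto simp: c_def g_def)
    have [measurable]: "(\<lambda>\<omega>. c (X n \<omega>) \<omega>) \<in> borel_measurable M" "(\<lambda>\<omega>. c (X' \<omega>) \<omega>) \<in> borel_measurable M" for n
      unfolding c_def by measurable
    have ci: "integrable M (\<lambda>\<omega>. c (X n \<omega>) \<omega>)" "integrable M (\<lambda>\<omega>. c (X' \<omega>) \<omega>)" for n
      by (rule Bochner_Integration.integrable_bound[OF g], use cb in \<open>auto simp: g_def\<close>)+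
    have clim: "AE \<omega> in M. (\<lambda>n. c (X n \<omega>) \<omega>) \<longlonglongrightarrow> c (X' \<omega>) \<omega>"
      using lim by eventually_elim (auto simp: c_def intro!: tendsto_intros)
    have cl: "(\<lambda>n. \<integral>\<omega>. c (X n \<omega>) \<omega> \<partial>M) \<longlonglongrightarrow> (\<integral>\<omega>. c (X' \<omega>) \<omega> \<partial>M)"
      by (rule integral_dominated_convergence[OF _ _ g clim]) (use cb in auto)
    have diff: "AE \<omega> in M. \<bar>X n \<omega> - c (X n \<omega>) \<omega>\<bar> \<le> r n \<omega>" for n
      using r(3)[of n] by eventually_elim (auto simp: c_def g_def)
    have dn: "(\<integral>\<^sup>+\<omega>. ennreal \<bar>X n \<omega> - c (X n \<omega>) \<omega>\<bar> \<partial>M) \<le> ennreal e" for n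
    proof -
      have "(\<integral>\<^sup>+\<omega>. ennreal \<bar>X n \<omega> - c (X n \<omega>) \<omega>\<bar> \<partial>M) \<le> (\<integral>\<^sup>+\<omega>. ennreal (r n \<omega>) \<partial>M)"
      proof (rule nn_integral_mono_AE)
        show "AE \<omega> in M. ennreal \<bar>X n \<omega> - c (X n \<omega>) \<omega>\<bar> \<le> ennreal (r n \<omega>)"
          using diff[of n] by eventually_elim (rule ennreal_leI)
      qed
      also have "\<dots> = ennreal (\<integral>\<omega>. r n \<omega> \<partial>M)"
        by (rule nn_integral_eq_integral[OF r(1)]) (use r(3)[of n] in auto)
      finally show ?thesis using r(2)[of n] by (meson ennreal_leI order_trans)
    qed
    \<comment> \<open>Fatou's lemma carries the bound on the truncation error over to the limit;
      integrability of \<open>X'\<close> is read off from it.\<close>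
    have dl: "(\<integral>\<^sup>+\<omega>. ennreal \<bar>X' \<omega> - c (X' \<omega>) \<omega>\<bar> \<partial>M) \<le> ennreal e"
    proof -
      have "(\<integral>\<^sup>+\<omega>. ennreal \<bar>X' \<omega> - c (X' \<omega>) \<omega>\<bar> \<partial>M)
          = (\<integral>\<^sup>+\<omega>. liminf (\<lambda>n. ennreal \<bar>X n \<omega> - c (X n \<omega>) \<omega>\<bar>) \<partial>M)"
      proof (rule nn_integral_cong_AE)
        show "AE \<omega> in M. ennreal \<bar>X' \<omega> - c (X' \<omega>) \<omega>\<bar> = liminf (\<lambda>n. ennreal \<bar>X n \<omega> - c (X n \<omega>) \<omega>\<bar>)"
          using lim clim
          by eventually_elim (rule lim_imp_Liminf[symmetric], auto intro!: tendsto_intros)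
      qed
      also have "\<dots> \<le> liminf (\<lambda>n. \<integral>\<^sup>+\<omega>. ennreal \<bar>X n \<omega> - c (X n \<omega>) \<omega>\<bar> \<partial>M)"
        by (rule nn_integral_liminf) simp
      also have "\<dots> \<le> ennreal e"
        using Liminf_mono[of "\<lambda>n. \<integral>\<^sup>+\<omega>. ennreal \<bar>X n \<omega> - c (X n \<omega>) \<omega>\<bar> \<partial>M" "\<lambda>_. ennreal e" sequentially] dn
        by (auto simp: Liminf_const)
      finally show ?thesis .
    qed
    have di: "integrable M (\<lambda>\<omega>. X' \<omega> - c (X' \<omega>) \<omega>)"
      by (rule integrableI_bounded) (use dl in \<open>auto simp: less_top[symmetric] top_unique\<close>)
    have X': "integrable M X'"
      using Bochner_Integration.integrable_add[OF di ci(2)] by simp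
    have b: "\<bar>\<integral>\<omega>. f \<omega> \<partial>M\<bar> \<le> e" if "integrable M f" "(\<integral>\<^sup>+\<omega>. ennreal \<bar>f \<omega>\<bar> \<partial>M) \<le> ennreal e" for f :: "'a \<Rightarrow> real"
    proof -
      have "ennreal (norm (\<integral>\<omega>. f \<omega> \<partial>M)) \<le> (\<integral>\<^sup>+\<omega>. ennreal (norm (f \<omega>)) \<partial>M)"
        by (rule integral_norm_bound_ennreal[OF that(1)])
      also have "\<dots> \<le> ennreal e" using that(2) by simp
      finally show ?thesis using e by (simp add: ennreal_le_iff)
    qed
    have "\<forall>\<^sub>F n in sequentially. dist (\<integral>\<omega>. c (X n \<omega>) \<omega> \<partial>M) (\<integral>\<omega>. c (X' \<omega>) \<omega> \<partial>M) < e"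
      using tendstoD[OF cl e] .
    then have "\<forall>\<^sub>F n in sequentially. \<bar>(\<integral>\<omega>. X n \<omega> \<partial>M) - (\<integral>\<omega>. X' \<omega> \<partial>M)\<bar> < 3 * e"
    proof eventually_elim
      case (elim n)
      have "\<bar>\<integral>\<omega>. X n \<omega> - c (X n \<omega>) \<omega> \<partial>M\<bar> \<le> e" by (rule b) (use int ci dn in auto)
      moreover have "\<bar>\<integral>\<omega>. X' \<omega> - c (X' \<omega>) \<omega> \<partial>M\<bar> \<le> e" by (rule b) (use di dl in auto)
      ultimately show ?case using elim int X' ci by (simp add: dist_real_def)
    qed
    with X' show ?thesis by simp
  qed
  show "integrable M X'" using key[of 1] by simp
  show "(\<lambda>n. \<integral>\<omega>. X n \<omega> \<partial>M) \<longlonglongrightarrow> (\<integral>\<omega>. X' \<omega> \<partial>M)"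
  proof (rule tendstoI)
    fix e :: real assume "e > 0"
    then show "\<forall>\<^sub>F n in sequentially. dist (\<integral>\<omega>. X n \<omega> \<partial>M) (\<integral>\<omega>. X' \<omega> \<partial>M) < e"
      using key[of "e / 3"] by (simp add: dist_real_def)
  qed
qed

text \<open>By Young's inequality \<open>a * k\<close> is at most
  \<open>a\<^sup>2 / (4 * h) + h * k\<^sup>2\<close>. The first summand is a fixed integrable
  majorant and the second has mean at most \<open>h * C\<close>, so the sequence is uniformly
  integrable. This is how L2-bounded factors enter all later limits of expectations.\<close>

lemma integral_tendsto_dominated_square:
  fixes X k :: "nat \<Rightarrow> 'a \<Rightarrow> real"
  assumes int: "\<And>n. integrable M (X n)" and meas: "X' \<in> borel_measurable M"
    and lim: "AE \<omega> in M. (\<lambda>n. X n \<omega>) \<longlonglongrightarrow> X' \<omega>"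
    and a: "integrable M (\<lambda>\<omega>. (a \<omega>)\<^sup>2)" and k: "\<And>n. integrable M (\<lambda>\<omega>. (k n \<omega>)\<^sup>2)"
    and C: "\<And>n. (\<integral>\<omega>. (k n \<omega>)\<^sup>2 \<partial>M) \<le> C"
    and dom: "\<And>n. AE \<omega> in M. \<bar>X n \<omega>\<bar> \<le> a \<omega> * k n \<omega>"
  shows "integrable M X'" and "(\<lambda>n. \<integral>\<omega>. X n \<omega> \<partial>M) \<longlonglongrightarrow> (\<integral>\<omega>. X' \<omega> \<partial>M)"
proof -
  have "\<exists>g r. integrable M g \<and> (\<forall>n. integrable M (r n) \<and> (\<integral>\<omega>. r n \<omega> \<partial>M) \<le> e
          \<and> (AE \<omega> in M. 0 \<le> r n \<omega> \<and> \<bar>X n \<omega>\<bar> \<le> g \<omega> + r n \<omega>))" if e: "e > 0" for e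
  proof -
    have "0 \<le> (\<integral>\<omega>. (k 0 \<omega>)\<^sup>2 \<partial>M)" by simp
    with C[of 0] have C0: "0 \<le> C" by linarith
    \<comment> \<open>Any \<open>h\<close> with \<open>h * C \<le> e\<close> would do; the added 1
      covers \<open>C = 0\<close>.\<close>
    define h where "h = e / (C + 1)"
    have h: "h > 0" "h * C \<le> e"
      using e C0 by (auto simp: h_def divide_simps)
    show ?thesis
    proof (intro exI[of _ "\<lambda>\<omega>. (a \<omega>)\<^sup>2 / (4 * h)"] exI[of _ "\<lambda>n \<omega>. h * (k n \<omega>)\<^sup>2"] conjI allI)
      fix n
      show "(\<integral>\<omega>. h * (k n \<omega>)\<^sup>2 \<partial>M) \<le> e"
      proof -
        have "(\<integral>\<omega>. h * (k n \<omega>)\<^sup>2 \<partial>M) = h * (\<integral>\<omega>. (k n \<omega>)\<^sup>2 \<partial>M)" by simp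
        also have "\<dots> \<le> h * C" using h(1) C[of n] by (intro mult_left_mono) auto
        also have "\<dots> \<le> e" by (rule h)
        finally show ?thesis .
      qed
      have *: "x * y \<le> x\<^sup>2 / (4 * h) + h * y\<^sup>2" for x y
      proof -
        have "0 \<le> (x - 2 * h * y)\<^sup>2 / (4 * h)" using h by simp
        also have "\<dots> = x\<^sup>2 / (4 * h) + h * y\<^sup>2 - x * y"
          using h by (simp add: field_simps power2_eq_square)
        finally show ?thesis by simp
      qed
      show "AE \<omega> in M. 0 \<le> h * (k n \<omega>)\<^sup>2 \<and> \<bar>X n \<omega>\<bar> \<le> (a \<omega>)\<^sup>2 / (4 * h) + h * (k n \<omega>)\<^sup>2"
        using dom[of n] by eventually_elim (use h * in \<open>auto intro: order_trans\<close>)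
    qed (use a k in auto)
  qed
  from integral_tendsto_uniformly_integrable[OF int meas lim this]
  show "integrable M X'" and "(\<lambda>n. \<integral>\<omega>. X n \<omega> \<partial>M) \<longlonglongrightarrow> (\<integral>\<omega>. X' \<omega> \<partial>M)" by blast+
qed

lemma integrable_square_mult:
  fixes f g :: "'a \<Rightarrow> real"
  assumes [measurable]: "f \<in> borel_measurable M" "g \<in> borel_measurable M"
    and "integrable M (\<lambda>x. (f x)\<^sup>2)" "integrable M (\<lambda>x. (g x)\<^sup>2)"
  shows "integrable M (\<lambda>x. f x * g x)"
proof (rule Bochner_Integration.integrable_bound)
  show "integrable M (\<lambda>x. (f x)\<^sup>2 + (g x)\<^sup>2)" using assms by simp
  have "\<bar>a * b\<bar> \<le> a\<^sup>2 + b\<^sup>2" for a b :: real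
    using sum_squares_bound[of a b] sum_squares_bound[of a "-b"] zero_le_power2[of a] zero_le_power2[of b]
    by (auto simp: abs_if simp del: zero_le_power2)
  then show "AE x in M. norm (f x * g x) \<le> norm ((f x)\<^sup>2 + (g x)\<^sup>2)" by simp
qed simp

lemma integrable_square_add:
  fixes f g :: "'a \<Rightarrow> 'b::euclidean_space"
  assumes [measurable]: "f \<in> borel_measurable M" "g \<in> borel_measurable M"
    and "integrable M (\<lambda>x. (norm (f x))\<^sup>2)" "integrable M (\<lambda>x. (norm (g x))\<^sup>2)"
  shows "integrable M (\<lambda>x. (norm (f x + g x))\<^sup>2)"
proof (rule Bochner_Integration.integrable_bound)
  show "integrable M (\<lambda>x. 2 * (norm (f x))\<^sup>2 + 2 * (norm (g x))\<^sup>2)" using assms by simp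
  have "(norm (a + b))\<^sup>2 \<le> 2 * (norm a)\<^sup>2 + 2 * (norm b)\<^sup>2" for a b :: 'b
  proof -
    have "(norm (a + b))\<^sup>2 \<le> (norm a + norm b)\<^sup>2" by (intro power_mono norm_triangle_ineq) simp
    also have "\<dots> \<le> 2 * (norm a)\<^sup>2 + 2 * (norm b)\<^sup>2"
      using sum_squares_bound[of "norm a" "norm b"] by (simp add: power2_sum)
    finally show ?thesis .
  qed
  then show "AE x in M. norm ((norm (f x + g x))\<^sup>2) \<le> norm (2 * (norm (f x))\<^sup>2 + 2 * (norm (g x))\<^sup>2)"
    by simp
qed simp

lemma integrable_square_diff:
  fixes f g :: "'a \<Rightarrow> 'b::euclidean_space"
  assumes [measurable]: "f \<in> borel_measurable M" "g \<in> borel_measurable M"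
    and "integrable M (\<lambda>x. (norm (f x))\<^sup>2)" "integrable M (\<lambda>x. (norm (g x))\<^sup>2)"
  shows "integrable M (\<lambda>x. (norm (f x - g x))\<^sup>2)"
  using integrable_square_add[of f M "\<lambda>x. - g x"] assms by simp

lemma integrable_square_inner:
  fixes f g :: "'a \<Rightarrow> 'b::euclidean_space"
  assumes [measurable]: "f \<in> borel_measurable M" "g \<in> borel_measurable M"
    and "integrable M (\<lambda>x. (norm (f x))\<^sup>2)" "integrable M (\<lambda>x. (norm (g x))\<^sup>2)"
  shows "integrable M (\<lambda>x. f x \<bullet> g x)"
proof (rule Bochner_Integration.integrable_bound)
  show "integrable M (\<lambda>x. norm (f x) * norm (g x))"
    by (rule integrable_square_mult) (use assms in auto)
  show "AE x in M. norm (f x \<bullet> g x) \<le> norm (norm (f x) * norm (g x))"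
    using Cauchy_Schwarz_ineq2 by auto
qed simp

lemma integrable_power2_bound:
  fixes f :: "'a \<Rightarrow> 'b::euclidean_space"
  assumes "integrable M h" "f \<in> borel_measurable M" "AE x in M. (norm (f x))\<^sup>2 \<le> h x"
  shows "integrable M (\<lambda>x. (norm (f x))\<^sup>2)"
  by (rule Bochner_Integration.integrable_bound[OF assms(1)]) (use assms(2,3) in auto)

section \<open>Discrete time martingale transforms\<close>

text \<open>Recursion, rather than a maximum over an image set, lets measurability with respect to a
  given sigma-algebra follow by induction.\<close>

primrec runmax :: "(nat \<Rightarrow> real) \<Rightarrow> nat \<Rightarrow> real" where
  "runmax f 0 = f 0"
| "runmax f (Suc n) = max (runmax f n) (f (Suc n))"

lemma runmax_ge: "j \<le> n \<Longrightarrow> f j \<le> runmax f n"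
  by (induction n) (auto simp: le_Suc_eq)

lemma runmax_mono: "i \<le> j \<Longrightarrow> runmax f i \<le> runmax f j"
  by (induction j) (auto simp: le_Suc_eq)

lemma runmax_le: "(\<And>j. j \<le> n \<Longrightarrow> f j \<le> c) \<Longrightarrow> runmax f n \<le> c"
  by (induction n) auto

lemma runmax_mem: "\<exists>j\<le>n. runmax f n = f j"
proof (induction n)
  case (Suc n)
  then show ?case by (auto simp: max_def intro: le_SucI)
qed simp

lemma runmax_nonneg: "(\<And>j. 0 \<le> f j) \<Longrightarrow> 0 \<le> runmax f n"
  using runmax_mem[of n f] by auto

lemma measurable_runmax [measurable (raw)]:
  assumes "\<And>j. j \<le> n \<Longrightarrow> (\<lambda>x. f x j) \<in> borel_measurable M"
  shows "(\<lambda>x. runmax (f x) n) \<in> borel_measurable M"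
  using assms by (induction n) auto

text \<open>A pathwise form of Doob's L2 inequality. If \<open>x\<close> is a martingale, the sum on
  the left is a transform with weights known at time \<open>k\<close> and has mean zero, so that
  taking expectations yields the constant 4. The last step combines \<open>key\<close> with the
  nonnegativity of the square of \<open>m n - 2 * \<bar>x n\<bar>\<close>.\<close>

lemma doob_pathwise:
  fixes x :: "nat \<Rightarrow> real"
  defines "m \<equiv> runmax (\<lambda>j. \<bar>x j\<bar>)"
  shows "(m n)\<^sup>2 + 4 * (\<Sum>k<n. m k * sgn (x k) * (x (Suc k) - x k)) \<le> 4 * (x n)\<^sup>2"
proof -
  \<comment> \<open>In the induction step \<open>m\<close> is replaced by its new value. For fixed
    \<open>y\<close> the expression \<open>2 * m * y - m\<^sup>2\<close> is largest at
    \<open>m = y\<close>, and the running maximum changes only when it jumps to \<open>y\<close>, so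
    the replacement never decreases the right side.\<close>
  have key: "2 * (\<Sum>k<n. m k * (\<bar>x (Suc k)\<bar> - \<bar>x k\<bar>)) \<le> 2 * m n * \<bar>x n\<bar> - (m n)\<^sup>2"
  proof (induction n)
    case 0
    have "2 * m 0 * \<bar>x 0\<bar> - (m 0)\<^sup>2 = (x 0)\<^sup>2"
      by (simp add: m_def power2_eq_square mult.assoc)
    then show ?case by simp
  next
    case (Suc n)
    let ?y = "\<bar>x (Suc n)\<bar>"
    have mono: "2 * m n * ?y - (m n)\<^sup>2 \<le> 2 * m (Suc n) * ?y - (m (Suc n))\<^sup>2"
    proof (cases "?y \<le> m n")
      case False
      then have "m (Suc n) = ?y" by (simp add: m_def)
      moreover have "2 * m n * y - (m n)\<^sup>2 \<le> 2 * y * y - y\<^sup>2" for y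
        using zero_le_power2[of "y - m n"] by (simp add: power2_diff power2_eq_square algebra_simps)
      ultimately show ?thesis by metis
    qed (simp add: m_def)
    have "2 * (\<Sum>k<Suc n. m k * (\<bar>x (Suc k)\<bar> - \<bar>x k\<bar>))
        = 2 * (\<Sum>k<n. m k * (\<bar>x (Suc k)\<bar> - \<bar>x k\<bar>)) + (2 * m n * ?y - 2 * m n * \<bar>x n\<bar>)"
      by (simp add: algebra_simps)
    with Suc mono show ?case by linarith
  qed
  have "m k * sgn (x k) * (x (Suc k) - x k) \<le> m k * (\<bar>x (Suc k)\<bar> - \<bar>x k\<bar>)" for k
  proof -
    have "sgn (x k) * (x (Suc k) - x k) \<le> \<bar>x (Suc k)\<bar> - \<bar>x k\<bar>"
      by (auto simp: sgn_if abs_if)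
    moreover have "0 \<le> m k" unfolding m_def by (rule runmax_nonneg) simp
    ultimately show ?thesis by (simp add: mult_left_mono mult.assoc)
  qed
  then have "(\<Sum>k<n. m k * sgn (x k) * (x (Suc k) - x k)) \<le> (\<Sum>k<n. m k * (\<bar>x (Suc k)\<bar> - \<bar>x k\<bar>))"
    by (rule sum_mono)
  then have "2 * (\<Sum>k<n. m k * sgn (x k) * (x (Suc k) - x k)) \<le> 2 * m n * \<bar>x n\<bar> - (m n)\<^sup>2"
    using key by linarith
  moreover have "0 \<le> (m n - 2 * \<bar>x n\<bar>)\<^sup>2" by simp
  then have "4 * m n * \<bar>x n\<bar> \<le> (m n)\<^sup>2 + 4 * (x n)\<^sup>2"
    by (simp add: power2_diff power_mult_distrib)
  ultimately show ?thesis by simp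
qed

text \<open>Summation by parts: the sum is the last weight times \<open>x k\<close>, minus a sum of
  \<open>x\<close> against the increments of \<open>a\<close>. Both parts are at most
  \<open>A * c\<close> in absolute value, because the increments of \<open>a\<close> are nonnegative
  and telescope.\<close>

lemma abel_bound:
  fixes a x :: "nat \<Rightarrow> real"
  assumes a: "incseq a" "0 \<le> a 0" and x: "x 0 = 0" "\<And>j. j \<le> k \<Longrightarrow> \<bar>x j\<bar> \<le> c"
    and A: "\<And>j. j < k \<Longrightarrow> a j \<le> A" "0 \<le> A"
  shows "\<bar>\<Sum>j<k. a j * (x (Suc j) - x j)\<bar> \<le> 2 * A * c"
proof (cases k)
  case 0
  then show ?thesis using x(2)[of 0] A(2) by simp
next
  case (Suc m)
  have c: "0 \<le> c" using x(2)[of 0] by simp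
  have a0: "0 \<le> a j" for j using a by (meson incseqD le0 order_trans)
  have "\<bar>(\<Sum>j<Suc i. a j * (x (Suc j) - x j)) - a i * x (Suc i)\<bar> \<le> a i * c" if "i < k" for i
    using that
  proof (induction i)
    case 0
    then show ?case using x(1) a0 c by simp
  next
    case (Suc i)
    let ?S = "\<Sum>j<Suc i. a j * (x (Suc j) - x j)"
    have "(\<Sum>j<Suc (Suc i). a j * (x (Suc j) - x j)) - a (Suc i) * x (Suc (Suc i))
        = (?S - a i * x (Suc i)) - (a (Suc i) - a i) * x (Suc i)"
      by (simp add: algebra_simps)
    also have "\<bar>\<dots>\<bar> \<le> a i * c + (a (Suc i) - a i) * c"
    proof (rule order_trans[OF abs_triangle_ineq4 add_mono])
      show "\<bar>?S - a i * x (Suc i)\<bar> \<le> a i * c" using Suc by simp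
      have d: "0 \<le> a (Suc i) - a i" using incseq_SucD[OF a(1)] by simp
      show "\<bar>(a (Suc i) - a i) * x (Suc i)\<bar> \<le> (a (Suc i) - a i) * c"
        using d x(2)[of "Suc i"] Suc.prems by (simp add: abs_mult mult_left_mono)
    qed
    also have "\<dots> = a (Suc i) * c" by (simp add: algebra_simps)
    finally show ?case .
  qed
  from this[of m] Suc have "\<bar>(\<Sum>j<k. a j * (x (Suc j) - x j)) - a m * x k\<bar> \<le> a m * c" by simp
  moreover have "\<bar>a m * x k\<bar> \<le> a m * c" using x(2)[of k] a0[of m] by (simp add: abs_mult mult_left_mono)
  moreover have "a m * c \<le> A * c" using A(1)[of m] Suc c by (simp add: mult_right_mono)
  ultimately show ?thesis by linarith
qed

text \<open>Square-integrable martingale differences. Orthogonality to every square-integrable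
  \<open>W\<close> known at step \<open>k\<close> stands in for conditional expectations, and it is
  the form in which transforms use the martingale property.\<close>

locale orthogonal_differences = prob_space M for M :: "'a measure" +
  fixes G :: "nat \<Rightarrow> 'a measure" and D :: "nat \<Rightarrow> 'a \<Rightarrow> 'b::euclidean_space"
  assumes sub: "\<And>k. subalgebra M (G k)" and incr: "\<And>k. sets (G k) \<subseteq> sets (G (Suc k))"
    and D_meas: "\<And>k. D k \<in> borel_measurable (G (Suc k))"
    and D_sq: "\<And>k. integrable M (\<lambda>\<omega>. (norm (D k \<omega>))\<^sup>2)"
    and orth: "\<And>k W. W \<in> borel_measurable (G k) \<Longrightarrow> integrable M (\<lambda>\<omega>. (norm (W \<omega>))\<^sup>2)
        \<Longrightarrow> (\<integral>\<omega>. W \<omega> \<bullet> D k \<omega> \<partial>M) = 0"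
begin

lemma measG: "f \<in> borel_measurable (G k) \<Longrightarrow> f \<in> borel_measurable M"
  using measurable_from_subalg[OF sub] .

lemma measG_mono: assumes "f \<in> borel_measurable (G j)" "j \<le> k" shows "f \<in> borel_measurable (G k)"
proof -
  have "sets (G j) \<subseteq> sets (G k)" using incr \<open>j \<le> k\<close> by (rule lift_Suc_mono_le)
  then have "subalgebra (G k) (G j)" using sub by (auto simp: subalgebra_def)
  then show ?thesis using assms(1) by (rule measurable_from_subalg)
qed

lemma D_measM [measurable]: "D k \<in> borel_measurable M" using measG[OF D_meas] .

context
  fixes U :: "nat \<Rightarrow> 'a \<Rightarrow> 'b"
  assumes U: "\<And>k. U k \<in> borel_measurable (G k)" and U1: "\<And>k \<omega>. norm (U k \<omega>) \<le> 1"
begin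

definition K :: "nat \<Rightarrow> 'a \<Rightarrow> real" where "K n \<omega> = (\<Sum>j<n. U j \<omega> \<bullet> D j \<omega>)"

lemma U_measM: "U k \<in> borel_measurable M" using measG[OF U] .

lemma UD_le: "(U k \<omega> \<bullet> D k \<omega>)\<^sup>2 \<le> (norm (D k \<omega>))\<^sup>2"
proof -
  have "\<bar>U k \<omega> \<bullet> D k \<omega>\<bar> \<le> norm (U k \<omega>) * norm (D k \<omega>)" by (rule Cauchy_Schwarz_ineq2)
  also have "\<dots> \<le> 1 * norm (D k \<omega>)" by (intro mult_right_mono U1) simp
  finally show ?thesis by (simp add: abs_le_square_iff[symmetric])
qed

lemma UD_sq: "integrable M (\<lambda>\<omega>. (U k \<omega> \<bullet> D k \<omega>)\<^sup>2)"
proof (rule Bochner_Integration.integrable_bound[OF D_sq[of k]])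
  note [measurable] = U_measM
  show "(\<lambda>\<omega>. (U k \<omega> \<bullet> D k \<omega>)\<^sup>2) \<in> borel_measurable M" by measurable
qed (use UD_le in auto)

lemma K_meas: "K n \<in> borel_measurable (G n)"
  unfolding K_def
proof (rule borel_measurable_sum)
  fix j assume "j \<in> {..<n}"
  then show "(\<lambda>\<omega>. U j \<omega> \<bullet> D j \<omega>) \<in> borel_measurable (G n)"
    by (intro borel_measurable_inner measG_mono[OF U] measG_mono[OF D_meas]) auto
qed

lemma K_measM: "K n \<in> borel_measurable M" using measG[OF K_meas] .

lemma K_Suc: "K (Suc n) \<omega> = K n \<omega> + U n \<omega> \<bullet> D n \<omega>" by (simp add: K_def)

lemma K_sq: "integrable M (\<lambda>\<omega>. (K n \<omega>)\<^sup>2)"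
proof (induction n)
  case (Suc n)
  note [measurable] = U_measM K_measM
  from integrable_square_add[of "K n" M "\<lambda>\<omega>. U n \<omega> \<bullet> D n \<omega>"] Suc UD_sq
  show ?case by (simp add: K_Suc)
qed (simp add: K_def)

lemma K_orth:
  assumes W: "W \<in> borel_measurable (G n)" "integrable M (\<lambda>\<omega>. (W \<omega>)\<^sup>2)"
  shows "(\<integral>\<omega>. W \<omega> * (U n \<omega> \<bullet> D n \<omega>) \<partial>M) = 0"
proof -
  note [measurable] = U_measM
  have [measurable]: "W \<in> borel_measurable M" using measG[OF W(1)] .
  have "(norm (W \<omega> *\<^sub>R U n \<omega>))\<^sup>2 \<le> (W \<omega>)\<^sup>2" for \<omega>
    using U1[of n \<omega>] mult_left_mono[of "(norm (U n \<omega>))\<^sup>2" 1 "(W \<omega>)\<^sup>2"]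
    by (simp add: power_mult_distrib power_le_one)
  then have "integrable M (\<lambda>\<omega>. (norm (W \<omega> *\<^sub>R U n \<omega>))\<^sup>2)"
    by (intro integrable_power2_bound[OF W(2)]) auto
  then have "(\<integral>\<omega>. (W \<omega> *\<^sub>R U n \<omega>) \<bullet> D n \<omega> \<partial>M) = 0"
    by (intro orth borel_measurable_scaleR W U)
  then show ?thesis by simp
qed

text \<open>The cross terms vanish by \<open>K_orth\<close>, and Cauchy--Schwarz with
  \<open>U1\<close> removes \<open>U\<close> from the diagonal terms. The bound depends on
  \<open>D\<close> alone.\<close>

lemma K_sq_le: "(\<integral>\<omega>. (K n \<omega>)\<^sup>2 \<partial>M) \<le> (\<Sum>j<n. \<integral>\<omega>. (norm (D j \<omega>))\<^sup>2 \<partial>M)"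
proof (induction n)
  case (Suc n)
  note [measurable] = U_measM K_measM
  have i: "integrable M (\<lambda>\<omega>. K n \<omega> * (U n \<omega> \<bullet> D n \<omega>))"
    by (rule integrable_square_mult) (use K_sq UD_sq in auto)
  have "(\<integral>\<omega>. (K (Suc n) \<omega>)\<^sup>2 \<partial>M)
      = (\<integral>\<omega>. (K n \<omega>)\<^sup>2 + (U n \<omega> \<bullet> D n \<omega>)\<^sup>2 + 2 * (K n \<omega> * (U n \<omega> \<bullet> D n \<omega>)) \<partial>M)"
    by (simp add: K_Suc power2_sum mult.assoc)
  also have "\<dots> = (\<integral>\<omega>. (K n \<omega>)\<^sup>2 \<partial>M) + (\<integral>\<omega>. (U n \<omega> \<bullet> D n \<omega>)\<^sup>2 \<partial>M)"
    using i K_sq UD_sq K_orth[OF K_meas K_sq] by simp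
  also have "(\<integral>\<omega>. (U n \<omega> \<bullet> D n \<omega>)\<^sup>2 \<partial>M) \<le> (\<integral>\<omega>. (norm (D n \<omega>))\<^sup>2 \<partial>M)"
    by (intro integral_mono UD_sq D_sq UD_le)
  finally show ?case using Suc by simp
qed (simp add: K_def)

text \<open>The weights \<open>m k * sgn (K k)\<close> of \<open>doob_pathwise\<close> are known at
  step \<open>k\<close> and square integrable, so the correction sum has mean zero;
  \<open>K_sq_le\<close> then bounds the right side.\<close>

lemma doob:
  defines "m \<equiv> \<lambda>n \<omega>. runmax (\<lambda>j. \<bar>K j \<omega>\<bar>) n"
  shows "integrable M (\<lambda>\<omega>. (m n \<omega>)\<^sup>2)"
    and "(\<integral>\<omega>. (m n \<omega>)\<^sup>2 \<partial>M) \<le> 4 * (\<Sum>j<n. \<integral>\<omega>. (norm (D j \<omega>))\<^sup>2 \<partial>M)"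
proof -
  note [measurable] = U_measM K_measM
  have m_meas: "m n \<in> borel_measurable (G n)" for n
    unfolding m_def by (intro measurable_runmax borel_measurable_abs measG_mono[OF K_meas])
  have [measurable]: "m n \<in> borel_measurable M" for n using measG[OF m_meas] .
  \<comment> \<open>The crude bound by the sum of all squares gives the integrability without which
    the expectation could not be split.\<close>
  have m_sq: "integrable M (\<lambda>\<omega>. (m n \<omega>)\<^sup>2)" for n
  proof (rule Bochner_Integration.integrable_bound)
    show "integrable M (\<lambda>\<omega>. \<Sum>j\<le>n. (K j \<omega>)\<^sup>2)" using K_sq by simp
    have "(m n \<omega>)\<^sup>2 \<le> (\<Sum>j\<le>n. (K j \<omega>)\<^sup>2)" for \<omega>
    proof -
      obtain j where "j \<le> n" "m n \<omega> = \<bar>K j \<omega>\<bar>" using runmax_mem[of n "\<lambda>j. \<bar>K j \<omega>\<bar>"] by (auto simp: m_def)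
      then show ?thesis using member_le_sum[of j "{..n}" "\<lambda>j. (K j \<omega>)\<^sup>2"] by simp
    qed
    then show "AE \<omega> in M. norm ((m n \<omega>)\<^sup>2) \<le> norm (\<Sum>j\<le>n. (K j \<omega>)\<^sup>2)"
      by (intro AE_I2) (simp add: sum_nonneg)
  qed simp
  then show "integrable M (\<lambda>\<omega>. (m n \<omega>)\<^sup>2)" .
  define W where "W k \<omega> = m k \<omega> * sgn (K k \<omega>)" for k \<omega>
  have W_meas: "W k \<in> borel_measurable (G k)" for k
    unfolding W_def using m_meas[of k] K_meas[of k] by measurable
  have [measurable]: "W k \<in> borel_measurable M" for k using measG[OF W_meas] .
  have W_sq: "integrable M (\<lambda>\<omega>. (W k \<omega>)\<^sup>2)" for k
    by (rule Bochner_Integration.integrable_bound[OF m_sq[of k]])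
       (auto simp: W_def power_mult_distrib sgn_if)
  have i: "integrable M (\<lambda>\<omega>. W k \<omega> * (U k \<omega> \<bullet> D k \<omega>))" for k
    by (rule integrable_square_mult) (use W_sq UD_sq in auto)
  have "(\<integral>\<omega>. (m n \<omega>)\<^sup>2 \<partial>M) = (\<integral>\<omega>. (m n \<omega>)\<^sup>2 + 4 * (\<Sum>k<n. W k \<omega> * (U k \<omega> \<bullet> D k \<omega>)) \<partial>M)"
    using m_sq i by (simp add: K_orth[OF W_meas W_sq])
  also have "\<dots> \<le> (\<integral>\<omega>. 4 * (K n \<omega>)\<^sup>2 \<partial>M)"
  proof (rule integral_mono)
    fix \<omega>
    show "(m n \<omega>)\<^sup>2 + 4 * (\<Sum>k<n. W k \<omega> * (U k \<omega> \<bullet> D k \<omega>)) \<le> 4 * (K n \<omega>)\<^sup>2"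
      using doob_pathwise[of "\<lambda>j. K j \<omega>" n] by (simp add: m_def W_def K_Suc)
  qed (use m_sq i K_sq in auto)
  also have "\<dots> \<le> 4 * (\<Sum>j<n. \<integral>\<omega>. (norm (D j \<omega>))\<^sup>2 \<partial>M)" using K_sq_le by simp
  finally show "(\<integral>\<omega>. (m n \<omega>)\<^sup>2 \<partial>M) \<le> 4 * (\<Sum>j<n. \<integral>\<omega>. (norm (D j \<omega>))\<^sup>2 \<partial>M)" .
qed

end

text \<open>Dividing the integrand by its running maximum leaves an integrand bounded by 1, and summation
  by parts recovers the original transform.\<close>
lemma transform_bound:
  fixes V :: "nat \<Rightarrow> 'a \<Rightarrow> 'b"
  assumes V: "\<And>k. V k \<in> borel_measurable (G k)"
  shows "\<exists>\<kappa>. \<kappa> \<in> borel_measurable M \<and> (\<forall>\<omega>. 0 \<le> \<kappa> \<omega>) \<and> integrable M (\<lambda>\<omega>. (\<kappa> \<omega>)\<^sup>2)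
      \<and> (\<integral>\<omega>. (\<kappa> \<omega>)\<^sup>2 \<partial>M) \<le> 4 * (\<Sum>j<n. \<integral>\<omega>. (norm (D j \<omega>))\<^sup>2 \<partial>M)
      \<and> (\<forall>\<omega> k c. k \<le> n \<longrightarrow> 0 \<le> c \<longrightarrow> (\<forall>j<k. norm (V j \<omega>) \<le> c)
            \<longrightarrow> \<bar>\<Sum>j<k. V j \<omega> \<bullet> D j \<omega>\<bar> \<le> 2 * c * \<kappa> \<omega>)"
proof -
  define a where "a k \<omega> = runmax (\<lambda>j. norm (V j \<omega>)) k" for k \<omega>
  \<comment> \<open>Where the running maximum \<open>a\<close> is 0, \<open>V\<close> is 0 as well
    and the division returns 0, so the factorisation \<open>VU\<close> holds everywhere.\<close>
  define U where "U k \<omega> = V k \<omega> /\<^sub>R a k \<omega>" for k \<omega>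
  have "(\<lambda>\<omega>. norm (V j \<omega>)) \<in> borel_measurable (G k)" if "j \<le> k" for j k
    using measG_mono[OF V that] by simp
  then have a_meas: "a k \<in> borel_measurable (G k)" for k
    unfolding a_def by (rule measurable_runmax)
  have Va: "norm (V k \<omega>) \<le> a k \<omega>" for k \<omega> unfolding a_def by (rule runmax_ge) simp
  have a0: "0 \<le> a k \<omega>" for k \<omega> using Va[of k \<omega>] norm_ge_zero order_trans by blast
  have U: "U k \<in> borel_measurable (G k)" for k
    unfolding U_def using a_meas[of k] V[of k] by measurable
  have U1: "norm (U k \<omega>) \<le> 1" for k \<omega>
    using Va[of k \<omega>] a0[of k \<omega>] by (cases "a k \<omega> = 0") (auto simp: U_def field_simps)
  have VU: "V k \<omega> = a k \<omega> *\<^sub>R U k \<omega>" for k \<omega>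
    using Va[of k \<omega>] by (cases "a k \<omega> = 0") (auto simp: U_def)
  define k where "k \<omega> = runmax (\<lambda>j. \<bar>K U j \<omega>\<bar>) n" for \<omega>
  have k_ge: "\<bar>K U j \<omega>\<bar> \<le> k \<omega>" if "j \<le> n" for j \<omega>
    unfolding k_def by (rule runmax_ge[OF that])
  show ?thesis
  proof (intro exI[of _ k] conjI allI impI)
    show "k \<in> borel_measurable M" unfolding k_def
      by (intro measurable_runmax borel_measurable_abs K_measM[OF U U1])
    show "0 \<le> k \<omega>" for \<omega> unfolding k_def by (rule runmax_nonneg) simp
    show "integrable M (\<lambda>\<omega>. (k \<omega>)\<^sup>2)" unfolding k_def by (rule doob(1)[OF U U1])
    show "(\<integral>\<omega>. (k \<omega>)\<^sup>2 \<partial>M) \<le> 4 * (\<Sum>j<n. \<integral>\<omega>. (norm (D j \<omega>))\<^sup>2 \<partial>M)"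
      unfolding k_def by (rule doob(2)[OF U U1])
    fix \<omega> i c assume i: "i \<le> n" and c: "0 \<le> (c::real)" "\<forall>j<i. norm (V j \<omega>) \<le> c"
    have "(\<Sum>j<i. V j \<omega> \<bullet> D j \<omega>) = (\<Sum>j<i. a j \<omega> * (K U (Suc j) \<omega> - K U j \<omega>))"
      by (simp add: VU[of _ \<omega>] K_Suc[OF U U1])
    also have "\<bar>\<dots>\<bar> \<le> 2 * c * k \<omega>"
    proof (rule abel_bound)
      show "incseq (\<lambda>j. a j \<omega>)" by (auto simp: incseq_def a_def runmax_mono)
      show "a j \<omega> \<le> c" if "j < i" for j
        unfolding a_def by (rule runmax_le) (use c(2) that in auto)
    qed (use a0 k_ge i c in \<open>auto simp: K_def[OF U U1]\<close>)
    finally show "\<bar>\<Sum>j<i. V j \<omega> \<bullet> D j \<omega>\<bar> \<le> 2 * c * k \<omega>" .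
  qed
qed

end

section \<open>Martingales and optional stopping\<close>

locale filtered_space = prob_space M for M :: "'a measure" +
  fixes F :: "real \<Rightarrow> 'a measure"
  assumes filt: "filtration_usual M F"
begin

lemma space_F [simp]: "space (F t) = space M"
  using filt[unfolded filtration_usual_def, THEN conjunct1] by simp

lemma subalg_F: "subalgebra M (F t)"
  using filt[unfolded filtration_usual_def, THEN conjunct1] by (simp add: subalgebra_def)

lemma sets_F_mono: "0 \<le> s \<Longrightarrow> s \<le> t \<Longrightarrow> sets (F s) \<subseteq> sets (F t)"
  using filt[unfolded filtration_usual_def, THEN conjunct2, THEN conjunct1] by simp

lemma sets_F_M: "A \<in> sets (F t) \<Longrightarrow> A \<in> sets M"
  using subalg_F[of t] unfolding subalgebra_def by blast

lemma measF: "f \<in> measurable (F t) N \<Longrightarrow> f \<in> measurable M N"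
  using measurable_from_subalg[OF subalg_F] .

lemma measF_mono:
  assumes "f \<in> measurable (F s) N" "0 \<le> s" "s \<le> t"
  shows "f \<in> measurable (F t) N"
proof (rule measurable_from_subalg[OF _ assms(1)])
  show "subalgebra (F t) (F s)" using sets_F_mono[OF assms(2,3)] by (simp add: subalgebra_def)
qed

lemma null_F0: "A \<in> sets M \<Longrightarrow> emeasure M A = 0 \<Longrightarrow> N \<subseteq> A \<Longrightarrow> N \<in> sets (F 0)"
  using filt[unfolded filtration_usual_def, THEN conjunct2, THEN conjunct2, THEN conjunct1] by blast

text \<open>Completeness of \<open>F 0\<close> puts every subset of a null set into each
  \<open>F t\<close>, so changing a function on a null set preserves adaptedness. Almost sure limits
  thereby stay adapted.\<close>

lemma measF_AE_cong:
  assumes f: "f \<in> measurable (F t) N" and g: "g \<in> space M \<rightarrow> space N"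
    and eq: "AE \<omega> in M. f \<omega> = g \<omega>" and t: "0 \<le> t"
  shows "g \<in> measurable (F t) N"
proof (rule measurableI)
  show "g x \<in> space N" if "x \<in> space (F t)" for x using g that by auto
  fix S assume S: "S \<in> sets N"
  from eq obtain E where E: "E \<in> sets M" "emeasure M E = 0" "{\<omega> \<in> space M. f \<omega> \<noteq> g \<omega>} \<subseteq> E"
    by (auto elim!: AE_E simp: null_sets_def)
  have *: "N' \<in> sets (F t)" if "N' \<subseteq> E" for N'
    using null_F0[OF E(1,2) that] sets_F_mono[of 0 t] t by auto
  have fS: "f -` S \<inter> space (F t) \<in> sets (F t)" by (rule measurable_sets[OF f S])
  let ?D = "{\<omega> \<in> space M. f \<omega> \<noteq> g \<omega>}"
  have D: "?D \<in> sets (F t)" "g -` S \<inter> ?D \<in> sets (F t)" using E(3) by (auto intro!: *)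
  have "g -` S \<inter> space (F t) = (f -` S \<inter> space (F t) - ?D) \<union> (g -` S \<inter> ?D)" by auto
  then show "g -` S \<inter> space (F t) \<in> sets (F t)" using fS D by auto
qed

lemma measF_AE_limit:
  fixes f :: "nat \<Rightarrow> 'a \<Rightarrow> real"
  assumes f: "\<And>n. f n \<in> borel_measurable (F t)"
    and lim: "AE \<omega> in M. (\<lambda>n. f n \<omega>) \<longlonglongrightarrow> g \<omega>" and t: "0 \<le> t"
  shows "g \<in> borel_measurable (F t)"
proof (rule measF_AE_cong[OF _ _ _ t])
  show "(\<lambda>\<omega>. lim (\<lambda>n. f n \<omega>)) \<in> borel_measurable (F t)"
    using f by (rule borel_measurable_lim_metric)
  show "AE \<omega> in M. lim (\<lambda>n. f n \<omega>) = g \<omega>"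
    using lim by eventually_elim (rule limI)
qed auto

text \<open>The definition of a martingale by integrals over events makes \<open>N s\<close> a
  version of the conditional expectation of \<open>N t\<close>; the factor \<open>W\<close>, known
  at time \<open>s\<close>, is then pulled out.\<close>

lemma martingale_mult_eq:
  assumes N: "martingale M F N" and st: "0 \<le> s" "s \<le> t" and W: "W \<in> borel_measurable (F s)"
    and int: "integrable M (\<lambda>\<omega>. W \<omega> * N t \<omega>)"
  shows "(\<integral>\<omega>. W \<omega> * N t \<omega> \<partial>M) = (\<integral>\<omega>. W \<omega> * N s \<omega> \<partial>M)"
proof -
  interpret S: finite_measure_subalgebra M "F s" by unfold_locales (rule subalg_F)
  have Nm: "N u \<in> borel_measurable (F u)" "integrable M (N u)" if "0 \<le> u" for u
    using N that by (auto simp: martingale_def adapted_def)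
  have ce: "AE \<omega> in M. real_cond_exp M (F s) (N t) \<omega> = N s \<omega>"
  proof (rule S.real_cond_exp_charact)
    show "(\<integral>\<omega>\<in>A. N t \<omega> \<partial>M) = (\<integral>\<omega>\<in>A. N s \<omega> \<partial>M)" if "A \<in> sets (F s)" for A
      using N st that unfolding martingale_def by blast
  qed (use Nm[of t] Nm[of s] st in simp_all)
  have [measurable]: "N t \<in> borel_measurable M" "N s \<in> borel_measurable M" "W \<in> borel_measurable M"
    using measF[OF Nm(1), of t] measF[OF Nm(1), of s] measF[OF W] st by simp_all
  have "(\<integral>\<omega>. W \<omega> * N t \<omega> \<partial>M) = (\<integral>\<omega>. W \<omega> * real_cond_exp M (F s) (N t) \<omega> \<partial>M)"
    by (rule S.real_cond_exp_intg(2)[symmetric, OF int W]) simp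
  also have "\<dots> = (\<integral>\<omega>. W \<omega> * N s \<omega> \<partial>M)"
  proof (rule integral_cong_AE)
    show "AE \<omega> in M. W \<omega> * real_cond_exp M (F s) (N t) \<omega> = W \<omega> * N s \<omega>"
      using ce by eventually_elim simp
  qed simp_all
  finally show ?thesis .
qed

lemma martingale_increment_bounded:
  assumes N: "martingale M F N" and st: "0 \<le> s" "s \<le> t" and W: "W \<in> borel_measurable (F s)"
    and b: "\<And>\<omega>. \<bar>W \<omega>\<bar> \<le> 1"
  shows "integrable M (\<lambda>\<omega>. W \<omega> * (N t \<omega> - N s \<omega>))" "(\<integral>\<omega>. W \<omega> * (N t \<omega> - N s \<omega>) \<partial>M) = 0"
proof -
  have [measurable]: "W \<in> borel_measurable M" using W measF by auto
  have Ni: "integrable M (N u)" if "0 \<le> u" for u using N that by (auto simp: martingale_def)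
  have i: "integrable M (\<lambda>\<omega>. W \<omega> * N u \<omega>)" if "0 \<le> u" for u
  proof (rule Bochner_Integration.integrable_bound[OF Ni[OF that]])
    show "(\<lambda>\<omega>. W \<omega> * N u \<omega>) \<in> borel_measurable M"
      by (intro borel_measurable_times) (use Ni[OF that] in auto)
    show "AE \<omega> in M. norm (W \<omega> * N u \<omega>) \<le> norm (N u \<omega>)"
      using b by (auto simp: abs_mult intro!: mult_left_le_one_le)
  qed
  show "integrable M (\<lambda>\<omega>. W \<omega> * (N t \<omega> - N s \<omega>))" "(\<integral>\<omega>. W \<omega> * (N t \<omega> - N s \<omega>) \<partial>M) = 0"
    using i[of t] i[of s] st martingale_mult_eq[OF N st W] by (simp_all add: right_diff_distrib)
qed

section \<open>Optional stopping for continuous martingales\<close>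

text \<open>The weights switch off at the first grid point at or above \<open>r\<close>, and the sum
  telescopes up to it. This is the approximation of a stopping time from above by grid times, capped
  at the last index.\<close>

lemma telescope_stopped:
  fixes u :: "nat \<Rightarrow> real" and f :: "nat \<Rightarrow> real"
  assumes "incseq u"
  shows "\<exists>j\<le>m. (\<Sum>k<m. (if u k < r then 1 else 0) * (f (Suc k) - f k)) = f j - f 0
      \<and> (\<forall>k<j. u k < r) \<and> (j < m \<longrightarrow> r \<le> u j)"
proof (induction m)
  case (Suc m)
  then obtain j where j: "j \<le> m" "(\<Sum>k<m. (if u k < r then 1 else 0) * (f (Suc k) - f k)) = f j - f 0"
    "\<forall>k<j. u k < r" "j < m \<longrightarrow> r \<le> u j" by auto
  show ?case
  proof (cases "u m < r")
    case True
    have "j = m"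
    proof (rule ccontr)
      assume "j \<noteq> m"
      then have "r \<le> u j" "u j \<le> u m" using j(1,4) incseqD[OF assms, of j m] by auto
      then show False using True by simp
    qed
    then show ?thesis using True j by (intro exI[of _ "Suc m"]) (auto simp: less_Suc_eq)
  next
    case False
    then show ?thesis using j by (intro exI[of _ j]) (auto simp: not_less le_less)
  qed
qed simp

lemma martingale_tail_small:
  fixes Z :: "'a \<Rightarrow> real"
  assumes Z: "integrable M Z" and e: "e > 0"
  shows "\<exists>c\<ge>0. (\<integral>\<omega>. max 0 (\<bar>Z \<omega>\<bar> - c) \<partial>M) \<le> e"
proof -
  have [measurable]: "Z \<in> borel_measurable M" using Z by auto
  have "(\<lambda>n. \<integral>\<omega>. max 0 (\<bar>Z \<omega>\<bar> - real n) \<partial>M) \<longlonglongrightarrow> (\<integral>\<omega>. 0 \<partial>M)"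
  proof (rule integral_dominated_convergence[where w = "\<lambda>\<omega>. \<bar>Z \<omega>\<bar>"])
    show "AE \<omega> in M. (\<lambda>n. max 0 (\<bar>Z \<omega>\<bar> - real n)) \<longlonglongrightarrow> 0"
    proof (rule AE_I2)
      fix \<omega>
      have "\<forall>\<^sub>F n in sequentially. max 0 (\<bar>Z \<omega>\<bar> - real n) = 0"
        using filterlim_at_top[THEN iffD1, OF filterlim_real_sequentially, rule_format, of "\<bar>Z \<omega>\<bar>"]
        by eventually_elim auto
      then show "(\<lambda>n. max 0 (\<bar>Z \<omega>\<bar> - real n)) \<longlonglongrightarrow> 0" by (rule tendsto_eventually)
    qed
  qed (use Z in auto)
  from order_tendstoD(2)[OF this, of e] e have "\<forall>\<^sub>F n in sequentially. (\<integral>\<omega>. max 0 (\<bar>Z \<omega>\<bar> - real n) \<partial>M) < e"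
    by simp
  then obtain n where "(\<integral>\<omega>. max 0 (\<bar>Z \<omega>\<bar> - real n) \<partial>M) < e"
    by (auto simp: eventually_sequentially)
  then show ?thesis by (intro exI[of _ "real n"]) auto
qed

text \<open>Stopping at the first grid point after \<open>\<rho>\<close> is a transform with bounded
  weights known at the left endpoints, so its mean over \<open>A\<close> is zero. Path continuity
  gives convergence of these sums as the mesh shrinks; uniform integrability comes from comparing
  their tails with those of \<open>N t\<close>.\<close>

lemma stopped_martingale_approx:
  fixes N :: "real \<Rightarrow> 'a \<Rightarrow> real"
  assumes N: "martingale M F N" and cont: "AE \<omega> in M. continuous_on {0..} (\<lambda>t. N t \<omega>)"
    and \<rho>: "stopping_time_r F \<rho>" and st: "0 \<le> s" "s \<le> t" and A: "A \<in> sets (F s)"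
  shows "\<exists>X. (\<forall>n. X n \<in> borel_measurable (F t))
      \<and> (AE \<omega> in M. (\<lambda>n. X n \<omega>) \<longlonglongrightarrow> N (min t (\<rho> \<omega>)) \<omega> - N (min s (\<rho> \<omega>)) \<omega>)"
    and "integrable M (\<lambda>\<omega>. indicator A \<omega> * (N (min t (\<rho> \<omega>)) \<omega> - N (min s (\<rho> \<omega>)) \<omega>))"
    and "(\<integral>\<omega>. indicator A \<omega> * (N (min t (\<rho> \<omega>)) \<omega> - N (min s (\<rho> \<omega>)) \<omega>) \<partial>M) = 0"
proof -
  define \<delta> where "\<delta> n = (t - s) / real (Suc n)" for n
  have \<delta>: "0 \<le> \<delta> n" "real (Suc n) * \<delta> n = t - s" for n using st by (simp_all add: \<delta>_def)
  define u where "u n k = s + real k * \<delta> n" for n k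
  have u0: "u n 0 = s" and uE: "u n (Suc n) = t" for n using \<delta>(2)[of n] by (simp_all add: u_def)
  have u_inc: "incseq (u n)" for n
    using \<delta>(1)[of n] by (auto simp: incseq_def u_def intro!: mult_right_mono)
  have u_step: "u n (Suc k) - u n k = \<delta> n" for n k
    by (simp add: u_def distrib_right)
  have u_ge: "0 \<le> u n k" for n k using incseqD[OF u_inc, of 0 k n] u0 st by simp
  have u_le: "u n k \<le> t" if "k \<le> Suc n" for n k using incseqD[OF u_inc that, of n] uE[of n] by simp
  have Nm: "N v \<in> borel_measurable (F v)" "integrable M (N v)" if "0 \<le> v" for v
    using N that by (auto simp: martingale_def adapted_def)
  define b where "b n k \<omega> = (if \<omega> \<in> space M \<and> u n k < \<rho> \<omega> then 1 else 0 :: real)" for n k \<omega>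
  have b_meas: "b n k \<in> borel_measurable (F (u n k))" for n k
  proof -
    have "{\<omega> \<in> space M. \<rho> \<omega> \<le> u n k} \<in> sets (F (u n k))"
      using \<rho> u_ge[of n k] by (auto simp: stopping_time_r_def)
    then have "space (F (u n k)) - {\<omega> \<in> space M. \<rho> \<omega> \<le> u n k} \<in> sets (F (u n k))" by blast
    moreover have "space (F (u n k)) - {\<omega> \<in> space M. \<rho> \<omega> \<le> u n k} = {\<omega> \<in> space M. u n k < \<rho> \<omega>}"
      by auto
    moreover have "b n k = indicator {\<omega> \<in> space M. u n k < \<rho> \<omega>}"
      by (auto simp: b_def indicator_def)
    ultimately show ?thesis by simp
  qed
  define T where "T n m \<omega> = N s \<omega> + (\<Sum>k<m. b n k \<omega> * (N (u n (Suc k)) \<omega> - N (u n k) \<omega>))" for n m \<omega>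
  have T_meas: "T n m \<in> borel_measurable (F (u n m))" for n m
    unfolding T_def
  proof (intro borel_measurable_add borel_measurable_sum borel_measurable_times borel_measurable_diff)
    show "N s \<in> borel_measurable (F (u n m))"
      using measF_mono[OF Nm(1)[OF st(1)] st(1)] incseqD[OF u_inc, of 0 m n] u0 by auto
    fix k assume "k \<in> {..<m}"
    then have "u n k \<le> u n m" "u n (Suc k) \<le> u n m" using incseqD[OF u_inc] by auto
    then show "b n k \<in> borel_measurable (F (u n m))" "N (u n (Suc k)) \<in> borel_measurable (F (u n m))"
      "N (u n k) \<in> borel_measurable (F (u n m))"
      using measF_mono[OF b_meas u_ge] measF_mono[OF Nm(1)[OF u_ge] u_ge] by blast+
  qed
  have b_int: "integrable M (\<lambda>\<omega>. b n k \<omega> * (N (u n (Suc k)) \<omega> - N (u n k) \<omega>))" for n k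
    by (rule martingale_increment_bounded(1)[OF N u_ge _ b_meas])
       (use incseq_SucD[OF u_inc] in \<open>auto simp: b_def\<close>)
  have T_int: "integrable M (T n m)" for n m
    unfolding T_def using Nm(2)[OF st(1)] b_int by simp
  have tail: "(\<integral>\<omega>. max 0 (\<bar>T n (Suc n) \<omega>\<bar> - c) \<partial>M) \<le> (\<integral>\<omega>. max 0 (\<bar>N t \<omega>\<bar> - c) \<partial>M)"
    if c: "0 \<le> c" for n c
  proof -
    \<comment> \<open>A subgradient of the convex function \<open>max 0 (\<bar>x\<bar> - c)\<close>;
      the tail comparison is Jensen's inequality in this form.\<close>
    define d where "d x = (if \<bar>x\<bar> > c then sgn x else 0)" for x :: real
    have convex: "max 0 (\<bar>x\<bar> - c) + d x * (y - x) \<le> max 0 (\<bar>y\<bar> - c)" for x y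
      using c by (auto simp: d_def sgn_if abs_if max_def)
    have d1: "\<bar>d x\<bar> \<le> 1" for x by (auto simp: d_def sgn_if)
    have [measurable]: "d \<in> borel_measurable borel" unfolding d_def by measurable
    \<comment> \<open>After stopping, \<open>T\<close> is frozen, so wherever \<open>1 - b\<close>
      is nonzero the subgradient at the final value equals the one at \<open>T n k\<close>. The
      product with \<open>N t - T n (Suc n)\<close> thus becomes a transform with weights known at
      time \<open>u n k\<close>, which has mean zero.\<close>
    define w where "w k \<omega> = (1 - b n k \<omega>) * d (T n k \<omega>)" for k \<omega>
    have w_meas: "w k \<in> borel_measurable (F (u n k))" for k
      unfolding w_def using b_meas[of n k] T_meas[of n k] by measurable
    have w1: "\<bar>w k \<omega>\<bar> \<le> 1" for k \<omega> using d1 by (auto simp: w_def b_def)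
    have wi: "integrable M (\<lambda>\<omega>. w k \<omega> * (N (u n (Suc k)) \<omega> - N (u n k) \<omega>))"
      "(\<integral>\<omega>. w k \<omega> * (N (u n (Suc k)) \<omega> - N (u n k) \<omega>) \<partial>M) = 0" for k
      by (rule martingale_increment_bounded[OF N u_ge _ w_meas w1], rule incseq_SucD[OF u_inc])+
    have pw: "max 0 (\<bar>T n (Suc n) \<omega>\<bar> - c) + (\<Sum>k<Suc n. w k \<omega> * (N (u n (Suc k)) \<omega> - N (u n k) \<omega>))
        \<le> max 0 (\<bar>N t \<omega>\<bar> - c)" if \<omega>: "\<omega> \<in> space M" for \<omega>
    proof -
      have "(\<Sum>k<Suc n. w k \<omega> * (N (u n (Suc k)) \<omega> - N (u n k) \<omega>))
          = (\<Sum>k<Suc n. d (T n (Suc n) \<omega>) * ((1 - b n k \<omega>) * (N (u n (Suc k)) \<omega> - N (u n k) \<omega>)))"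
      proof (rule sum.cong[OF refl])
        fix k assume k: "k \<in> {..<Suc n}"
        show "w k \<omega> * (N (u n (Suc k)) \<omega> - N (u n k) \<omega>)
            = d (T n (Suc n) \<omega>) * ((1 - b n k \<omega>) * (N (u n (Suc k)) \<omega> - N (u n k) \<omega>))"
        proof (cases "u n k < \<rho> \<omega>")
          case False
          have z: "b n j \<omega> = 0" if "k \<le> j" for j
            using False incseqD[OF u_inc that, of n] by (auto simp: b_def)
          have "T n m \<omega> = T n k \<omega>" if "k \<le> m" for m
            using that by (induction m rule: dec_induct) (auto simp: T_def z)
          from this[of "Suc n"] k have "T n (Suc n) \<omega> = T n k \<omega>" by simp
          then show ?thesis by (simp add: w_def)
        qed (simp add: w_def b_def \<omega>)
      qed
      also have "\<dots> = d (T n (Suc n) \<omega>) * (\<Sum>k<Suc n. (N (u n (Suc k)) \<omega> - N (u n k) \<omega>)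
            - b n k \<omega> * (N (u n (Suc k)) \<omega> - N (u n k) \<omega>))"
        unfolding sum_distrib_left by (intro sum.cong) (auto simp: algebra_simps)
      also have "(\<Sum>k<Suc n. (N (u n (Suc k)) \<omega> - N (u n k) \<omega>)
            - b n k \<omega> * (N (u n (Suc k)) \<omega> - N (u n k) \<omega>)) = N t \<omega> - T n (Suc n) \<omega>"
        using sum_lessThan_telescope[of "\<lambda>k. N (u n k) \<omega>" "Suc n"]
        by (subst sum_subtractf) (simp add: T_def u0 uE del: sum.lessThan_Suc)
      finally show ?thesis using convex[of "T n (Suc n) \<omega>" "N t \<omega>"] by simp
    qed
    have "(\<integral>\<omega>. max 0 (\<bar>T n (Suc n) \<omega>\<bar> - c) \<partial>M) = (\<integral>\<omega>. max 0 (\<bar>T n (Suc n) \<omega>\<bar> - c)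
        + (\<Sum>k<Suc n. w k \<omega> * (N (u n (Suc k)) \<omega> - N (u n k) \<omega>)) \<partial>M)"
      using T_int wi by (simp del: sum.lessThan_Suc)
    also have "\<dots> \<le> (\<integral>\<omega>. max 0 (\<bar>N t \<omega>\<bar> - c) \<partial>M)"
      by (rule integral_mono) (use pw T_int wi(1) Nm(2)[of t] st in \<open>auto simp del: sum.lessThan_Suc\<close>)
    finally show ?thesis .
  qed
  define X where "X n \<omega> = T n (Suc n) \<omega> - N s \<omega>" for n \<omega>
  have X_meas: "X n \<in> borel_measurable (F t)" for n
    unfolding X_def using T_meas[of n "Suc n"] measF_mono[OF Nm(1)[OF st(1)] st] uE by simp
  have X_int: "integrable M (X n)" for n unfolding X_def using T_int Nm(2)[OF st(1)] by simp
  have lim: "AE \<omega> in M. (\<lambda>n. X n \<omega>) \<longlonglongrightarrow> N (min t (\<rho> \<omega>)) \<omega> - N (min s (\<rho> \<omega>)) \<omega>"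
    using cont AE_space
  proof eventually_elim
    case (elim \<omega>)
    have "\<exists>j\<le>Suc n. X n \<omega> = N (u n j) \<omega> - N s \<omega> \<and> (\<forall>k<j. u n k < \<rho> \<omega>) \<and> (j < Suc n \<longrightarrow> \<rho> \<omega> \<le> u n j)" for n
      using telescope_stopped[OF u_inc[of n], of "Suc n" "\<rho> \<omega>" "\<lambda>k. N (u n k) \<omega>"] elim
      by (simp add: X_def T_def b_def u0 cong: if_cong del: sum.lessThan_Suc)
    then obtain j where j: "\<And>n. j n \<le> Suc n" "\<And>n. X n \<omega> = N (u n (j n)) \<omega> - N s \<omega>"
      "\<And>n k. k < j n \<Longrightarrow> u n k < \<rho> \<omega>" "\<And>n. j n < Suc n \<Longrightarrow> \<rho> \<omega> \<le> u n (j n)" by metis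
    show ?case
    proof (cases "\<rho> \<omega> \<le> s")
      case True
      have "j n = 0" for n using j(3)[of 0 n] True u0[of n] by force
      then have "X n \<omega> = 0" for n using j(2)[of n] u0 by simp
      moreover have "min t (\<rho> \<omega>) = min s (\<rho> \<omega>)" using True st by auto
      ultimately show ?thesis by simp
    next
      case False
      \<comment> \<open>The selected grid point is the first one at or above
        \<open>\<rho> \<omega>\<close>, or the endpoint \<open>t\<close>; its predecessor lies below
        \<open>\<rho> \<omega>\<close>, so the distance is at most one step.\<close>
      have bd: "\<bar>u n (j n) - min t (\<rho> \<omega>)\<bar> \<le> \<delta> n" for n
      proof -
        have pos: "j n > 0"
        proof (rule ccontr)
          assume "\<not> ?thesis"
          then have "\<rho> \<omega> \<le> u n 0" using j(4)[of n] by simp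
          then show False using False u0 by simp
        qed
        have l: "min t (\<rho> \<omega>) \<le> u n (j n)"
        proof (cases "j n = Suc n")
          case True then show ?thesis using uE by simp
        next
          case False then show ?thesis using j(1)[of n] j(4)[of n] by auto
        qed
        have "u n (j n - 1) < \<rho> \<omega>" using j(3)[of "j n - 1" n] pos by simp
        moreover have "u n (j n) = u n (j n - 1) + \<delta> n"
          using u_step[of n "j n - 1"] pos by simp
        moreover have "u n (j n) \<le> t" using u_le[OF j(1)] .
        moreover have "0 \<le> \<delta> n" by (rule \<delta>)
        ultimately show ?thesis using l by auto
      qed
      have z: "\<delta> \<longlonglongrightarrow> 0" unfolding \<delta>_def by (rule LIMSEQ_Suc[OF lim_const_over_n])
      have "(\<lambda>n. u n (j n) - min t (\<rho> \<omega>)) \<longlonglongrightarrow> 0"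
        by (rule Lim_null_comparison[OF _ z]) (use bd in auto)
      then have "(\<lambda>n. u n (j n)) \<longlonglongrightarrow> min t (\<rho> \<omega>)" by (simp add: LIM_zero_iff)
      then have "(\<lambda>n. N (u n (j n)) \<omega>) \<longlonglongrightarrow> N (min t (\<rho> \<omega>)) \<omega>"
        by (rule continuous_on_tendsto_compose[OF elim(1)]) (use False st u_ge in auto)
      then show ?thesis using False j(2) by (auto intro!: tendsto_intros)
    qed
  qed
  let ?L = "\<lambda>\<omega>. N (min t (\<rho> \<omega>)) \<omega> - N (min s (\<rho> \<omega>)) \<omega>"
  have L_meas: "?L \<in> borel_measurable (F t)"
    by (rule measF_AE_limit[OF X_meas lim]) (use st in auto)
  have [measurable]: "A \<in> sets M" "?L \<in> borel_measurable M" using A sets_F_M measF[OF L_meas] by auto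
  have Ai: "integrable M (\<lambda>\<omega>. indicator A \<omega> * X n \<omega>)" for n
    using integrable_mult_indicator[OF _ X_int[of n], of A] by simp
  have A0: "(\<integral>\<omega>. indicator A \<omega> * X n \<omega> \<partial>M) = 0" for n
  proof -
    define w where "w k \<omega> = indicator A \<omega> * b n k \<omega>" for k \<omega>
    have w_meas: "w k \<in> borel_measurable (F (u n k))" for k
    proof -
      have "A \<in> sets (F (u n k))" using A sets_F_mono[OF st(1), of "u n k"] incseqD[OF u_inc, of 0 k n] u0 by auto
      then show ?thesis unfolding w_def using b_meas[of n k] by measurable
    qed
    have w1: "\<bar>w k \<omega>\<bar> \<le> 1" for k \<omega> by (auto simp: w_def b_def indicator_def)
    have wi: "integrable M (\<lambda>\<omega>. w k \<omega> * (N (u n (Suc k)) \<omega> - N (u n k) \<omega>))"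
      "(\<integral>\<omega>. w k \<omega> * (N (u n (Suc k)) \<omega> - N (u n k) \<omega>) \<partial>M) = 0" for k
      by (rule martingale_increment_bounded[OF N u_ge _ w_meas w1], rule incseq_SucD[OF u_inc])+
    have "(\<integral>\<omega>. indicator A \<omega> * X n \<omega> \<partial>M) = (\<integral>\<omega>. (\<Sum>k<Suc n. w k \<omega> * (N (u n (Suc k)) \<omega> - N (u n k) \<omega>)) \<partial>M)"
      by (simp add: X_def T_def w_def sum_distrib_left mult.assoc del: sum.lessThan_Suc)
    also have "\<dots> = 0" using wi by (simp del: sum.lessThan_Suc)
    finally show ?thesis .
  qed
  have Alim: "AE \<omega> in M. (\<lambda>n. indicator A \<omega> * X n \<omega>) \<longlonglongrightarrow> indicator A \<omega> * ?L \<omega>"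
    using lim by eventually_elim (intro tendsto_intros)
  \<comment> \<open>The majorant uses that \<open>\<bar>x\<bar>\<close> is at most
    \<open>c + max 0 (\<bar>x\<bar> - c)\<close> for the stopped value; the mean of the excess is
    controlled by \<open>tail\<close>, uniformly in \<open>n\<close>.\<close>
  have ui: "\<exists>g r. integrable M g \<and> (\<forall>n. integrable M (r n) \<and> (\<integral>\<omega>. r n \<omega> \<partial>M) \<le> e
          \<and> (AE \<omega> in M. 0 \<le> r n \<omega> \<and> \<bar>indicator A \<omega> * X n \<omega>\<bar> \<le> g \<omega> + r n \<omega>))" if e: "e > 0" for e :: real
  proof -
    obtain c where c: "c \<ge> 0" "(\<integral>\<omega>. max 0 (\<bar>N t \<omega>\<bar> - c) \<partial>M) \<le> e"
      using martingale_tail_small[OF Nm(2) e, of t] st by auto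
    show ?thesis
    proof (intro exI[of _ "\<lambda>\<omega>. c + \<bar>N s \<omega>\<bar>"] exI[of _ "\<lambda>n \<omega>. max 0 (\<bar>T n (Suc n) \<omega>\<bar> - c)"] conjI allI)
      fix n
      show "(\<integral>\<omega>. max 0 (\<bar>T n (Suc n) \<omega>\<bar> - c) \<partial>M) \<le> e" using tail[OF c(1)] c(2) order_trans by blast
      show "AE \<omega> in M. 0 \<le> max 0 (\<bar>T n (Suc n) \<omega>\<bar> - c)
          \<and> \<bar>indicator A \<omega> * X n \<omega>\<bar> \<le> c + \<bar>N s \<omega>\<bar> + max 0 (\<bar>T n (Suc n) \<omega>\<bar> - c)"
        using c(1) by (intro AE_I2) (auto simp: X_def indicator_def)
    qed (use Nm(2)[OF st(1)] T_int in auto)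
  qed
  have Lm: "(\<lambda>\<omega>. indicator A \<omega> * ?L \<omega>) \<in> borel_measurable M" by measurable
  note res = integral_tendsto_uniformly_integrable[OF Ai Lm Alim ui]
  show "\<exists>X. (\<forall>n. X n \<in> borel_measurable (F t)) \<and> (AE \<omega> in M. (\<lambda>n. X n \<omega>) \<longlonglongrightarrow> ?L \<omega>)"
    using X_meas lim by blast
  show "integrable M (\<lambda>\<omega>. indicator A \<omega> * ?L \<omega>)" by (rule res(1))
  show "(\<integral>\<omega>. indicator A \<omega> * ?L \<omega> \<partial>M) = 0"
    using res(2) unfolding A0 by (simp add: LIMSEQ_const_iff)
qed

text \<open>Adaptedness, too, is taken from the approximation: the stopped increment is an almost
  sure limit of sums that are measurable for \<open>F t\<close>.\<close>

lemma martingale_stopped: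
  assumes N: "martingale M F N" and cont: "AE \<omega> in M. continuous_on {0..} (\<lambda>t. N t \<omega>)"
    and \<rho>: "stopping_time_r F \<rho>" and \<rho>0: "\<And>\<omega>. \<omega> \<in> space M \<Longrightarrow> 0 \<le> \<rho> \<omega>"
  shows "martingale M F (\<lambda>t \<omega>. N (min t (\<rho> \<omega>)) \<omega>)"
proof -
  have N0: "N 0 \<in> borel_measurable (F 0)" "integrable M (N 0)"
    using N by (auto simp: martingale_def adapted_def)
  have eq: "N (min t (\<rho> \<omega>)) \<omega> = (N (min t (\<rho> \<omega>)) \<omega> - N (min 0 (\<rho> \<omega>)) \<omega>) + N 0 \<omega>"
    if "\<omega> \<in> space M" for \<omega> t using \<rho>0[OF that] by (simp add: min_absorb1)
  have ad: "(\<lambda>\<omega>. N (min t (\<rho> \<omega>)) \<omega>) \<in> borel_measurable (F t)"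
    and int: "integrable M (\<lambda>\<omega>. N (min t (\<rho> \<omega>)) \<omega>)" if t: "0 \<le> t" for t
  proof -
    have sp: "space M \<in> sets (F 0)" using sets.top[of "F 0"] by simp
    note approx = stopped_martingale_approx[OF N cont \<rho> order_refl t sp]
    obtain X where X: "\<And>n. X n \<in> borel_measurable (F t)"
      "AE \<omega> in M. (\<lambda>n. X n \<omega>) \<longlonglongrightarrow> N (min t (\<rho> \<omega>)) \<omega> - N (min 0 (\<rho> \<omega>)) \<omega>"
      using approx(1) by blast
    have "(\<lambda>\<omega>. N (min t (\<rho> \<omega>)) \<omega> - N (min 0 (\<rho> \<omega>)) \<omega>) \<in> borel_measurable (F t)"
      by (rule measF_AE_limit[OF X(1,2) t])
    then have "(\<lambda>\<omega>. (N (min t (\<rho> \<omega>)) \<omega> - N (min 0 (\<rho> \<omega>)) \<omega>) + N 0 \<omega>) \<in> borel_measurable (F t)"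
      using measF_mono[OF N0(1) order_refl t] by simp
    then show "(\<lambda>\<omega>. N (min t (\<rho> \<omega>)) \<omega>) \<in> borel_measurable (F t)"
      by (subst measurable_cong[OF eq]) simp_all
    have "integrable M (\<lambda>\<omega>. N (min t (\<rho> \<omega>)) \<omega> - N (min 0 (\<rho> \<omega>)) \<omega>)"
      using approx(2) by (rule Bochner_Integration.integrable_cong[THEN iffD1, OF refl, rotated]) simp
    then have "integrable M (\<lambda>\<omega>. (N (min t (\<rho> \<omega>)) \<omega> - N (min 0 (\<rho> \<omega>)) \<omega>) + N 0 \<omega>)" using N0(2) by simp
    then show "integrable M (\<lambda>\<omega>. N (min t (\<rho> \<omega>)) \<omega>)"
      by (subst Bochner_Integration.integrable_cong[OF refl eq]) simp_all
  qed
  have "(\<integral>\<omega>\<in>A. N (min t (\<rho> \<omega>)) \<omega> \<partial>M) = (\<integral>\<omega>\<in>A. N (min s (\<rho> \<omega>)) \<omega> \<partial>M)"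
    if st: "0 \<le> s" "s \<le> t" and A: "A \<in> sets (F s)" for s t A
  proof -
    have i: "integrable M (\<lambda>\<omega>. indicator A \<omega> *\<^sub>R N (min v (\<rho> \<omega>)) \<omega>)" if "0 \<le> v" for v
      using integrable_mult_indicator[OF sets_F_M[OF A] int[OF that]] .
    have "(\<integral>\<omega>. indicator A \<omega> * (N (min t (\<rho> \<omega>)) \<omega> - N (min s (\<rho> \<omega>)) \<omega>) \<partial>M)
        = (\<integral>\<omega>\<in>A. N (min t (\<rho> \<omega>)) \<omega> \<partial>M) - (\<integral>\<omega>\<in>A. N (min s (\<rho> \<omega>)) \<omega> \<partial>M)"
      unfolding set_lebesgue_integral_def
      by (subst Bochner_Integration.integral_diff[symmetric]) (use i st in \<open>auto simp: right_diff_distrib\<close>)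
    then show ?thesis using stopped_martingale_approx(3)[OF N cont \<rho> st A] by simp
  qed
  with ad int show ?thesis unfolding martingale_def adapted_def by blast
qed

end

section \<open>From local martingales to square-integrable ones\<close>

context filtered_space begin

text \<open>After stopping, the second moment of \<open>I\<close> equals the mean of the stopped
  \<open>q\<close>, which is at most the mean of \<open>Q\<close> independently of the stopping
  time. The stopped processes are thus bounded in L2, and the localisation is removed by Fatou for
  the second moments and by \<open>integral_tendsto_dominated_square\<close> for the
  orthogonality.\<close>

lemma square_of_local_martingale:
  fixes I q :: "real \<Rightarrow> 'a \<Rightarrow> real"
  assumes ad: "adapted F I" and cont: "continuous_paths M I" and I0: "\<And>\<omega>. \<omega> \<in> space M \<Longrightarrow> I 0 \<omega> = 0"
    and lm: "local_martingale M F I" and lm2: "local_martingale M F (\<lambda>t \<omega>. (I t \<omega>)\<^sup>2 - q t \<omega>)"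
    and q0: "\<And>\<omega>. q 0 \<omega> = 0" and qc: "AE \<omega> in M. continuous_on {0..} (\<lambda>t. q t \<omega>)"
    and qm: "AE \<omega> in M. \<forall>s t. 0 \<le> s \<longrightarrow> s \<le> t \<longrightarrow> q s \<omega> \<le> q t \<omega>"
    and Qb: "AE \<omega> in M. \<forall>t\<ge>0. ennreal (q t \<omega>) \<le> Q \<omega>" and Qfin: "(\<integral>\<^sup>+\<omega>. Q \<omega> \<partial>M) < \<infinity>"
  shows "\<And>t. 0 \<le> t \<Longrightarrow> integrable M (\<lambda>\<omega>. (I t \<omega>)\<^sup>2)"
    and "\<And>s t W. 0 \<le> s \<Longrightarrow> s \<le> t \<Longrightarrow> W \<in> borel_measurable (F s) \<Longrightarrow> integrable M (\<lambda>\<omega>. (W \<omega>)\<^sup>2)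
        \<Longrightarrow> (\<integral>\<omega>. W \<omega> * (I t \<omega> - I s \<omega>) \<partial>M) = 0"
    and "\<And>s t. 0 \<le> s \<Longrightarrow> s \<le> t \<Longrightarrow>
        (\<integral>\<^sup>+\<omega>. ennreal ((I t \<omega> - I s \<omega>)\<^sup>2) \<partial>M) \<le> (\<integral>\<^sup>+\<omega>. ennreal (q t \<omega> - q s \<omega>) \<partial>M)"
proof -
  obtain \<tau> where \<tau>: "\<And>n. stopping_time_r F (\<tau> n)" "\<And>n \<omega>. \<omega> \<in> space M \<Longrightarrow> 0 \<le> \<tau> n \<omega>"
    "\<And>\<omega>. \<omega> \<in> space M \<Longrightarrow> filterlim (\<lambda>n. \<tau> n \<omega>) at_top sequentially"
    "\<And>n. martingale M F (\<lambda>t \<omega>. I (min t (\<tau> n \<omega>)) \<omega>)"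
    using lm unfolding local_martingale_def by blast
  define J where "J t \<omega> = (I t \<omega>)\<^sup>2 - q t \<omega>" for t \<omega>
  obtain \<rho> where \<rho>: "\<And>n. stopping_time_r F (\<rho> n)" "\<And>n \<omega>. \<omega> \<in> space M \<Longrightarrow> 0 \<le> \<rho> n \<omega>"
    "\<And>\<omega>. \<omega> \<in> space M \<Longrightarrow> filterlim (\<lambda>n. \<rho> n \<omega>) at_top sequentially"
    "\<And>n. martingale M F (\<lambda>t \<omega>. J (min t (\<rho> n \<omega>)) \<omega>)"
    using lm2 unfolding local_martingale_def J_def by blast
  \<comment> \<open>The local martingales \<open>I\<close> and \<open>J\<close> come with unrelated
    localising sequences. Stopping each stopped martingale once more at the other time gives a
    common one; this second stopping uses \<open>martingale_stopped\<close>.\<close>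
  define \<theta> where "\<theta> n \<omega> = min (\<tau> n \<omega>) (\<rho> n \<omega>)" for n \<omega>
  have \<theta>0: "0 \<le> \<theta> n \<omega>" if "\<omega> \<in> space M" for n \<omega> using \<tau>(2) \<rho>(2) that by (simp add: \<theta>_def)
  have ev: "\<forall>\<^sub>F n in sequentially. t \<le> \<theta> n \<omega>" if "\<omega> \<in> space M" for \<omega> t
    using \<tau>(3)[OF that, unfolded filterlim_at_top, rule_format, of t]
      \<rho>(3)[OF that, unfolded filterlim_at_top, rule_format, of t]
    by eventually_elim (simp add: \<theta>_def)
  have contI: "continuous_on {0..} (\<lambda>t. I t \<omega>)" if "\<omega> \<in> space M" for \<omega>
    using cont that by (simp add: continuous_paths_def)
  have stopc: "continuous_on {0..} (\<lambda>t. f (min t c))" if "continuous_on {0..} f" "0 \<le> c"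
    for f :: "real \<Rightarrow> real" and c
    by (rule continuous_on_compose2[OF that(1)]) (use that(2) in \<open>auto intro!: continuous_intros\<close>)
  have contJ: "AE \<omega> in M. continuous_on {0..} (\<lambda>t. J t \<omega>)"
    using qc AE_space unfolding J_def by eventually_elim (intro continuous_intros contI)
  have mI: "martingale M F (\<lambda>t \<omega>. I (min t (\<theta> n \<omega>)) \<omega>)" for n
  proof -
    have "martingale M F (\<lambda>t \<omega>. (\<lambda>t \<omega>. I (min t (\<tau> n \<omega>)) \<omega>) (min t (\<rho> n \<omega>)) \<omega>)"
    proof (rule martingale_stopped[OF \<tau>(4) _ \<rho>(1) \<rho>(2)])
      show "AE \<omega> in M. continuous_on {0..} (\<lambda>t. I (min t (\<tau> n \<omega>)) \<omega>)"
        by (rule AE_I2) (rule stopc[OF contI \<tau>(2)])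
    qed
    then show ?thesis by (simp add: \<theta>_def min.assoc min.commute[of "\<rho> n _"])
  qed
  have mJ: "martingale M F (\<lambda>t \<omega>. J (min t (\<theta> n \<omega>)) \<omega>)" for n
  proof -
    have "martingale M F (\<lambda>t \<omega>. (\<lambda>t \<omega>. J (min t (\<rho> n \<omega>)) \<omega>) (min t (\<tau> n \<omega>)) \<omega>)"
    proof (rule martingale_stopped[OF \<rho>(4) _ \<tau>(1) \<tau>(2)])
      show "AE \<omega> in M. continuous_on {0..} (\<lambda>t. J (min t (\<rho> n \<omega>)) \<omega>)"
        using contJ AE_space by eventually_elim (rule stopc, assumption, rule \<rho>(2))
    qed
    then show ?thesis by (simp add: \<theta>_def min.assoc)
  qed
  define In where "In n t \<omega> = I (min t (\<theta> n \<omega>)) \<omega>" for n t \<omega>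
  define qn where "qn n t \<omega> = q (min t (\<theta> n \<omega>)) \<omega>" for n t \<omega>
  have In_meas: "In n t \<in> borel_measurable (F t)" "integrable M (In n t)" if "0 \<le> t" for n t
    using mI[of n] that unfolding martingale_def adapted_def In_def by blast+
  have InM: "In n t \<in> borel_measurable M" if "0 \<le> t" for n t using measF[OF In_meas(1)[OF that]] .
  have Jn_int: "integrable M (\<lambda>\<omega>. (In n t \<omega>)\<^sup>2 - qn n t \<omega>)" if "0 \<le> t" for n t
    using mJ[of n] that unfolding martingale_def J_def In_def qn_def by blast
  have Jn0: "(\<integral>\<omega>. (In n t \<omega>)\<^sup>2 - qn n t \<omega> \<partial>M) = 0" if t: "0 \<le> t" for n t
  proof -
    have sp: "space M \<in> sets (F 0)" using sets.top[of "F 0"] by simp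
    have "(\<integral>\<omega>\<in>space M. J (min t (\<theta> n \<omega>)) \<omega> \<partial>M) = (\<integral>\<omega>\<in>space M. J (min 0 (\<theta> n \<omega>)) \<omega> \<partial>M)"
      using mJ[of n] t sp unfolding martingale_def by blast
    also have "\<dots> = (\<integral>\<omega>\<in>space M. 0 \<partial>M)"
      by (rule set_lebesgue_integral_cong) (auto simp: min_absorb1 \<theta>0 J_def I0 q0)
    also have "(\<integral>\<omega>\<in>space M. J (min t (\<theta> n \<omega>)) \<omega> \<partial>M) = (\<integral>\<omega>. J (min t (\<theta> n \<omega>)) \<omega> \<partial>M)"
      by (rule set_integral_space[OF mJ[of n, unfolded martingale_def, THEN conjunct2, THEN conjunct1, rule_format, OF t]])
    finally show ?thesis by (simp add: J_def In_def qn_def set_lebesgue_integral_def)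
  qed
  have qn_bound: "AE \<omega> in M. 0 \<le> qn n t \<omega> \<and> ennreal (qn n t \<omega>) \<le> Q \<omega>" if "0 \<le> t" for n t
    using qm Qb AE_space
  proof eventually_elim
    case (elim \<omega>)
    have "0 \<le> min t (\<theta> n \<omega>)" using \<theta>0 elim that by simp
    then show ?case using elim(1)[rule_format, of 0 "min t (\<theta> n \<omega>)"] elim(2) q0 by (simp add: qn_def)
  qed
  have qn_int: "integrable M (qn n t)" if t: "0 \<le> t" for n t
  proof (rule integrableI_bounded)
    \<comment> \<open>Measurability of \<open>qn\<close> is recovered by subtracting the measurable
      martingale from the measurable square; its integrability comes from \<open>Q\<close>. The
      square of \<open>In\<close> then becomes integrable as the sum of the martingale and
      \<open>qn\<close>.\<close>
    have "(\<lambda>\<omega>. (In n t \<omega>)\<^sup>2 - qn n t \<omega>) \<in> borel_measurable M"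
      by (rule borel_measurable_integrable[OF Jn_int[OF t]])
    then have "(\<lambda>\<omega>. (In n t \<omega>)\<^sup>2 - ((In n t \<omega>)\<^sup>2 - qn n t \<omega>)) \<in> borel_measurable M"
      by (rule borel_measurable_diff[OF borel_measurable_power[OF InM[OF t]]])
    then show "qn n t \<in> borel_measurable M" by simp
    have "(\<integral>\<^sup>+\<omega>. ennreal (norm (qn n t \<omega>)) \<partial>M) \<le> (\<integral>\<^sup>+\<omega>. Q \<omega> \<partial>M)"
    proof (rule nn_integral_mono_AE)
      show "AE \<omega> in M. ennreal (norm (qn n t \<omega>)) \<le> Q \<omega>"
        using qn_bound[OF t, of n] by eventually_elim simp
    qed
    then show "(\<integral>\<^sup>+\<omega>. ennreal (norm (qn n t \<omega>)) \<partial>M) < \<infinity>" using Qfin by (rule le_less_trans)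
  qed
  have In_sq: "integrable M (\<lambda>\<omega>. (In n t \<omega>)\<^sup>2)" if t: "0 \<le> t" for n t
    using Bochner_Integration.integrable_add[OF Jn_int[OF t, of n] qn_int[OF t, of n]] by simp
  have In_sq_eq: "(\<integral>\<omega>. (In n t \<omega>)\<^sup>2 \<partial>M) = (\<integral>\<omega>. qn n t \<omega> \<partial>M)" if t: "0 \<le> t" for n t
    using Jn0[OF t, of n] In_sq[OF t, of n] qn_int[OF t, of n] by simp
  have In_orth: "(\<integral>\<omega>. W \<omega> * (In n t \<omega> - In n s \<omega>) \<partial>M) = 0"
    "integrable M (\<lambda>\<omega>. W \<omega> * (In n t \<omega> - In n s \<omega>))"
    if st: "0 \<le> s" "s \<le> t" and W: "W \<in> borel_measurable (F s)" "integrable M (\<lambda>\<omega>. (W \<omega>)\<^sup>2)" for s t W n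
  proof -
    have t: "0 \<le> t" using st by simp
    have i: "integrable M (\<lambda>\<omega>. W \<omega> * In n u \<omega>)" if "0 \<le> u" for u
      by (rule integrable_square_mult[OF measF[OF W(1)] InM[OF that] W(2) In_sq[OF that]])
    have "(\<integral>\<omega>. W \<omega> * In n t \<omega> \<partial>M) = (\<integral>\<omega>. W \<omega> * In n s \<omega> \<partial>M)"
      unfolding In_def by (rule martingale_mult_eq[OF mI st W(1) i[OF t, unfolded In_def]])
    then show "(\<integral>\<omega>. W \<omega> * (In n t \<omega> - In n s \<omega>) \<partial>M) = 0"
      "integrable M (\<lambda>\<omega>. W \<omega> * (In n t \<omega> - In n s \<omega>))"
      using i[OF t] i[OF st(1)] by (simp_all add: right_diff_distrib)
  qed
  have In_diff: "integrable M (\<lambda>\<omega>. (In n t \<omega> - In n s \<omega>)\<^sup>2)"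
    "(\<integral>\<omega>. (In n t \<omega> - In n s \<omega>)\<^sup>2 \<partial>M) = (\<integral>\<omega>. qn n t \<omega> - qn n s \<omega> \<partial>M)"
    if st: "0 \<le> s" "s \<le> t" for s t n
  proof -
    have t: "0 \<le> t" using st by simp
    \<comment> \<open>The last product has mean zero by orthogonality, so the mean square of an
      increment is the difference of the mean squares.\<close>
    have eq: "(In n t \<omega> - In n s \<omega>)\<^sup>2 = (In n t \<omega>)\<^sup>2 - (In n s \<omega>)\<^sup>2 - 2 * (In n s \<omega> * (In n t \<omega> - In n s \<omega>))" for \<omega>
      by (simp add: power2_eq_square algebra_simps)
    note o = In_orth[OF st In_meas(1)[OF st(1)] In_sq[OF st(1)], of n n]
    show "integrable M (\<lambda>\<omega>. (In n t \<omega> - In n s \<omega>)\<^sup>2)"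
      unfolding eq using o(2) In_sq[OF t] In_sq[OF st(1)]
      by (intro Bochner_Integration.integrable_diff integrable_mult_right) auto
    show "(\<integral>\<omega>. (In n t \<omega> - In n s \<omega>)\<^sup>2 \<partial>M) = (\<integral>\<omega>. qn n t \<omega> - qn n s \<omega> \<partial>M)"
      unfolding eq using o In_sq[OF t] In_sq[OF st(1)] In_sq_eq[OF t] In_sq_eq[OF st(1)]
        qn_int[OF t] qn_int[OF st(1)] by simp
  qed
  have In_diff_le: "(\<integral>\<^sup>+\<omega>. ennreal ((In n t \<omega> - In n s \<omega>)\<^sup>2) \<partial>M) \<le> (\<integral>\<^sup>+\<omega>. ennreal (q t \<omega> - q s \<omega>) \<partial>M)"
    if st: "0 \<le> s" "s \<le> t" for s t n
  proof -
    have t: "0 \<le> t" using st by simp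
    \<comment> \<open>Stopping a nondecreasing process can only shrink its increments, which gives a
      bound that is free of \<open>n\<close>.\<close>
    have b: "AE \<omega> in M. 0 \<le> qn n t \<omega> - qn n s \<omega> \<and> qn n t \<omega> - qn n s \<omega> \<le> q t \<omega> - q s \<omega>"
      using qm AE_space
    proof eventually_elim
      case (elim \<omega>)
      have "0 \<le> \<theta> n \<omega>" using \<theta>0 elim by simp
      then have "q s \<omega> \<le> q t \<omega>" "\<theta> n \<omega> \<le> t \<Longrightarrow> q (\<theta> n \<omega>) \<omega> \<le> q t \<omega>" "s \<le> \<theta> n \<omega> \<Longrightarrow> q s \<omega> \<le> q (\<theta> n \<omega>) \<omega>"
        using elim(1)[rule_format, of s t] elim(1)[rule_format, of "\<theta> n \<omega>" t]
          elim(1)[rule_format, of s "\<theta> n \<omega>"] st by auto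
      then show ?case using st by (auto simp: qn_def min_def)
    qed
    have "(\<integral>\<^sup>+\<omega>. ennreal ((In n t \<omega> - In n s \<omega>)\<^sup>2) \<partial>M) = ennreal (\<integral>\<omega>. (In n t \<omega> - In n s \<omega>)\<^sup>2 \<partial>M)"
      by (rule nn_integral_eq_integral[OF In_diff(1)[OF st]]) simp
    also have "\<dots> = ennreal (\<integral>\<omega>. qn n t \<omega> - qn n s \<omega> \<partial>M)" by (simp only: In_diff(2)[OF st])
    also have "\<dots> = (\<integral>\<^sup>+\<omega>. ennreal (qn n t \<omega> - qn n s \<omega>) \<partial>M)"
      by (rule nn_integral_eq_integral[symmetric])
         (use qn_int[OF t] qn_int[OF st(1)] in simp, use b in eventually_elim, simp)
    also have "\<dots> \<le> (\<integral>\<^sup>+\<omega>. ennreal (q t \<omega> - q s \<omega>) \<partial>M)"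
      by (rule nn_integral_mono_AE) (use b in eventually_elim, rule ennreal_leI, simp)
    finally show ?thesis .
  qed
  have lim: "(\<lambda>n. In n t \<omega>) \<longlonglongrightarrow> I t \<omega>" if "\<omega> \<in> space M" for t \<omega>
    by (rule tendsto_eventually) (use ev[OF that, of t] in \<open>auto elim!: eventually_mono simp: In_def min_absorb1\<close>)
  have IM: "I t \<in> borel_measurable M" if "0 \<le> t" for t
    using ad that measF[of "I t" t] by (auto simp: adapted_def)
  show incr: "(\<integral>\<^sup>+\<omega>. ennreal ((I t \<omega> - I s \<omega>)\<^sup>2) \<partial>M) \<le> (\<integral>\<^sup>+\<omega>. ennreal (q t \<omega> - q s \<omega>) \<partial>M)"
    if st: "0 \<le> s" "s \<le> t" for s t
  proof -
    have t: "0 \<le> t" using st by simp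
    have "(\<integral>\<^sup>+\<omega>. ennreal ((I t \<omega> - I s \<omega>)\<^sup>2) \<partial>M) = (\<integral>\<^sup>+\<omega>. liminf (\<lambda>n. ennreal ((In n t \<omega> - In n s \<omega>)\<^sup>2)) \<partial>M)"
      by (intro nn_integral_cong lim_imp_Liminf[symmetric] tendsto_ennrealI tendsto_intros lim) auto
    also have "\<dots> \<le> liminf (\<lambda>n. \<integral>\<^sup>+\<omega>. ennreal ((In n t \<omega> - In n s \<omega>)\<^sup>2) \<partial>M)"
      by (rule nn_integral_liminf) (use InM[OF t] InM[OF st(1)] in measurable)
    also have "\<dots> \<le> liminf (\<lambda>n::nat. \<integral>\<^sup>+\<omega>. ennreal (q t \<omega> - q s \<omega>) \<partial>M)"
      by (intro Liminf_mono always_eventually allI In_diff_le st)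
    also have "\<dots> = (\<integral>\<^sup>+\<omega>. ennreal (q t \<omega> - q s \<omega>) \<partial>M)" by (simp add: Liminf_const)
    finally show ?thesis .
  qed
  have qQ: "(\<integral>\<^sup>+\<omega>. ennreal (q t \<omega> - q s \<omega>) \<partial>M) \<le> (\<integral>\<^sup>+\<omega>. Q \<omega> \<partial>M)" if st: "0 \<le> s" "s \<le> t" for s t
  proof (rule nn_integral_mono_AE)
    show "AE \<omega> in M. ennreal (q t \<omega> - q s \<omega>) \<le> Q \<omega>"
      using Qb qm
    proof eventually_elim
      case (elim \<omega>)
      have "ennreal (q t \<omega> - q s \<omega>) \<le> ennreal (q t \<omega>)"
        using elim(2)[rule_format, of 0 s] st q0 by (intro ennreal_leI) simp
      also have "\<dots> \<le> Q \<omega>" using elim(1) st by simp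
      finally show ?case .
    qed
  qed
  show sq: "integrable M (\<lambda>\<omega>. (I t \<omega>)\<^sup>2)" if t: "0 \<le> t" for t
  proof (rule integrableI_bounded)
    show "(\<lambda>\<omega>. (I t \<omega>)\<^sup>2) \<in> borel_measurable M" using IM[OF t] by measurable
    have "(\<integral>\<^sup>+\<omega>. ennreal (norm ((I t \<omega>)\<^sup>2)) \<partial>M) = (\<integral>\<^sup>+\<omega>. ennreal ((I t \<omega> - I 0 \<omega>)\<^sup>2) \<partial>M)"
      by (rule nn_integral_cong) (simp add: I0)
    also have "\<dots> \<le> (\<integral>\<^sup>+\<omega>. Q \<omega> \<partial>M)" using incr[of 0 t] qQ[of 0 t] t by simp
    finally show "(\<integral>\<^sup>+\<omega>. ennreal (norm ((I t \<omega>)\<^sup>2)) \<partial>M) < \<infinity>" using Qfin by (rule le_less_trans)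
  qed
  show "(\<integral>\<omega>. W \<omega> * (I t \<omega> - I s \<omega>) \<partial>M) = 0"
    if st: "0 \<le> s" "s \<le> t" and W: "W \<in> borel_measurable (F s)" "integrable M (\<lambda>\<omega>. (W \<omega>)\<^sup>2)" for s t W
  proof -
    have t: "0 \<le> t" using st by simp
    have "(\<lambda>n. \<integral>\<omega>. W \<omega> * (In n t \<omega> - In n s \<omega>) \<partial>M) \<longlonglongrightarrow> (\<integral>\<omega>. W \<omega> * (I t \<omega> - I s \<omega>) \<partial>M)"
    proof (rule integral_tendsto_dominated_square(2))
      show "integrable M (\<lambda>\<omega>. W \<omega> * (In n t \<omega> - In n s \<omega>))" for n by (rule In_orth(2)[OF st W])
      show "(\<lambda>\<omega>. W \<omega> * (I t \<omega> - I s \<omega>)) \<in> borel_measurable M"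
        using measF[OF W(1)] IM[OF t] IM[OF st(1)] by measurable
      show "AE \<omega> in M. (\<lambda>n. W \<omega> * (In n t \<omega> - In n s \<omega>)) \<longlonglongrightarrow> W \<omega> * (I t \<omega> - I s \<omega>)"
        by (intro AE_I2 tendsto_intros lim)
      show "integrable M (\<lambda>\<omega>. (\<bar>W \<omega>\<bar>)\<^sup>2)" using W(2) by simp
      show "integrable M (\<lambda>\<omega>. \<bar>In n t \<omega> - In n s \<omega>\<bar>\<^sup>2)" for n using In_diff(1)[OF st] by simp
      show "(\<integral>\<omega>. \<bar>In n t \<omega> - In n s \<omega>\<bar>\<^sup>2 \<partial>M) \<le> enn2real (\<integral>\<^sup>+\<omega>. Q \<omega> \<partial>M)" for n
      proof -
        have "ennreal (\<integral>\<omega>. (In n t \<omega> - In n s \<omega>)\<^sup>2 \<partial>M) = (\<integral>\<^sup>+\<omega>. ennreal ((In n t \<omega> - In n s \<omega>)\<^sup>2) \<partial>M)"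
          by (rule nn_integral_eq_integral[symmetric, OF In_diff(1)[OF st]]) simp
        also have "\<dots> \<le> (\<integral>\<^sup>+\<omega>. Q \<omega> \<partial>M)" using In_diff_le[OF st] qQ[OF st] by (rule order_trans)
        also have "\<dots> = ennreal (enn2real (\<integral>\<^sup>+\<omega>. Q \<omega> \<partial>M))" using Qfin by simp
        finally show ?thesis by (simp add: ennreal_le_iff)
      qed
      show "AE \<omega> in M. \<bar>W \<omega> * (In n t \<omega> - In n s \<omega>)\<bar> \<le> \<bar>W \<omega>\<bar> * \<bar>In n t \<omega> - In n s \<omega>\<bar>" for n
        by (simp add: abs_mult)
    qed
    then show ?thesis by (simp add: In_orth(1)[OF st W] LIMSEQ_const_iff)
  qed
qed

end

section \<open>Square integrable martingales on dyadic grids\<close>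

text \<open>\<open>C s\<close> bounds the energy that \<open>I\<close> has left after time
  \<open>s\<close>. It enters every maximal estimate, and its decay makes the tails small.\<close>

locale sq_martingale = filtered_space M F for M :: "'a measure" and F +
  fixes I :: "real \<Rightarrow> 'a \<Rightarrow> 'b::euclidean_space" and C :: "real \<Rightarrow> real"
  assumes I_adapted: "\<And>t. 0 \<le> t \<Longrightarrow> I t \<in> borel_measurable (F t)"
    and I_cont: "\<And>\<omega>. \<omega> \<in> space M \<Longrightarrow> continuous_on {0..} (\<lambda>t. I t \<omega>)"
    and I_zero: "\<And>\<omega>. \<omega> \<in> space M \<Longrightarrow> I 0 \<omega> = 0"
    and I_sq: "\<And>t. 0 \<le> t \<Longrightarrow> integrable M (\<lambda>\<omega>. (norm (I t \<omega>))\<^sup>2)"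
    and I_orth: "\<And>s t W. 0 \<le> s \<Longrightarrow> s \<le> t \<Longrightarrow> W \<in> borel_measurable (F s)
        \<Longrightarrow> integrable M (\<lambda>\<omega>. (norm (W \<omega>))\<^sup>2) \<Longrightarrow> (\<integral>\<omega>. W \<omega> \<bullet> (I t \<omega> - I s \<omega>) \<partial>M) = 0"
    and I_incr: "\<And>s t. 0 \<le> s \<Longrightarrow> s \<le> t \<Longrightarrow> (\<integral>\<omega>. (norm (I t \<omega> - I s \<omega>))\<^sup>2 \<partial>M) \<le> C s"
begin

lemma I_meas: "0 \<le> t \<Longrightarrow> I t \<in> borel_measurable M"
  using measF[OF I_adapted] .

lemma C_nonneg: "0 \<le> s \<Longrightarrow> 0 \<le> C s"
  using I_incr[of s s] by simp

definition grid :: "real \<Rightarrow> real \<Rightarrow> nat \<Rightarrow> nat \<Rightarrow> real" where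
  "grid s h n k = s + h * real k / 2 ^ n"

definition dsum :: "(real \<Rightarrow> 'a \<Rightarrow> 'b) \<Rightarrow> real \<Rightarrow> real \<Rightarrow> nat \<Rightarrow> nat \<Rightarrow> 'a \<Rightarrow> real" where
  "dsum V s h n k \<omega> = (\<Sum>j<k. V (grid s h n j) \<omega> \<bullet> (I (grid s h n (Suc j)) \<omega> - I (grid s h n j) \<omega>))"

lemma grid_mono: "0 \<le> h \<Longrightarrow> j \<le> k \<Longrightarrow> grid s h n j \<le> grid s h n k"
  by (auto simp: grid_def intro!: divide_right_mono mult_left_mono)

lemma grid_ge: "0 \<le> h \<Longrightarrow> s \<le> grid s h n k"
  by (auto simp: grid_def)

context
  fixes s h :: real assumes s: "0 \<le> s" and h: "0 \<le> h"
begin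

lemma grid_nonneg: "0 \<le> grid s h n k"
  using grid_ge[OF h, of s n k] s by simp

lemma grid_differences:
  "orthogonal_differences M (\<lambda>k. F (grid s h n k)) (\<lambda>k \<omega>. I (grid s h n (Suc k)) \<omega> - I (grid s h n k) \<omega>)"
proof unfold_locales
  show "subalgebra M (F (grid s h n k))" for k by (rule subalg_F)
  have le: "grid s h n k \<le> grid s h n (Suc k)" for k by (rule grid_mono[OF h]) simp
  show "sets (F (grid s h n k)) \<subseteq> sets (F (grid s h n (Suc k)))" for k
    by (rule sets_F_mono[OF grid_nonneg le])
  show "(\<lambda>\<omega>. I (grid s h n (Suc k)) \<omega> - I (grid s h n k) \<omega>) \<in> borel_measurable (F (grid s h n (Suc k)))" for k
    by (intro borel_measurable_diff I_adapted grid_nonneg measF_mono[OF I_adapted[OF grid_nonneg] grid_nonneg le])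
  show "integrable M (\<lambda>\<omega>. (norm (I (grid s h n (Suc k)) \<omega> - I (grid s h n k) \<omega>))\<^sup>2)" for k
    by (intro integrable_square_diff I_meas I_sq grid_nonneg)
  show "(\<integral>\<omega>. W \<omega> \<bullet> (I (grid s h n (Suc k)) \<omega> - I (grid s h n k) \<omega>) \<partial>M) = 0"
    if "W \<in> borel_measurable (F (grid s h n k))" "integrable M (\<lambda>\<omega>. (norm (W \<omega>))\<^sup>2)" for k W
    by (rule I_orth[OF grid_nonneg le that])
qed

text \<open>Pythagoras: increments over successive cells are orthogonal, so the energies add up to
  that of the total increment.\<close>

lemma grid_energy:
  "(\<Sum>j<k. \<integral>\<omega>. (norm (I (grid s h n (Suc j)) \<omega> - I (grid s h n j) \<omega>))\<^sup>2 \<partial>M) \<le> C s"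
proof -
  let ?g = "grid s h n"
  have "(\<Sum>j<k. \<integral>\<omega>. (norm (I (?g (Suc j)) \<omega> - I (?g j) \<omega>))\<^sup>2 \<partial>M) = (\<integral>\<omega>. (norm (I (?g k) \<omega> - I s \<omega>))\<^sup>2 \<partial>M)"
  proof (induction k)
    case (Suc k)
    have le: "?g k \<le> ?g (Suc k)" by (rule grid_mono[OF h]) simp
    let ?W = "\<lambda>\<omega>. I (?g k) \<omega> - I s \<omega>" and ?D = "\<lambda>\<omega>. I (?g (Suc k)) \<omega> - I (?g k) \<omega>"
    have W: "?W \<in> borel_measurable (F (?g k))"
      by (intro borel_measurable_diff I_adapted grid_nonneg measF_mono[OF I_adapted[OF s] s grid_ge[OF h]])
    have Wsq: "integrable M (\<lambda>\<omega>. (norm (?W \<omega>))\<^sup>2)" and Dsq: "integrable M (\<lambda>\<omega>. (norm (?D \<omega>))\<^sup>2)"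
      by (intro integrable_square_diff I_meas I_sq grid_nonneg s)+
    have WD: "integrable M (\<lambda>\<omega>. ?W \<omega> \<bullet> ?D \<omega>)"
      by (intro integrable_square_inner Wsq Dsq borel_measurable_diff I_meas grid_nonneg s)
    have "(\<integral>\<omega>. (norm (I (?g (Suc k)) \<omega> - I s \<omega>))\<^sup>2 \<partial>M)
        = (\<integral>\<omega>. (norm (?W \<omega>))\<^sup>2 + (norm (?D \<omega>))\<^sup>2 + 2 * (?W \<omega> \<bullet> ?D \<omega>) \<partial>M)"
    proof (rule Bochner_Integration.integral_cong[OF refl])
      fix \<omega>
      have "I (?g (Suc k)) \<omega> - I s \<omega> = ?W \<omega> + ?D \<omega>" by simp
      then show "(norm (I (?g (Suc k)) \<omega> - I s \<omega>))\<^sup>2 = (norm (?W \<omega>))\<^sup>2 + (norm (?D \<omega>))\<^sup>2 + 2 * (?W \<omega> \<bullet> ?D \<omega>)"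
        by (simp only: power2_norm_eq_inner inner_add_left inner_add_right inner_commute[of "?D \<omega>" "?W \<omega>"])
    qed
    also have "\<dots> = (\<integral>\<omega>. (norm (?W \<omega>))\<^sup>2 \<partial>M) + (\<integral>\<omega>. (norm (?D \<omega>))\<^sup>2 \<partial>M)"
      using Wsq Dsq WD I_orth[OF grid_nonneg le W Wsq] by simp
    finally show ?case using Suc by simp
  qed (simp add: grid_def)
  also have "\<dots> \<le> C s" by (rule I_incr[OF s grid_ge[OF h]])
  finally show ?thesis .
qed

text \<open>Each level gets its own \<open>\<kappa>\<close>, with a second moment bound that does
  not depend on the level. The range \<open>n * 2 ^ n\<close> of indices lets the grids become finer
  and longer at once, so that every dyadic time is eventually covered.\<close>

lemma grid_transform:
  assumes V: "\<And>t. 0 \<le> t \<Longrightarrow> V t \<in> borel_measurable (F t)"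
  shows "\<exists>\<kappa>::nat \<Rightarrow> 'a \<Rightarrow> real. \<forall>n. \<kappa> n \<in> borel_measurable M \<and> (\<forall>\<omega>. 0 \<le> \<kappa> n \<omega>)
      \<and> integrable M (\<lambda>\<omega>. (\<kappa> n \<omega>)\<^sup>2) \<and> (\<integral>\<omega>. (\<kappa> n \<omega>)\<^sup>2 \<partial>M) \<le> 4 * C s
      \<and> (\<forall>\<omega> k c. k \<le> n * 2 ^ n \<longrightarrow> 0 \<le> c \<longrightarrow> (\<forall>j<k. norm (V (grid s h n j) \<omega>) \<le> c)
            \<longrightarrow> \<bar>dsum V s h n k \<omega>\<bar> \<le> 2 * c * \<kappa> n \<omega>)"
proof (rule choice, rule allI)
  fix n
  interpret D: orthogonal_differences M "\<lambda>k. F (grid s h n k)"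
    "\<lambda>k \<omega>. I (grid s h n (Suc k)) \<omega> - I (grid s h n k) \<omega>" by (rule grid_differences)
  obtain \<kappa> where \<kappa>: "\<kappa> \<in> borel_measurable M" "\<forall>\<omega>. 0 \<le> \<kappa> \<omega>" "integrable M (\<lambda>\<omega>. (\<kappa> \<omega>)\<^sup>2)"
    "(\<integral>\<omega>. (\<kappa> \<omega>)\<^sup>2 \<partial>M)
        \<le> 4 * (\<Sum>j<n * 2 ^ n. \<integral>\<omega>. (norm (I (grid s h n (Suc j)) \<omega> - I (grid s h n j) \<omega>))\<^sup>2 \<partial>M)"
    "\<forall>\<omega> k c. k \<le> n * 2 ^ n \<longrightarrow> 0 \<le> c \<longrightarrow> (\<forall>j<k. norm (V (grid s h n j) \<omega>) \<le> c)
        \<longrightarrow> \<bar>\<Sum>j<k. V (grid s h n j) \<omega> \<bullet> (I (grid s h n (Suc j)) \<omega> - I (grid s h n j) \<omega>)\<bar> \<le> 2 * c * \<kappa> \<omega>"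
    using D.transform_bound[of "\<lambda>k. V (grid s h n k)" "n * 2 ^ n", OF V[OF grid_nonneg]] by blast
  have "(\<integral>\<omega>. (\<kappa> \<omega>)\<^sup>2 \<partial>M) \<le> 4 * C s" using \<kappa>(4) grid_energy[where n = n and k = "n * 2 ^ n"] by linarith
  then show "\<exists>\<kappa>. \<kappa> \<in> borel_measurable M \<and> (\<forall>\<omega>. 0 \<le> \<kappa> \<omega>)
      \<and> integrable M (\<lambda>\<omega>. (\<kappa> \<omega>)\<^sup>2) \<and> (\<integral>\<omega>. (\<kappa> \<omega>)\<^sup>2 \<partial>M) \<le> 4 * C s
      \<and> (\<forall>\<omega> k c. k \<le> n * 2 ^ n \<longrightarrow> 0 \<le> c \<longrightarrow> (\<forall>j<k. norm (V (grid s h n j) \<omega>) \<le> c)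
            \<longrightarrow> \<bar>dsum V s h n k \<omega>\<bar> \<le> 2 * c * \<kappa> \<omega>)"
    using \<kappa> unfolding dsum_def by blast
qed

lemma grid_refine: "m \<le> n \<Longrightarrow> grid s h n (j * 2 ^ (n - m)) = grid s h m j"
proof -
  assume "m \<le> n"
  then have "(2::real) ^ n = 2 ^ (n - m) * 2 ^ m" by (simp flip: power_add)
  then show ?thesis by (simp add: grid_def)
qed

text \<open>\<open>D\<close> is the lower limit of the squared maxima over finer and finer grids; by Fatou it inherits
  the bound from Doob's inequality.\<close>
lemma limit_bound:
  assumes V: "\<And>t. 0 \<le> t \<Longrightarrow> V t \<in> borel_measurable (F t)"
  shows "\<exists>D\<in>borel_measurable M. (\<integral>\<^sup>+\<omega>. D \<omega> \<partial>M) \<le> ennreal (4 * C s) \<and>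
    (\<forall>\<omega> j m c L. 0 < c \<longrightarrow> (\<forall>u. s \<le> u \<longrightarrow> u \<le> grid s h m j \<longrightarrow> norm (V u \<omega>) \<le> c)
       \<longrightarrow> (\<lambda>n. dsum V s h n (j * 2 ^ (n - m)) \<omega>) \<longlonglongrightarrow> L \<longrightarrow> ennreal ((L / (2 * c))\<^sup>2) \<le> D \<omega>)"
proof -
  obtain \<kappa> :: "nat \<Rightarrow> 'a \<Rightarrow> real" where \<kappa>: "\<And>n. \<kappa> n \<in> borel_measurable M" "\<And>n \<omega>. 0 \<le> \<kappa> n \<omega>"
    "\<And>n. integrable M (\<lambda>\<omega>. (\<kappa> n \<omega>)\<^sup>2)" "\<And>n. (\<integral>\<omega>. (\<kappa> n \<omega>)\<^sup>2 \<partial>M) \<le> 4 * C s"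
    "\<And>n \<omega> k c. k \<le> n * 2 ^ n \<Longrightarrow> 0 \<le> c \<Longrightarrow> (\<And>j. j < k \<Longrightarrow> norm (V (grid s h n j) \<omega>) \<le> c)
      \<Longrightarrow> \<bar>dsum V s h n k \<omega>\<bar> \<le> 2 * c * \<kappa> n \<omega>"
    using grid_transform[OF V] by blast
  note [measurable] = \<kappa>(1)
  define D where "D \<omega> = liminf (\<lambda>n. ennreal ((\<kappa> n \<omega>)\<^sup>2))" for \<omega>
  show ?thesis
  proof (intro bexI[of _ D] conjI allI impI)
    show "D \<in> borel_measurable M" unfolding D_def by measurable
    have "(\<integral>\<^sup>+\<omega>. D \<omega> \<partial>M) \<le> liminf (\<lambda>n. \<integral>\<^sup>+\<omega>. ennreal ((\<kappa> n \<omega>)\<^sup>2) \<partial>M)"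
      unfolding D_def by (rule nn_integral_liminf) measurable
    also have "\<dots> \<le> liminf (\<lambda>n::nat. ennreal (4 * C s))"
    proof (intro Liminf_mono always_eventually allI)
      fix n
      have "(\<integral>\<^sup>+\<omega>. ennreal ((\<kappa> n \<omega>)\<^sup>2) \<partial>M) = ennreal (\<integral>\<omega>. (\<kappa> n \<omega>)\<^sup>2 \<partial>M)"
        by (rule nn_integral_eq_integral[OF \<kappa>(3)]) simp
      then show "(\<integral>\<^sup>+\<omega>. ennreal ((\<kappa> n \<omega>)\<^sup>2) \<partial>M) \<le> ennreal (4 * C s)"
        using \<kappa>(4)[of n] by (simp add: ennreal_leI)
    qed
    finally show "(\<integral>\<^sup>+\<omega>. D \<omega> \<partial>M) \<le> ennreal (4 * C s)" by (simp add: Liminf_const)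
    fix \<omega> j m c L
    assume c: "0 < (c::real)" and Vc: "\<forall>u. s \<le> u \<longrightarrow> u \<le> grid s h m j \<longrightarrow> norm (V u \<omega>) \<le> c"
      and lim: "(\<lambda>n. dsum V s h n (j * 2 ^ (n - m)) \<omega>) \<longlonglongrightarrow> L"
    have "ennreal ((L / (2 * c))\<^sup>2) = liminf (\<lambda>n. ennreal ((dsum V s h n (j * 2 ^ (n - m)) \<omega> / (2 * c))\<^sup>2))"
      by (rule lim_imp_Liminf[symmetric]) (use c in \<open>auto intro!: tendsto_intros lim\<close>)
    also have "\<dots> \<le> D \<omega>" unfolding D_def
    proof (rule Liminf_mono)
      \<comment> \<open>From \<open>m\<close> on, the chosen point belongs to the grid of level
        \<open>n\<close>; from \<open>j\<close> on, its index \<open>j * 2 ^ (n - m)\<close> lies in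
        the range \<open>n * 2 ^ n\<close> on which \<open>\<kappa> n\<close> controls the
        sums.\<close>
      show "\<forall>\<^sub>F n in sequentially. ennreal ((dsum V s h n (j * 2 ^ (n - m)) \<omega> / (2 * c))\<^sup>2) \<le> ennreal ((\<kappa> n \<omega>)\<^sup>2)"
        using eventually_ge_at_top[of m] eventually_ge_at_top[of j]
      proof eventually_elim
        case (elim n)
        have "\<bar>dsum V s h n (j * 2 ^ (n - m)) \<omega>\<bar> \<le> 2 * c * \<kappa> n \<omega>"
        proof (rule \<kappa>(5))
          show "j * 2 ^ (n - m) \<le> n * 2 ^ n"
            by (intro mult_le_mono elim power_increasing) auto
          fix i assume "i < j * 2 ^ (n - m)"
          then have "grid s h n i \<le> grid s h m j"
            using grid_mono[OF h, of i "j * 2 ^ (n - m)" s n] grid_refine[OF elim(1), of j] by simp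
          then show "norm (V (grid s h n i) \<omega>) \<le> c" using Vc grid_ge[OF h] by blast
        qed (use c in simp)
        then have "\<bar>dsum V s h n (j * 2 ^ (n - m)) \<omega> / (2 * c)\<bar> \<le> \<kappa> n \<omega>"
          using c by (simp add: field_simps)
        then have "(dsum V s h n (j * 2 ^ (n - m)) \<omega> / (2 * c))\<^sup>2 \<le> (\<kappa> n \<omega>)\<^sup>2"
          using \<kappa>(2)[of n \<omega>] by (simp add: abs_le_square_iff[symmetric])
        then show ?case by (rule ennreal_leI)
      qed
    qed
    finally show "ennreal ((L / (2 * c))\<^sup>2) \<le> D \<omega>" .
  qed
qed

text \<open>Every Riemann sum has mean zero by orthogonality. The sums are dominated by
  \<open>2 * sqrt \<bar>a \<omega>\<bar> * \<kappa> n \<omega>\<close>, a fixed square-integrable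
  factor times one bounded in L2, so the mean survives the limit.\<close>

lemma limit_expectation_zero:
  assumes V: "\<And>t. 0 \<le> t \<Longrightarrow> V t \<in> borel_measurable (F t)"
    and a: "integrable M a" and Va: "AE \<omega> in M. \<forall>u\<ge>s. (norm (V u \<omega>))\<^sup>2 \<le> a \<omega>"
    and L: "L \<in> borel_measurable M" "AE \<omega> in M. (\<lambda>n. dsum V s h n (2 ^ n) \<omega>) \<longlonglongrightarrow> L \<omega>"
  shows "integrable M L" "(\<integral>\<omega>. L \<omega> \<partial>M) = 0"
proof -
  obtain \<kappa> :: "nat \<Rightarrow> 'a \<Rightarrow> real" where \<kappa>: "\<And>n. \<kappa> n \<in> borel_measurable M" "\<And>n \<omega>. 0 \<le> \<kappa> n \<omega>"
    "\<And>n. integrable M (\<lambda>\<omega>. (\<kappa> n \<omega>)\<^sup>2)" "\<And>n. (\<integral>\<omega>. (\<kappa> n \<omega>)\<^sup>2 \<partial>M) \<le> 4 * C s"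
    "\<And>n \<omega> k c. k \<le> n * 2 ^ n \<Longrightarrow> 0 \<le> c \<Longrightarrow> (\<And>j. j < k \<Longrightarrow> norm (V (grid s h n j) \<omega>) \<le> c)
      \<Longrightarrow> \<bar>dsum V s h n k \<omega>\<bar> \<le> 2 * c * \<kappa> n \<omega>"
    using grid_transform[OF V] by blast
  have VM: "V u \<in> borel_measurable M" if "0 \<le> u" for u using measF[OF V[OF that]] .
  have Vsq: "integrable M (\<lambda>\<omega>. (norm (V (grid s h n j) \<omega>))\<^sup>2)" for n j
  proof (rule integrable_power2_bound[OF a VM[OF grid_nonneg]])
    show "AE \<omega> in M. (norm (V (grid s h n j) \<omega>))\<^sup>2 \<le> a \<omega>"
      using Va by eventually_elim (use grid_ge[OF h] in blast)
  qed
  have i: "integrable M (\<lambda>\<omega>. V (grid s h n j) \<omega> \<bullet> (I (grid s h n (Suc j)) \<omega> - I (grid s h n j) \<omega>))" for n j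
    by (intro integrable_square_inner Vsq integrable_square_diff VM I_meas I_sq grid_nonneg borel_measurable_diff)
  have di: "integrable M (dsum V s h n k)" for n k
    unfolding dsum_def using i by simp
  have d0: "(\<integral>\<omega>. dsum V s h n k \<omega> \<partial>M) = 0" for n k
    unfolding dsum_def using i
    by (simp add: I_orth[OF grid_nonneg grid_mono[OF h] V[OF grid_nonneg] Vsq])
  have aM: "integrable M (\<lambda>\<omega>. (2 * sqrt \<bar>a \<omega>\<bar>)\<^sup>2)"
    using a by (simp add: power_mult_distrib)
  \<comment> \<open>The shift to \<open>Suc n\<close> guarantees that \<open>2 ^ n\<close> is at
    most \<open>n * 2 ^ n\<close> at the level in question; this fails at level 0.\<close>
  have lim: "AE \<omega> in M. (\<lambda>n. dsum V s h (Suc n) (2 ^ Suc n) \<omega>) \<longlonglongrightarrow> L \<omega>"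
    using L(2) by eventually_elim (rule LIMSEQ_Suc)
  have dom: "AE \<omega> in M. \<bar>dsum V s h (Suc n) (2 ^ Suc n) \<omega>\<bar> \<le> 2 * sqrt \<bar>a \<omega>\<bar> * \<kappa> (Suc n) \<omega>" for n
    using Va
  proof eventually_elim
    case (elim \<omega>)
    show ?case
    proof (rule \<kappa>(5))
      fix j
      have "(norm (V (grid s h (Suc n) j) \<omega>))\<^sup>2 \<le> \<bar>a \<omega>\<bar>" using elim grid_ge[OF h, of s "Suc n" j] by fastforce
      then show "norm (V (grid s h (Suc n) j) \<omega>) \<le> sqrt \<bar>a \<omega>\<bar>" by (rule real_le_rsqrt)
    qed simp_all
  qed
  note res = integral_tendsto_dominated_square[OF di L(1) lim aM \<kappa>(3) \<kappa>(4) dom]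
  show "integrable M L" by (rule res(1))
  show "(\<integral>\<omega>. L \<omega> \<partial>M) = 0" using res(2) unfolding d0 by (simp add: LIMSEQ_const_iff)
qed

end

section \<open>From dyadic times to all times\<close>

text \<open>Rounding down keeps the approximating points below \<open>u\<close>, hence inside the
  window on which a bound is available.\<close>

lemma dyadic_approx:
  fixes s u :: real
  assumes "s \<le> u"
  obtains j :: "nat \<Rightarrow> nat" where "\<And>n. grid s 1 n (j n) \<le> u" "(\<lambda>n. grid s 1 n (j n)) \<longlonglongrightarrow> u"
proof -
  define j where "j n = nat \<lfloor>(u - s) * 2 ^ n\<rfloor>" for n
  have j: "real (j n) = of_int \<lfloor>(u - s) * 2 ^ n\<rfloor>" for n using assms by (simp add: j_def)
  have le: "grid s 1 n (j n) \<le> u" for n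
  proof -
    have "real (j n) \<le> (u - s) * 2 ^ n" by (simp add: j)
    then show ?thesis by (simp add: grid_def field_simps)
  qed
  have ge: "u - 1 / 2 ^ n \<le> grid s 1 n (j n)" for n
  proof -
    have "(u - s) * 2 ^ n - 1 \<le> real (j n)" unfolding j by linarith
    then have "((u - s) * 2 ^ n - 1) / 2 ^ n \<le> real (j n) / 2 ^ n" by (intro divide_right_mono) auto
    then show ?thesis by (simp add: grid_def diff_divide_distrib)
  qed
  have "(\<lambda>n. u - 1 / 2 ^ n) \<longlonglongrightarrow> u - 0"
    by (intro tendsto_diff tendsto_const LIMSEQ_divide_realpow_zero) simp
  then have "(\<lambda>n. u - 1 / 2 ^ n) \<longlonglongrightarrow> u" by simp
  then have "(\<lambda>n. grid s 1 n (j n)) \<longlonglongrightarrow> u"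
    by (rule real_tendsto_sandwich[OF always_eventually always_eventually _ tendsto_const, rotated 2])
       (use le ge in simp_all)
  with le show thesis by (rule that)
qed

lemma dyadic_le_extend:
  assumes g: "continuous_on {s..T} g" and d: "\<And>n j. grid s 1 n j \<le> T \<Longrightarrow> g (grid s 1 n j) \<le> (c::real)"
    and u: "s \<le> u" "u \<le> T"
  shows "g u \<le> c"
proof -
  obtain j where j: "\<And>n. grid s 1 n (j n) \<le> u" "(\<lambda>n. grid s 1 n (j n)) \<longlonglongrightarrow> u"
    using dyadic_approx[OF u(1)] by blast
  have "(\<lambda>n. g (grid s 1 n (j n))) \<longlonglongrightarrow> g u"
    by (rule continuous_on_tendsto_compose[OF g j(2)])
       (use u order_trans[OF j(1) u(2)] grid_ge[of 1] in \<open>auto intro!: always_eventually\<close>)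
  then show ?thesis
    by (rule tendsto_upperbound) (use d[OF order_trans[OF j(1) u(2)]] in \<open>auto intro!: always_eventually\<close>)
qed

text \<open>With a constant integrand \<open>b\<close> from the basis the Riemann sums telescope to
  a coordinate of the increment of \<open>I\<close>, so \<open>limit_bound\<close> doubles as a
  maximal inequality for \<open>I\<close> itself.\<close>

lemma sup_bound:
  assumes s: "0 \<le> s"
  shows "\<exists>D\<in>borel_measurable M. (\<integral>\<^sup>+\<omega>. D \<omega> \<partial>M) \<le> ennreal (16 * DIM('b) * C s) \<and>
    (\<forall>\<omega>\<in>space M. \<forall>u\<ge>s. ennreal ((norm (I u \<omega> - I s \<omega>))\<^sup>2) \<le> D \<omega>)"
proof -
  have "\<forall>b\<in>Basis. \<exists>D\<in>borel_measurable M. (\<integral>\<^sup>+\<omega>. D \<omega> \<partial>M) \<le> ennreal (4 * C s) \<and>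
    (\<forall>\<omega> n j. ennreal (((I (grid s 1 n j) \<omega> - I s \<omega>) \<bullet> b / 2)\<^sup>2) \<le> D \<omega>)"
  proof
    fix b :: 'b assume b: "b \<in> Basis"
    obtain D where D: "D \<in> borel_measurable M" "(\<integral>\<^sup>+\<omega>. D \<omega> \<partial>M) \<le> ennreal (4 * C s)"
      "\<And>\<omega> j m c L. 0 < c \<Longrightarrow> (\<forall>u. s \<le> u \<longrightarrow> u \<le> grid s 1 m j \<longrightarrow> norm b \<le> c)
       \<Longrightarrow> (\<lambda>n. dsum (\<lambda>_ _. b) s 1 n (j * 2 ^ (n - m)) \<omega>) \<longlonglongrightarrow> L \<Longrightarrow> ennreal ((L / (2 * c))\<^sup>2) \<le> D \<omega>"
      using limit_bound[OF s zero_le_one, of "\<lambda>_ _. b"] by auto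
    show "\<exists>D\<in>borel_measurable M. (\<integral>\<^sup>+\<omega>. D \<omega> \<partial>M) \<le> ennreal (4 * C s) \<and>
      (\<forall>\<omega> n j. ennreal (((I (grid s 1 n j) \<omega> - I s \<omega>) \<bullet> b / 2)\<^sup>2) \<le> D \<omega>)"
    proof (intro bexI[of _ D] conjI allI D)
      fix \<omega> m j
      have d: "dsum (\<lambda>_ _. b) s 1 n k \<omega> = b \<bullet> (I (grid s 1 n k) \<omega> - I s \<omega>)" for n k
        unfolding dsum_def inner_sum_right[symmetric]
          sum_lessThan_telescope[of "\<lambda>j. I (grid s 1 n j) \<omega>"] by (simp add: grid_def)
      have "(\<lambda>n. dsum (\<lambda>_ _. b) s 1 n (j * 2 ^ (n - m)) \<omega>) \<longlonglongrightarrow> b \<bullet> (I (grid s 1 m j) \<omega> - I s \<omega>)"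
        unfolding d
        by (rule tendsto_eventually, rule eventually_mono[OF eventually_ge_at_top[of m]])
           (simp add: grid_refine[OF s zero_le_one])
      from D(3)[OF zero_less_one _ this] b
      show "ennreal (((I (grid s 1 m j) \<omega> - I s \<omega>) \<bullet> b / 2)\<^sup>2) \<le> D \<omega>"
        by (simp add: inner_commute)
    qed
  qed
  then obtain D where D: "\<And>b. b \<in> Basis \<Longrightarrow> D b \<in> borel_measurable M"
    "\<And>b. b \<in> Basis \<Longrightarrow> (\<integral>\<^sup>+\<omega>. D b \<omega> \<partial>M) \<le> ennreal (4 * C s)"
    "\<And>b \<omega> n j. b \<in> Basis \<Longrightarrow> ennreal (((I (grid s 1 n j) \<omega> - I s \<omega>) \<bullet> b / 2)\<^sup>2) \<le> D b \<omega>"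
    by metis
  \<comment> \<open>The factor 4 undoes the division by \<open>2 * c\<close> with
    \<open>c = 1\<close>. Together with the factor 4 of Doob's inequality and one term per
    coordinate it gives \<open>16 * DIM('b)\<close>.\<close>
  define E where "E \<omega> = (\<Sum>b\<in>Basis. 4 * D b \<omega>)" for \<omega>
  have dy: "ennreal ((norm (I (grid s 1 n j) \<omega> - I s \<omega>))\<^sup>2) \<le> E \<omega>" for n j \<omega>
  proof -
    let ?x = "I (grid s 1 n j) \<omega> - I s \<omega>"
    have "(norm ?x)\<^sup>2 = (\<Sum>b\<in>Basis. (?x \<bullet> b)\<^sup>2)"
      unfolding power2_norm_eq_inner by (subst euclidean_inner) (simp add: power2_eq_square)
    then have "ennreal ((norm ?x)\<^sup>2) = (\<Sum>b\<in>Basis. ennreal ((?x \<bullet> b)\<^sup>2))" by simp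
    also have "\<dots> \<le> E \<omega>" unfolding E_def
    proof (rule sum_mono)
      fix b :: 'b assume b: "b \<in> Basis"
      have "ennreal ((?x \<bullet> b)\<^sup>2) = 4 * ennreal ((?x \<bullet> b / 2)\<^sup>2)"
        by (simp add: power_divide ennreal_mult[symmetric] flip: ennreal_numeral)
      also have "\<dots> \<le> 4 * D b \<omega>" by (intro mult_left_mono D(3)[OF b]) simp
      finally show "ennreal ((?x \<bullet> b)\<^sup>2) \<le> 4 * D b \<omega>" .
    qed
    finally show ?thesis .
  qed
  show ?thesis
  proof (intro bexI[of _ E] conjI ballI allI impI)
    show "E \<in> borel_measurable M" unfolding E_def using D(1) by simp
    have "(\<integral>\<^sup>+\<omega>. E \<omega> \<partial>M) = (\<Sum>b\<in>Basis. 4 * (\<integral>\<^sup>+\<omega>. D b \<omega> \<partial>M))"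
      unfolding E_def using D(1) by (subst nn_integral_sum) (auto simp: nn_integral_cmult)
    also have "\<dots> \<le> (\<Sum>b\<in>(Basis::'b set). ennreal (16 * C s))"
    proof (rule sum_mono)
      fix b :: 'b assume b: "b \<in> Basis"
      have "4 * (\<integral>\<^sup>+\<omega>. D b \<omega> \<partial>M) \<le> 4 * ennreal (4 * C s)" by (intro mult_left_mono D(2)[OF b]) simp
      also have "\<dots> = ennreal (16 * C s)"
        using C_nonneg[OF s] by (simp add: ennreal_mult[symmetric] flip: ennreal_numeral)
      finally show "4 * (\<integral>\<^sup>+\<omega>. D b \<omega> \<partial>M) \<le> ennreal (16 * C s)" .
    qed
    also have "\<dots> = ennreal (16 * DIM('b) * C s)"
      using C_nonneg[OF s] by (simp add: ennreal_of_nat_eq_real_of_nat ennreal_mult[symmetric] ac_simps)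
    finally show "(\<integral>\<^sup>+\<omega>. E \<omega> \<partial>M) \<le> ennreal (16 * DIM('b) * C s)" .
    fix \<omega> u assume \<omega>: "\<omega> \<in> space M" and u: "s \<le> u"
    show "ennreal ((norm (I u \<omega> - I s \<omega>))\<^sup>2) \<le> E \<omega>"
    proof (cases "E \<omega> = \<infinity>")
      case False
      then obtain e where e: "E \<omega> = ennreal e" "0 \<le> e" by (cases "E \<omega>") auto
      have "(norm (I u \<omega> - I s \<omega>))\<^sup>2 \<le> e"
      proof (rule dyadic_le_extend[OF _ _ u order_refl])
        show "continuous_on {s..u} (\<lambda>u. (norm (I u \<omega> - I s \<omega>))\<^sup>2)"
          by (intro continuous_intros continuous_on_subset[OF I_cont[OF \<omega>]]) (use s in auto)
        show "(norm (I (grid s 1 n j) \<omega> - I s \<omega>))\<^sup>2 \<le> e" for n j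
          using dy[of n j \<omega>] e by (simp add: ennreal_le_iff)
      qed
      then show ?thesis using e by (simp add: ennreal_leI)
    qed simp
  qed
qed

end

section \<open>Pathwise limits of Riemann sums against the martingale\<close>

text \<open>The quadratic variation of a continuous function of bounded variation vanishes: the sum
  of squares is at most the largest increment times the total variation.\<close>

lemma sum_square_increments_tendsto_0:
  fixes g :: "real \<Rightarrow> 'v::real_normed_vector"
  assumes g: "continuous_on {a..b} g" and bv: "bounded_variation_on g a b" and ab: "a < b"
    and q: "filterlim q at_top F"
  shows "((\<lambda>x. \<Sum>k<q x. (norm (g (a + (b - a) * real (Suc k) / real (q x))
            - g (a + (b - a) * real k / real (q x))))\<^sup>2) \<longlongrightarrow> 0) F"
proof (rule tendstoI)
  fix e :: real assume e: "e > 0"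
  obtain K0 where K0: "\<And>n p. is_partition a b n p \<Longrightarrow> (\<Sum>k<n. norm (g (p (Suc k)) - g (p k))) \<le> K0"
    using bv unfolding bounded_variation_on_def by blast
  define K where "K = \<bar>K0\<bar> + 1"
  have K: "K > 0" "\<And>n p. is_partition a b n p \<Longrightarrow> (\<Sum>k<n. norm (g (p (Suc k)) - g (p k))) \<le> K"
    using K0 unfolding K_def by (simp, fastforce)
  define \<epsilon> where "\<epsilon> = e / (2 * K)"
  have \<epsilon>: "\<epsilon> > 0" "\<epsilon> * K < e" using e K(1) by (auto simp: \<epsilon>_def field_simps)
  have "uniformly_continuous_on {a..b} g" by (rule compact_uniformly_continuous[OF g]) simp
  then obtain d where d: "d > 0" "\<And>x y. x \<in> {a..b} \<Longrightarrow> y \<in> {a..b} \<Longrightarrow> dist y x < d \<Longrightarrow> dist (g y) (g x) < \<epsilon>"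
    unfolding uniformly_continuous_on_def using \<epsilon>(1) by metis
  have "\<forall>\<^sub>F n in sequentially. (b - a) / real n < d \<and> n > 0"
    using uniform_mesh_small[OF d(1)] eventually_gt_at_top[of 0] by eventually_elim auto
  then have "\<forall>\<^sub>F x in F. (b - a) / real (q x) < d \<and> q x > 0"
    using q unfolding filterlim_iff by blast
  then show "\<forall>\<^sub>F x in F. dist (\<Sum>k<q x. (norm (g (a + (b - a) * real (Suc k) / real (q x))
            - g (a + (b - a) * real k / real (q x))))\<^sup>2) 0 < e"
  proof eventually_elim
    case (elim x)
    let ?p = "\<lambda>k. a + (b - a) * real k / real (q x)"
    have part: "is_partition a b (q x) ?p" by (rule is_partition_uniform[OF ab]) (use elim in simp)
    have step: "?p (Suc k) - ?p k = (b - a) / real (q x)" for k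
    proof -
      have "?p (Suc k) - ?p k = ((b - a) * real (Suc k) - (b - a) * real k) / real (q x)"
        by (simp add: diff_divide_distrib)
      also have "\<dots> = (b - a) / real (q x)" by (simp add: algebra_simps)
      finally show ?thesis .
    qed
    have inr: "?p k \<in> {a..b}" if "k \<le> q x" for k
      using is_partition_mono[OF part, of 0 k] is_partition_mono[OF part, of k "q x"] that elim by auto
    have "(\<Sum>k<q x. (norm (g (?p (Suc k)) - g (?p k)))\<^sup>2) \<le> (\<Sum>k<q x. \<epsilon> * norm (g (?p (Suc k)) - g (?p k)))"
    proof (rule sum_mono)
      fix k assume "k \<in> {..<q x}"
      then have "dist (g (?p (Suc k))) (g (?p k)) < \<epsilon>"
        by (intro d(2) inr) (use step[of k] elim ab in \<open>auto simp: dist_real_def\<close>)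
      then show "(norm (g (?p (Suc k)) - g (?p k)))\<^sup>2 \<le> \<epsilon> * norm (g (?p (Suc k)) - g (?p k))"
        unfolding power2_eq_square by (intro mult_right_mono) (auto simp: dist_norm)
    qed
    also have "\<dots> \<le> \<epsilon> * K"
      unfolding sum_distrib_left[symmetric] using \<epsilon>(1) K(2)[OF part] by (intro mult_left_mono) auto
    also have "\<dots> < e" by (rule \<epsilon>(2))
    finally show ?case by (simp add: sum_nonneg)
  qed
qed

section \<open>Orthogonal projections and the pathwise integration by parts\<close>

locale orthogonal_projection =
  fixes P :: "'v::euclidean_space \<Rightarrow> 'v"
  assumes P_linear: "linear P" and P_adj: "\<And>x y. P x \<bullet> y = x \<bullet> P y"
    and P_idem: "\<And>x. P (P x) = P x"
begin

lemma P_norm_le: "norm (P x) \<le> norm x"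
proof -
  have "(norm (P x))\<^sup>2 = x \<bullet> P x" by (simp add: power2_norm_eq_inner P_adj P_idem)
  also have "\<dots> \<le> norm x * norm (P x)" by (rule norm_cauchy_schwarz)
  finally show ?thesis
    by (cases "P x = 0") (simp_all add: power2_eq_square)
qed

lemma P_diff: "P (x - y) = P x - P y" by (rule linear_diff[OF P_linear])

lemma P_bounded_linear: "bounded_linear P"
  using P_linear by (simp add: linear_conv_bounded_linear)

lemma P_measurable: "P \<in> borel_measurable borel"
  by (intro borel_measurable_continuous_onI linear_continuous_on P_bounded_linear)

text \<open>\<open>V\<close> has bounded variation, so summation by parts moves the increments from \<open>I\<close> to \<open>Y\<close>: this
  is the only place where an Ito formula would be needed.\<close>
lemma riemann_sum_tendsto:
  fixes Z Y I :: "real \<Rightarrow> 'v" and V :: "real \<Rightarrow> 'v"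
  assumes ab: "a < b" and Z: "continuous_on {a..b} Z" and Y: "continuous_on {a..b} Y"
    and bv: "bounded_variation_on Y a b"
    and V: "\<And>t. t \<in> {a..b} \<Longrightarrow> V t = Z t - P (I t)" and PZ: "\<And>t. t \<in> {a..b} \<Longrightarrow> P (Z t) = Z t"
    and dV: "\<And>s t. s \<in> {a..b} \<Longrightarrow> t \<in> {a..b} \<Longrightarrow> V t - V s = - P (Y t - Y s)"
    and q: "filterlim q at_top F"
  shows "((\<lambda>x. \<Sum>k<q x. V (a + (b - a) * real k / real (q x)) \<bullet>
        (I (a + (b - a) * real (Suc k) / real (q x)) - I (a + (b - a) * real k / real (q x))))
      \<longlongrightarrow> ((norm (Z b))\<^sup>2 - (norm (Z a))\<^sup>2 - (norm (P (I b)))\<^sup>2 + (norm (P (I a)))\<^sup>2) / 2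
          + rs_integral Z Y a b) F" (is "((\<lambda>x. ?S x) \<longlongrightarrow> ?c + ?R) F")
proof -
  define f where "f t = ((norm (Z t))\<^sup>2 - (norm (P (I t)))\<^sup>2) / 2" for t
  \<comment> \<open>An exact identity on each cell: a telescoping term, a Stieltjes term with the
    tag at the right endpoint, and a quadratic remainder in the increment of \<open>Y\<close>. In
    \<open>alg\<close> the letters stand for \<open>V s\<close>, \<open>P (I s)\<close>,
    \<open>P (I t)\<close> and the projected increment of \<open>Y\<close>.\<close>
  have step: "V s \<bullet> (I t - I s) = (f t - f s) + Z t \<bullet> (Y t - Y s) + (P (Y t - Y s) \<bullet> (Y t - Y s)) / 2"
    if s: "s \<in> {a..b}" and t: "t \<in> {a..b}" for s t
  proof -
    let ?J = "\<lambda>t. P (I t)" and ?d = "Y t - Y s"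
    have PV: "P (V u) = V u" if "u \<in> {a..b}" for u using V[OF that] PZ[OF that] by (simp add: P_diff P_idem)
    have "V s \<bullet> (I t - I s) = P (V s) \<bullet> (I t - I s)" using PV[OF s] by simp
    also have "\<dots> = V s \<bullet> (?J t - ?J s)" by (simp add: P_adj P_diff)
    finally have 1: "V s \<bullet> (I t - I s) = V s \<bullet> (?J t - ?J s)" .
    have Zs: "Z s = V s + ?J s" and Zt: "Z t = V t + ?J t" using V s t by simp_all
    have Vt: "V t = V s - P ?d" using dV[OF s t] by (simp add: algebra_simps)
    have Zd: "Z t \<bullet> ?d = Z t \<bullet> P ?d" using PZ[OF t] P_adj[of "Z t" ?d] by simp
    have Pd: "P ?d \<bullet> ?d = P ?d \<bullet> P ?d" using P_adj[of "P ?d" ?d] by (simp add: P_idem)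
    have alg: "v \<bullet> (j' - j) = ((norm (v - p + j'))\<^sup>2 - (norm j')\<^sup>2) / 2 - ((norm (v + j))\<^sup>2 - (norm j)\<^sup>2) / 2
        + (v - p + j') \<bullet> p + p \<bullet> p / 2" for v j j' p :: 'v
      unfolding power2_norm_eq_inner
      by (simp add: inner_add_left inner_add_right inner_diff_left inner_diff_right inner_commute field_simps)
    have fs: "f s = ((norm (V s + ?J s))\<^sup>2 - (norm (?J s))\<^sup>2) / 2" by (simp only: f_def Zs)
    have Zt': "Z t = V s - P ?d + ?J t" by (simp only: Zt Vt)
    have ft: "f t = ((norm (V s - P ?d + ?J t))\<^sup>2 - (norm (?J t))\<^sup>2) / 2" by (simp only: f_def Zt')
    show ?thesis unfolding 1 Zd Pd fs ft unfolding Zt' by (rule alg)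
  qed
  let ?p = "\<lambda>x k. a + (b - a) * real k / real (q x)"
  let ?d = "\<lambda>x k. Y (?p x (Suc k)) - Y (?p x k)"
  have I: "rs_has_integral Z Y a b ?R"
    by (rule rs_has_integral_rs_integral[OF Z Y bv]) (use ab in simp)
  have l1: "((\<lambda>x. \<Sum>k<q x. Z (?p x (Suc k)) \<bullet> ?d x k) \<longlongrightarrow> ?R) F"
    by (rule rs_sum_tendsto[OF I ab q]) (use ab in \<open>auto simp: divide_simps\<close>)
  \<comment> \<open>A remainder term is at most the square of the increment of \<open>Y\<close>,
    because \<open>P\<close> does not increase norms.\<close>
  have l2: "((\<lambda>x. (\<Sum>k<q x. P (?d x k) \<bullet> ?d x k) / 2) \<longlongrightarrow> 0) F"
  proof (rule Lim_null_comparison[OF always_eventually])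
    show "((\<lambda>x. \<Sum>k<q x. (norm (?d x k))\<^sup>2) \<longlongrightarrow> 0) F"
      by (rule sum_square_increments_tendsto_0[OF Y bv ab q])
    show "\<forall>x. norm ((\<Sum>k<q x. P (?d x k) \<bullet> ?d x k) / 2) \<le> (\<Sum>k<q x. (norm (?d x k))\<^sup>2)"
    proof
      fix x
      have b: "\<bar>P y \<bullet> y\<bar> \<le> (norm y)\<^sup>2" for y
      proof -
        have "\<bar>P y \<bullet> y\<bar> \<le> norm (P y) * norm y" by (rule Cauchy_Schwarz_ineq2)
        also have "\<dots> \<le> norm y * norm y" by (intro mult_right_mono P_norm_le) simp
        finally show ?thesis by (simp add: power2_eq_square)
      qed
      have "\<bar>\<Sum>k<q x. P (?d x k) \<bullet> ?d x k\<bar> \<le> (\<Sum>k<q x. (norm (?d x k))\<^sup>2)"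
        by (rule order_trans[OF sum_abs]) (rule sum_mono, rule b)
      then show "norm ((\<Sum>k<q x. P (?d x k) \<bullet> ?d x k) / 2) \<le> (\<Sum>k<q x. (norm (?d x k))\<^sup>2)"
        by simp
    qed
  qed
  have "\<forall>\<^sub>F x in F. q x > 0"
    using q eventually_gt_at_top[of 0] unfolding filterlim_iff by blast
  then have ev: "\<forall>\<^sub>F x in F. ?c + (\<Sum>k<q x. Z (?p x (Suc k)) \<bullet> ?d x k) + (\<Sum>k<q x. P (?d x k) \<bullet> ?d x k) / 2 = ?S x"
  proof eventually_elim
    case (elim x)
    have part: "is_partition a b (q x) (?p x)" by (rule is_partition_uniform[OF ab]) (use elim in simp)
    have inr: "?p x k \<in> {a..b}" if "k \<le> q x" for k
      using is_partition_mono[OF part, of 0 k] is_partition_mono[OF part, of k "q x"] that elim by auto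
    have "?S x = (\<Sum>k<q x. (f (?p x (Suc k)) - f (?p x k)) + Z (?p x (Suc k)) \<bullet> ?d x k + (P (?d x k) \<bullet> ?d x k) / 2)"
      by (intro sum.cong[OF refl] step inr) auto
    also have "\<dots> = (f (?p x (q x)) - f (?p x 0)) + (\<Sum>k<q x. Z (?p x (Suc k)) \<bullet> ?d x k)
        + (\<Sum>k<q x. P (?d x k) \<bullet> ?d x k) / 2"
      unfolding sum.distrib sum_divide_distrib
      using sum_lessThan_telescope[of "\<lambda>k. f (?p x k)" "q x"] by simp
    also have "f (?p x (q x)) - f (?p x 0) = ?c" using elim by (simp add: f_def field_simps)
    finally show ?case by simp
  qed
  have "((\<lambda>x. ?c + (\<Sum>k<q x. Z (?p x (Suc k)) \<bullet> ?d x k) + (\<Sum>k<q x. P (?d x k) \<bullet> ?d x k) / 2) \<longlongrightarrow> ?c + ?R + 0) F"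
    by (intro tendsto_add tendsto_const l1 l2)
  then show ?thesis using Lim_transform_eventually[OF _ ev] by simp
qed

end

lemma orthogonal_projection_exists:
  fixes S :: "'v::euclidean_space set"
  assumes S: "subspace S"
  obtains P where "orthogonal_projection P" "\<And>x. x \<in> S \<Longrightarrow> P x = x"
    "\<And>x. \<forall>y\<in>S. x \<bullet> y = 0 \<Longrightarrow> P x = 0"
proof -
  obtain B where B: "B \<subseteq> S" "pairwise orthogonal B" "\<And>x. x \<in> B \<Longrightarrow> norm x = 1" "independent B" "span B = S"
    using orthonormal_basis_subspace[OF S] by metis
  have fin: "finite B" using B(4) by (rule independent_imp_finite)
  have bb: "b \<bullet> c = (if b = c then 1 else 0)" if "b \<in> B" "c \<in> B" for b c
    using that B(2,3) by (auto simp: pairwise_def orthogonal_def dot_square_norm)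
  define P where "P x = (\<Sum>b\<in>B. (x \<bullet> b) *\<^sub>R b)" for x
  have lin: "linear P"
    unfolding P_def by (rule linearI) (simp_all add: inner_add_left scaleR_add_left sum.distrib scaleR_sum_right)
  have Pb: "P b = b" if "b \<in> B" for b
  proof -
    have "P b = (\<Sum>c\<in>B. if c = b then b else 0)"
      unfolding P_def by (rule sum.cong) (use that bb in auto)
    then show ?thesis using that fin by simp
  qed
  have PS: "P x = x" if "x \<in> S" for x
  proof -
    have "x \<in> span B" using that B(5) by simp
    then show ?thesis
      by (rule linear_eq_on[OF lin linear_ident]) (rule Pb)
  qed
  have "P x \<in> S" for x
    unfolding P_def using B(1) S by (intro subspace_sum subspace_scale) auto
  then have idem: "P (P x) = P x" for x by (rule PS)
  have "P x \<bullet> y = x \<bullet> P y" for x y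
    by (simp add: P_def inner_sum_left inner_sum_right inner_commute mult.commute)
  then have "orthogonal_projection P"
    using lin idem by (simp add: orthogonal_projection_def)
  moreover have "P x = 0" if "\<forall>y\<in>S. x \<bullet> y = 0" for x
    unfolding P_def using that B(1) by (intro sum.neutral) auto
  ultimately show thesis using PS that by blast
qed

text \<open>Up to a fixed grid point of level \<open>m\<close>, the sums of level \<open>n\<close>
  are uniform Riemann sums with \<open>j * 2 ^ (n - m)\<close> pieces. For \<open>j = 0\<close> the
  interval degenerates and both sides are 0.\<close>

lemma (in sq_martingale) dsum_tendsto:
  fixes Z Y V :: "real \<Rightarrow> 'b"
  assumes P: "orthogonal_projection P" and h: "0 < h"
    and Z: "continuous_on {s..} Z" and Y: "continuous_on {s..} Y"
    and bv: "\<And>T. s \<le> T \<Longrightarrow> bounded_variation_on Y s T"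
    and V: "\<And>t. s \<le> t \<Longrightarrow> W t \<omega> = Z t - P (I t \<omega>)" and PZ: "\<And>t. s \<le> t \<Longrightarrow> P (Z t) = Z t"
    and dV: "\<And>u t. s \<le> u \<Longrightarrow> s \<le> t \<Longrightarrow> W t \<omega> - W u \<omega> = - P (Y t - Y u)"
  defines "b \<equiv> \<lambda>m j. grid s h m j"
  shows "(\<lambda>n. dsum W s h n (j * 2 ^ (n - m)) \<omega>)
      \<longlonglongrightarrow> ((norm (Z (b m j)))\<^sup>2 - (norm (Z s))\<^sup>2 - (norm (P (I (b m j) \<omega>)))\<^sup>2 + (norm (P (I s \<omega>)))\<^sup>2) / 2
          + rs_integral Z Y s (b m j)"
proof (cases "j = 0")
  case True
  then have "b m j = s" by (simp add: b_def grid_def)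
  then show ?thesis using True by (simp add: dsum_def rs_integral_eq[OF rs_has_integral_trivial])
next
  case False
  interpret P: orthogonal_projection P by fact
  let ?b = "b m j"
  have sb: "s < ?b" using False h by (simp add: b_def grid_def)
  define q where "q n = j * 2 ^ (n - m)" for n
  have q: "filterlim q at_top sequentially"
  proof (rule filterlim_at_top_mono[OF filterlim_minus_const_nat_at_top[of m]])
    show "\<forall>\<^sub>F n in sequentially. n - m \<le> q n"
    proof (rule always_eventually, rule allI)
      fix n
      have "n - m \<le> 2 ^ (n - m)" using less_exp[of "n - m"] by simp
      also have "\<dots> \<le> q n" using False by (simp add: q_def)
      finally show "n - m \<le> q n" .
    qed
  qed
  have lim: "(\<lambda>n. \<Sum>k<q n. W (s + (?b - s) * real k / real (q n)) \<omega> \<bullet>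
        (I (s + (?b - s) * real (Suc k) / real (q n)) \<omega> - I (s + (?b - s) * real k / real (q n)) \<omega>))
     \<longlonglongrightarrow> ((norm (Z ?b))\<^sup>2 - (norm (Z s))\<^sup>2 - (norm (P (I ?b \<omega>)))\<^sup>2 + (norm (P (I s \<omega>)))\<^sup>2) / 2
          + rs_integral Z Y s ?b"
    by (rule P.riemann_sum_tendsto[OF sb _ _ _ _ _ _ q])
       (use sb V PZ dV bv[of ?b] in \<open>auto intro: continuous_on_subset[OF Z] continuous_on_subset[OF Y]\<close>)
  have ev: "\<forall>\<^sub>F n in sequentially. (\<Sum>k<q n. W (s + (?b - s) * real k / real (q n)) \<omega> \<bullet>
        (I (s + (?b - s) * real (Suc k) / real (q n)) \<omega> - I (s + (?b - s) * real k / real (q n)) \<omega>))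
      = dsum W s h n (j * 2 ^ (n - m)) \<omega>"
    using eventually_ge_at_top[of m]
  proof eventually_elim
    case (elim n)
    have "(2::real) ^ n = 2 ^ (n - m) * 2 ^ m" using elim by (simp flip: power_add)
    then have eq: "s + (?b - s) * real k / real (q n) = grid s h n k" for k
      using False by (simp add: b_def grid_def q_def)
    show ?case unfolding eq dsum_def unfolding q_def ..
  qed
  show ?thesis by (rule Lim_transform_eventually[OF lim ev])
qed

section \<open>The stochastic integral as a square integrable martingale\<close>

lemma continuous_on_Ici:
  fixes f :: "real \<Rightarrow> 'v::topological_space"
  assumes "\<And>T. 0 \<le> T \<Longrightarrow> continuous_on {0..T} f"
  shows "continuous_on {0..} f"
  unfolding continuous_on_eq_continuous_within
proof
  fix t :: real assume t: "t \<in> {0..}"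
  have "continuous (at t within {0..t + 1}) f"
    using assms[of "t + 1"] t unfolding continuous_on_eq_continuous_within by simp
  moreover have "at t within {0..t + 1} = at t within {0..}"
    by (rule at_within_nhd[of t "{..<t + 1}"]) auto
  ultimately show "continuous (at t within {0..}) f" by simp
qed

context filtered_space begin

text \<open>Progressive measurability speaks about the windows \<open>{0..n}\<close> one at a time.
  Clamping the time maps the whole line into such a window, an indicator removes the clamped values,
  and the windows then exhaust the half-line.\<close>

lemma progressive_joint_measurable:
  fixes H :: "real \<Rightarrow> 'a \<Rightarrow> 'v::euclidean_space"
  assumes H: "progressive F H"
  shows "(\<lambda>(\<omega>, t). indicator {0..} t *\<^sub>R H t \<omega>) \<in> borel_measurable (M \<Otimes>\<^sub>M lborel)"
proof (rule borel_measurable_LIMSEQ_metric)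
  fix n :: nat
  define c where "c t = max 0 (min (real n) t)" for t :: real
  have cm: "c \<in> measurable borel (restrict_space borel {0..real n})"
  proof (rule measurable_restrict_space2)
    show "c \<in> borel_measurable borel" unfolding c_def[abs_def] by measurable
  qed (auto simp: c_def)
  have "(\<lambda>(s, \<omega>). H s \<omega>) \<in> borel_measurable (restrict_space borel {0..real n} \<Otimes>\<^sub>M F (real n))"
    using H by (simp add: progressive_def)
  moreover have "(\<lambda>p. (c (snd p), fst p)) \<in> measurable (M \<Otimes>\<^sub>M lborel) (restrict_space borel {0..real n} \<Otimes>\<^sub>M F (real n))"
  proof (rule measurable_Pair)
    show "(\<lambda>p. c (snd p)) \<in> measurable (M \<Otimes>\<^sub>M lborel) (restrict_space borel {0..real n})"
      by (rule measurable_compose[OF _ cm]) simp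
    have "(\<lambda>x. x) \<in> measurable M (F (real n))" by (rule measF[OF measurable_ident_sets[OF refl]])
    from measurable_compose[OF measurable_fst this]
    show "(\<lambda>p. fst p) \<in> measurable (M \<Otimes>\<^sub>M lborel) (F (real n))" .
  qed
  ultimately have "(\<lambda>p. (\<lambda>(s, \<omega>). H s \<omega>) (c (snd p), fst p)) \<in> borel_measurable (M \<Otimes>\<^sub>M lborel)"
    by (rule measurable_compose[rotated])
  then have "(\<lambda>p. indicator {0..real n} (snd p) *\<^sub>R H (c (snd p)) (fst p)) \<in> borel_measurable (M \<Otimes>\<^sub>M lborel)"
    by (intro borel_measurable_scaleR) simp_all
  also have "(\<lambda>p. indicator {0..real n} (snd p) *\<^sub>R H (c (snd p)) (fst p))
      = (\<lambda>p. indicator {0..real n} (snd p) *\<^sub>R H (snd p) (fst p))"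
    by (auto simp: fun_eq_iff indicator_def c_def min_def max_def)
  finally show "(\<lambda>p. indicator {0..real n} (snd p) *\<^sub>R H (snd p) (fst p)) \<in> borel_measurable (M \<Otimes>\<^sub>M lborel)" .
next
  fix p :: "'a \<times> real"
  obtain N :: nat where N: "snd p \<le> real N" using real_arch_simple by blast
  have "\<forall>\<^sub>F n in sequentially. indicator {0..real n} (snd p) *\<^sub>R H (snd p) (fst p) = (case p of (\<omega>, t) \<Rightarrow> indicator {0..} t *\<^sub>R H t \<omega>)"
    using eventually_ge_at_top[of N]
  proof eventually_elim
    case (elim n)
    then have "snd p \<le> real n" using N by (meson of_nat_mono order_trans)
    then show ?case by (auto simp: split_beta indicator_def)
  qed
  then show "(\<lambda>n. indicator {0..real n} (snd p) *\<^sub>R H (snd p) (fst p)) \<longlonglongrightarrow> (case p of (\<omega>, t) \<Rightarrow> indicator {0..} t *\<^sub>R H t \<omega>)"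
    by (rule tendsto_eventually)
qed

text \<open>\<open>square_of_local_martingale\<close> is applied to each coordinate of
  \<open>I\<close>, with \<open>q\<close> the integral of the squared row of \<open>H\<close>;
  summing the rows restores the Frobenius norm. The constant \<open>C s\<close> is the mean energy
  of \<open>H\<close> on \<open>{s..}\<close>, a tail that tends to 0 by dominated
  convergence.\<close>

lemma ito_square_integrable:
  fixes H :: "real \<Rightarrow> 'a \<Rightarrow> real^'l^'d" and I :: "real \<Rightarrow> 'a \<Rightarrow> real^'d"
  assumes H: "progressive F H" and ad: "adapted F I" and cont: "continuous_paths M I"
    and I0: "\<And>\<omega>. \<omega> \<in> space M \<Longrightarrow> I 0 \<omega> = 0" and lm: "vec_local_martingale M F I"
    and lm2: "\<And>i. local_martingale M F
        (\<lambda>t \<omega>. (I t \<omega> $ i)\<^sup>2 - (\<integral>s\<in>{0..t}. (\<Sum>j\<in>UNIV. (H s \<omega> $ i $ j)\<^sup>2) \<partial>lborel))"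
    and fin: "(\<integral>\<^sup>+\<omega>. (\<integral>\<^sup>+t\<in>{0..}. ennreal ((norm (H t \<omega>))\<^sup>2) \<partial>lborel) \<partial>M) < \<infinity>"
  shows "\<exists>C. sq_martingale M F I C \<and> (\<lambda>n. C (real n)) \<longlonglongrightarrow> 0
    \<and> (\<forall>s t. 0 \<le> s \<longrightarrow> s \<le> t \<longrightarrow> ennreal (\<integral>\<omega>. (norm (I t \<omega> - I s \<omega>))\<^sup>2 \<partial>M)
          \<le> (\<integral>\<^sup>+\<omega>. (\<integral>\<^sup>+\<tau>\<in>{s..t}. ennreal ((norm (H \<tau> \<omega>))\<^sup>2) \<partial>lborel) \<partial>M))"
proof -
  interpret prod: pair_sigma_finite M lborel ..
  define G where "G \<omega> t = indicator {0..} t *\<^sub>R H t \<omega>" for \<omega> t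
  have G: "(\<lambda>(\<omega>, t). G \<omega> t) \<in> borel_measurable (M \<Otimes>\<^sub>M lborel)"
    unfolding G_def by (rule progressive_joint_measurable[OF H])
  define g where "g i \<omega> t = (\<Sum>j\<in>UNIV. (G \<omega> t $ i $ j)\<^sup>2)" for i \<omega> t
  have g0: "0 \<le> g i \<omega> t" for i \<omega> t by (simp add: g_def sum_nonneg)
  have "(\<lambda>p. G (fst p) (snd p) $ i $ j) \<in> borel_measurable (M \<Otimes>\<^sub>M lborel)" for i j
  proof -
    have "(\<lambda>x. x $ i $ j) \<in> borel_measurable (borel :: (real^'l^'d) measure)"
      by (intro borel_measurable_continuous_onI continuous_intros)
    from measurable_compose[OF G this] show ?thesis by (simp add: split_beta)
  qed
  then have gm: "(\<lambda>p. g i (fst p) (snd p)) \<in> borel_measurable (M \<Otimes>\<^sub>M lborel)" for i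
    unfolding g_def by (intro borel_measurable_sum borel_measurable_power)
  have gt: "g i \<omega> \<in> borel_measurable lborel" if "\<omega> \<in> space M" for i \<omega>
    using measurable_compose[OF measurable_Pair1'[OF that] gm[of i]] by simp
  have norm_G: "(norm (G \<omega> t))\<^sup>2 = (\<Sum>i\<in>UNIV. g i \<omega> t)" for \<omega> t
    unfolding g_def by (simp add: norm_vec_def L2_set_def sum_nonneg)
  define r where "r i S \<omega> = (\<integral>\<^sup>+t\<in>S. ennreal (g i \<omega> t) \<partial>lborel)" for i S \<omega>
  have rm: "r i S \<in> borel_measurable M" if S: "S \<in> sets borel" for i S
  proof -
    have "(\<lambda>p. ennreal (g i (fst p) (snd p)) * indicator S (snd p)) \<in> borel_measurable (M \<Otimes>\<^sub>M lborel)"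
      using gm[of i] S by (intro borel_measurable_times_ennreal measurable_compose[OF _ measurable_ennreal]
          measurable_compose[OF measurable_snd borel_measurable_indicator]) auto
    then have "(\<lambda>\<omega>. \<integral>\<^sup>+t. (\<lambda>p. ennreal (g i (fst p) (snd p)) * indicator S (snd p)) (\<omega>, t) \<partial>lborel) \<in> borel_measurable M"
      by (rule lborel.borel_measurable_nn_integral_fst)
    then show ?thesis by (simp add: r_def[abs_def])
  qed
  define R where "R S \<omega> = (\<Sum>i\<in>UNIV. r i S \<omega>)" for S \<omega>
  have Rm: "R S \<in> borel_measurable M" if S: "S \<in> sets borel" for S
    unfolding R_def using rm[OF S] by simp
  have R_eq: "R S \<omega> = (\<integral>\<^sup>+t\<in>S. ennreal ((norm (H t \<omega>))\<^sup>2) \<partial>lborel)"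
    if \<omega>: "\<omega> \<in> space M" and S: "S \<in> sets borel" "S \<subseteq> {0..}" for S \<omega>
  proof -
    have "R S \<omega> = (\<integral>\<^sup>+t. (\<Sum>i\<in>UNIV. ennreal (g i \<omega> t) * indicator S t) \<partial>lborel)"
      unfolding R_def r_def using gt[OF \<omega>] S by (subst nn_integral_sum) auto
    also have "\<dots> = (\<integral>\<^sup>+t\<in>S. ennreal ((norm (H t \<omega>))\<^sup>2) \<partial>lborel)"
    proof (rule nn_integral_cong)
      fix t
      show "(\<Sum>i\<in>UNIV. ennreal (g i \<omega> t) * indicator S t) = ennreal ((norm (H t \<omega>))\<^sup>2) * indicator S t"
      proof (cases "t \<in> S")
        case True
        then have "G \<omega> t = H t \<omega>" using S by (auto simp: G_def)
        then show ?thesis using True norm_G[of \<omega> t] g0 by (simp add: sum_ennreal)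
      qed simp
    qed
    finally show ?thesis .
  qed
  have R_mono: "R S \<omega> \<le> R S' \<omega>" if "S \<subseteq> S'" for S S' \<omega>
    unfolding R_def r_def using that
    by (intro sum_mono nn_integral_mono mult_left_mono) (auto simp: indicator_def)
  have Rfin: "(\<integral>\<^sup>+\<omega>. R {0..} \<omega> \<partial>M) < \<infinity>"
    using fin by (subst nn_integral_cong[OF R_eq]) auto
  \<comment> \<open>On a path where the energy is infinite the Bochner integral \<open>q\<close> may
    return its default value 0, so additivity and monotonicity of \<open>q\<close> are asserted only
    off this null set.\<close>
  have Rae: "AE \<omega> in M. R {0..} \<omega> < \<infinity>"
    using nn_integral_PInf_AE[OF Rm[of "{0..}"]] Rfin by (auto simp: less_top[symmetric])
  define q where "q i t \<omega> = (\<integral>s\<in>{0..t}. (\<Sum>j\<in>UNIV. (H s \<omega> $ i $ j)\<^sup>2) \<partial>lborel)" for i t \<omega>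
  have q_eq: "q i t \<omega> = (\<integral>s\<in>{0..t}. g i \<omega> s \<partial>lborel)" for i t \<omega>
    unfolding q_def set_lebesgue_integral_def
    by (rule Bochner_Integration.integral_cong) (auto simp: g_def G_def indicator_def)
  have r_le: "r i S \<omega> \<le> R S \<omega>" for i S \<omega>
    unfolding R_def by (rule member_le_sum) auto
  have g_int: "set_integrable lborel S (g i \<omega>)"
    if \<omega>: "\<omega> \<in> space M" "R {0..} \<omega> < \<infinity>" and S: "S \<in> sets borel" "S \<subseteq> {0..}" for i \<omega> S
    unfolding set_integrable_def
  proof (rule integrableI_bounded)
    show "(\<lambda>x. indicator S x *\<^sub>R g i \<omega> x) \<in> borel_measurable lborel"
      using gt[OF \<omega>(1)] S by (intro borel_measurable_scaleR) auto
    have "(\<integral>\<^sup>+ x. ennreal (norm (indicator S x *\<^sub>R g i \<omega> x)) \<partial>lborel) = r i S \<omega>"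
      unfolding r_def using g0 by (intro nn_integral_cong) (auto simp: indicator_def)
    also have "\<dots> \<le> R {0..} \<omega>" using r_le R_mono[OF S(2)] order_trans by blast
    finally show "(\<integral>\<^sup>+ x. ennreal (norm (indicator S x *\<^sub>R g i \<omega> x)) \<partial>lborel) < \<infinity>"
      using \<omega>(2) by (rule le_less_trans)
  qed
  have q_diff: "q i t \<omega> - q i s \<omega> = (\<integral>u\<in>{s<..t}. g i \<omega> u \<partial>lborel)"
    if \<omega>: "\<omega> \<in> space M" "R {0..} \<omega> < \<infinity>" and st: "0 \<le> s" "s \<le> t" for i s t \<omega>
  proof -
    have eq: "{0..t} = {0..s} \<union> {s<..t}" using st by auto
    show ?thesis unfolding q_eq eq
      by (subst set_integral_Un) (use st in \<open>auto intro!: g_int[OF \<omega>]\<close>)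
  qed
  have q_diff_nn: "0 \<le> q i t \<omega> - q i s \<omega>" "ennreal (q i t \<omega> - q i s \<omega>) \<le> r i {s..t} \<omega>"
    if \<omega>: "\<omega> \<in> space M" "R {0..} \<omega> < \<infinity>" and st: "0 \<le> s" "s \<le> t" for i s t \<omega>
  proof -
    show "0 \<le> q i t \<omega> - q i s \<omega>"
      unfolding q_diff[OF \<omega> st] set_lebesgue_integral_def using g0 by (intro integral_nonneg_AE) auto
    have i: "set_integrable lborel {s<..t} (g i \<omega>)" by (rule g_int[OF \<omega>]) (use st in auto)
    have "ennreal (q i t \<omega> - q i s \<omega>) = (\<integral>\<^sup>+ x. ennreal (indicator {s<..t} x *\<^sub>R g i \<omega> x) \<partial>lborel)"
      unfolding q_diff[OF \<omega> st] set_lebesgue_integral_def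
      by (rule nn_integral_eq_integral[symmetric]) (use i g0 in \<open>auto simp: set_integrable_def\<close>)
    also have "\<dots> \<le> r i {s..t} \<omega>" unfolding r_def by (intro nn_integral_mono) (auto simp: indicator_def)
    finally show "ennreal (q i t \<omega> - q i s \<omega>) \<le> r i {s..t} \<omega>" .
  qed
  have q0: "q i 0 \<omega> = 0" for i \<omega>
    unfolding q_def set_lebesgue_integral_def
  proof (rule integral_eq_zero_AE)
    show "AE x in lborel. indicator {0..0} x *\<^sub>R (\<Sum>j\<in>UNIV. (H x \<omega> $ i $ j)\<^sup>2) = 0"
      using AE_lborel_singleton[of 0] by eventually_elim simp
  qed
  have qc: "AE \<omega> in M. continuous_on {0..} (\<lambda>t. q i t \<omega>)" for i
    using Rae AE_space
  proof eventually_elim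
    case (elim \<omega>)
    show ?case
    proof (rule continuous_on_Ici)
      fix T :: real assume T: "0 \<le> T"
      have si: "set_integrable lborel {0..x} (g i \<omega>)" for x by (rule g_int) (use elim in auto)
      have "continuous_on {0..T} (\<lambda>x. integral {0..x} (g i \<omega>))"
        by (rule indefinite_integral_continuous_1) (rule set_borel_integral_eq_integral(1)[OF si])
      then show "continuous_on {0..T} (\<lambda>t. q i t \<omega>)"
        unfolding q_eq set_borel_integral_eq_integral(2)[OF si] .
    qed
  qed
  have qm: "AE \<omega> in M. \<forall>s t. 0 \<le> s \<longrightarrow> s \<le> t \<longrightarrow> q i s \<omega> \<le> q i t \<omega>" for i
    using Rae AE_space
  proof eventually_elim
    case (elim \<omega>)
    then show ?case using q_diff_nn(1)[of \<omega>] by fastforce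
  qed
  have qb: "AE \<omega> in M. \<forall>t\<ge>0. ennreal (q i t \<omega>) \<le> R {0..} \<omega>" for i
    using Rae AE_space
  proof eventually_elim
    case (elim \<omega>)
    show ?case
    proof (intro allI impI)
      fix t :: real assume t: "0 \<le> t"
      have "ennreal (q i t \<omega>) \<le> r i {0..t} \<omega>" using q_diff_nn(2)[of \<omega> 0 t i] elim t q0 by simp
      also have "\<dots> \<le> R {0..t} \<omega>" by (rule r_le)
      also have "\<dots> \<le> R {0..} \<omega>" by (rule R_mono) auto
      finally show "ennreal (q i t \<omega>) \<le> R {0..} \<omega>" .
    qed
  qed
  have adi: "adapted F (\<lambda>t \<omega>. I t \<omega> $ i)" for i
    unfolding adapted_def
  proof (intro allI impI)
    fix t :: real assume "0 \<le> t"
    then have "I t \<in> borel_measurable (F t)" using ad by (simp add: adapted_def)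
    then show "(\<lambda>\<omega>. I t \<omega> $ i) \<in> borel_measurable (F t)"
      by (rule measurable_compose) (intro borel_measurable_continuous_onI continuous_intros)
  qed
  have conti: "continuous_paths M (\<lambda>t \<omega>. I t \<omega> $ i)" for i
    using cont by (auto simp: continuous_paths_def intro: continuous_on_component)
  have lmi: "local_martingale M F (\<lambda>t \<omega>. I t \<omega> $ i)" for i
    using lm by (simp add: vec_local_martingale_def)
  note sq = square_of_local_martingale[OF adi conti _ lmi lm2[folded q_def] q0 qc qm qb Rfin]
  have IM: "I t \<in> borel_measurable M" if "0 \<le> t" for t
    using ad that measF by (auto simp: adapted_def)
  have IiM: "(\<lambda>\<omega>. I t \<omega> $ i) \<in> borel_measurable M" if "0 \<le> t" for t i
    using adi[of i] that measF by (auto simp: adapted_def)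
  have norm_eq: "(norm x)\<^sup>2 = (\<Sum>i\<in>UNIV. (x $ i)\<^sup>2)" for x :: "real^'d"
    by (simp add: norm_vec_def L2_set_def sum_nonneg)
  have isq: "integrable M (\<lambda>\<omega>. (I t \<omega> $ i)\<^sup>2)" if "0 \<le> t" for t i
    by (rule sq(1)) (use that I0 in simp_all)
  have dsq: "integrable M (\<lambda>\<omega>. (I t \<omega> $ i - I s \<omega> $ i)\<^sup>2)" if "0 \<le> s" "0 \<le> t" for s t i
    using integrable_square_diff[OF IiM[OF that(2)] IiM[OF that(1)], of i i] isq that by simp
  have incr: "ennreal (\<integral>\<omega>. (norm (I t \<omega> - I s \<omega>))\<^sup>2 \<partial>M) \<le> (\<integral>\<^sup>+\<omega>. R {s..t} \<omega> \<partial>M)"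
    if st: "0 \<le> s" "s \<le> t" for s t
  proof -
    have t: "0 \<le> t" using st by simp
    have "ennreal (\<integral>\<omega>. (norm (I t \<omega> - I s \<omega>))\<^sup>2 \<partial>M) = (\<integral>\<^sup>+\<omega>. ennreal ((norm (I t \<omega> - I s \<omega>))\<^sup>2) \<partial>M)"
      by (rule nn_integral_eq_integral[symmetric]) (use dsq st t in \<open>auto simp: norm_eq intro!: AE_I2 sum_nonneg\<close>)
    also have "\<dots> = (\<integral>\<^sup>+\<omega>. (\<Sum>i\<in>UNIV. ennreal ((I t \<omega> $ i - I s \<omega> $ i)\<^sup>2)) \<partial>M)"
      by (simp add: norm_eq sum_ennreal)
    also have "\<dots> = (\<Sum>i\<in>UNIV. \<integral>\<^sup>+\<omega>. ennreal ((I t \<omega> $ i - I s \<omega> $ i)\<^sup>2) \<partial>M)"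
      by (rule nn_integral_sum) (use IiM[OF t] IiM[OF st(1)] in measurable)
    also have "\<dots> \<le> (\<Sum>i\<in>UNIV. \<integral>\<^sup>+\<omega>. r i {s..t} \<omega> \<partial>M)"
    proof (rule sum_mono)
      fix i
      have "(\<integral>\<^sup>+\<omega>. ennreal ((I t \<omega> $ i - I s \<omega> $ i)\<^sup>2) \<partial>M) \<le> (\<integral>\<^sup>+\<omega>. ennreal (q i t \<omega> - q i s \<omega>) \<partial>M)"
        by (rule sq(3)) (use I0 st in simp_all)
      also have "\<dots> \<le> (\<integral>\<^sup>+\<omega>. r i {s..t} \<omega> \<partial>M)"
      proof (rule nn_integral_mono_AE)
        show "AE \<omega> in M. ennreal (q i t \<omega> - q i s \<omega>) \<le> r i {s..t} \<omega>"
          using Rae AE_space by eventually_elim (rule q_diff_nn(2)[OF _ _ st])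
      qed
      finally show "(\<integral>\<^sup>+\<omega>. ennreal ((I t \<omega> $ i - I s \<omega> $ i)\<^sup>2) \<partial>M) \<le> (\<integral>\<^sup>+\<omega>. r i {s..t} \<omega> \<partial>M)" .
    qed
    also have "\<dots> = (\<integral>\<^sup>+\<omega>. R {s..t} \<omega> \<partial>M)"
      unfolding R_def by (rule nn_integral_sum[symmetric]) (rule rm, simp)
    finally show ?thesis .
  qed
  \<comment> \<open>\<open>Cfin\<close> confirms that the conversion to a real number is faithful:
    for nonnegative \<open>s\<close> the mean energy after \<open>s\<close> is finite.\<close>
  define C where "C s = enn2real (\<integral>\<^sup>+\<omega>. R {s..} \<omega> \<partial>M)" for s
  have Cle: "(\<integral>\<^sup>+\<omega>. R {s..} \<omega> \<partial>M) \<le> (\<integral>\<^sup>+\<omega>. R {0..} \<omega> \<partial>M)" if "0 \<le> s" for s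
    using that by (intro nn_integral_mono R_mono) auto
  have Cfin: "(\<integral>\<^sup>+\<omega>. R {s..} \<omega> \<partial>M) = ennreal (C s)" if "0 \<le> s" for s
    unfolding C_def using le_less_trans[OF Cle[OF that] Rfin] by simp
  have "sq_martingale M F I C"
  proof unfold_locales
    show "I t \<in> borel_measurable (F t)" if "0 \<le> t" for t using ad that by (simp add: adapted_def)
    show "continuous_on {0..} (\<lambda>t. I t \<omega>)" if "\<omega> \<in> space M" for \<omega>
      using cont that by (simp add: continuous_paths_def)
    show "integrable M (\<lambda>\<omega>. (norm (I t \<omega>))\<^sup>2)" if "0 \<le> t" for t
      unfolding norm_eq using isq[OF that] by simp
    show "(\<integral>\<omega>. W \<omega> \<bullet> (I t \<omega> - I s \<omega>) \<partial>M) = 0"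
      if st: "0 \<le> s" "s \<le> t" and W: "W \<in> borel_measurable (F s)" "integrable M (\<lambda>\<omega>. (norm (W \<omega>))\<^sup>2)" for s t W
    proof -
      have t: "0 \<le> t" using st by simp
      have Wi: "(\<lambda>\<omega>. W \<omega> $ i) \<in> borel_measurable (F s)" for i
        by (rule measurable_compose[OF W(1)]) (intro borel_measurable_continuous_onI continuous_intros)
      have WiM: "(\<lambda>\<omega>. W \<omega> $ i) \<in> borel_measurable M" for i using measF[OF Wi] .
      have Wsq: "integrable M (\<lambda>\<omega>. (W \<omega> $ i)\<^sup>2)" for i
      proof (rule Bochner_Integration.integrable_bound[OF W(2)])
        show "(\<lambda>\<omega>. (W \<omega> $ i)\<^sup>2) \<in> borel_measurable M" using WiM by measurable
        show "AE \<omega> in M. norm ((W \<omega> $ i)\<^sup>2) \<le> norm ((norm (W \<omega>))\<^sup>2)"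
          using component_le_norm_cart by (auto simp: abs_le_square_iff[symmetric])
      qed
      have dM: "(\<lambda>\<omega>. I t \<omega> $ i - I s \<omega> $ i) \<in> borel_measurable M" for i
        using IiM[OF t] IiM[OF st(1)] by measurable
      have i: "integrable M (\<lambda>\<omega>. W \<omega> $ i * (I t \<omega> $ i - I s \<omega> $ i))" for i
        by (rule integrable_square_mult[OF WiM dM Wsq dsq[OF st(1) t]])
      have z: "(\<integral>\<omega>. W \<omega> $ i * (I t \<omega> $ i - I s \<omega> $ i) \<partial>M) = 0" for i
        by (rule sq(2)[OF _ st Wi Wsq]) (simp add: I0)
      show ?thesis using i z by (simp add: inner_vec_def)
    qed
    show "(\<integral>\<omega>. (norm (I t \<omega> - I s \<omega>))\<^sup>2 \<partial>M) \<le> C s" if st: "0 \<le> s" "s \<le> t" for s t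
    proof -
      have "ennreal (\<integral>\<omega>. (norm (I t \<omega> - I s \<omega>))\<^sup>2 \<partial>M) \<le> (\<integral>\<^sup>+\<omega>. R {s..t} \<omega> \<partial>M)" by (rule incr[OF st])
      also have "\<dots> \<le> (\<integral>\<^sup>+\<omega>. R {s..} \<omega> \<partial>M)" by (intro nn_integral_mono R_mono) auto
      also have "\<dots> = ennreal (C s)" by (rule Cfin[OF st(1)])
      finally show ?thesis by (simp add: ennreal_le_iff C_def)
    qed
  qed (use I0 in auto)
  moreover have "(\<lambda>n. C (real n)) \<longlonglongrightarrow> 0"
  proof -
    have ind: "(\<lambda>n. indicator {real n..} t) \<longlonglongrightarrow> (0::ennreal)" for t :: real
    proof (rule tendsto_eventually)
      obtain N :: nat where N: "t < real N" using reals_Archimedean2 by blast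
      show "\<forall>\<^sub>F n in sequentially. indicator {real n..} t = (0::ennreal)"
        using eventually_ge_at_top[of N]
      proof eventually_elim
        case (elim n)
        then have "real N \<le> real n" by simp
        then show ?case using N by (simp add: indicator_def)
      qed
    qed
    have rl: "(\<lambda>n. r i {real n..} \<omega>) \<longlonglongrightarrow> 0" if \<omega>: "\<omega> \<in> space M" "R {0..} \<omega> < \<infinity>" for i \<omega>
    proof -
      note dc = nn_integral_dominated_convergence[of "\<lambda>n t. ennreal (g i \<omega> t) * indicator {real n..} t" lborel
          "\<lambda>_. 0" "\<lambda>t. ennreal (g i \<omega> t) * indicator {0..} t"]
      have "(\<lambda>n. \<integral>\<^sup>+t. ennreal (g i \<omega> t) * indicator {real n..} t \<partial>lborel) \<longlonglongrightarrow> (\<integral>\<^sup>+(t::real). 0 \<partial>lborel)"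
      proof (rule dc)
        show "(\<integral>\<^sup>+t. ennreal (g i \<omega> t) * indicator {0..} t \<partial>lborel) < \<infinity>"
          using le_less_trans[OF r_le \<omega>(2)] by (simp add: r_def)
        show "AE t in lborel. (\<lambda>n. ennreal (g i \<omega> t) * indicator {real n..} t) \<longlonglongrightarrow> 0"
        proof (rule AE_I2)
          fix t
          have "(\<lambda>n. ennreal (g i \<omega> t) * indicator {real n..} t) \<longlonglongrightarrow> ennreal (g i \<omega> t) * 0"
            by (rule ennreal_tendsto_cmult[OF _ ind]) simp
          then show "(\<lambda>n. ennreal (g i \<omega> t) * indicator {real n..} t) \<longlonglongrightarrow> 0" by simp
        qed
      qed (use gt[OF \<omega>(1)] in \<open>auto simp: indicator_def\<close>)
      then show ?thesis by (simp add: r_def)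
    qed
    have "(\<lambda>n. \<integral>\<^sup>+\<omega>. R {real n..} \<omega> \<partial>M) \<longlonglongrightarrow> (\<integral>\<^sup>+\<omega>. 0 \<partial>M)"
    proof (rule nn_integral_dominated_convergence[where w = "R {0..}"])
      show "AE \<omega> in M. (\<lambda>n. R {real n..} \<omega>) \<longlonglongrightarrow> 0"
        using Rae AE_space
      proof eventually_elim
        case (elim \<omega>)
        have "(\<lambda>n. \<Sum>i\<in>UNIV. r i {real n..} \<omega>) \<longlonglongrightarrow> (\<Sum>i\<in>(UNIV::'d set). 0)"
          by (intro tendsto_sum rl) (use elim in auto)
        then show ?case by (simp add: R_def)
      qed
      show "AE \<omega> in M. R {real n..} \<omega> \<le> R {0..} \<omega>" for n by (intro AE_I2 R_mono) auto
    qed (use Rm Rfin in auto)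
    then have "(\<lambda>n. ennreal (C (real n))) \<longlonglongrightarrow> ennreal 0" by (simp add: Cfin)
    then show ?thesis by (subst (asm) tendsto_ennreal_iff) (auto simp: C_def)
  qed
  moreover have "ennreal (\<integral>\<omega>. (norm (I t \<omega> - I s \<omega>))\<^sup>2 \<partial>M)
      \<le> (\<integral>\<^sup>+\<omega>. (\<integral>\<^sup>+\<tau>\<in>{s..t}. ennreal ((norm (H \<tau> \<omega>))\<^sup>2) \<partial>lborel) \<partial>M)" if st: "0 \<le> s" "s \<le> t" for s t
    using incr[OF st] st by (subst nn_integral_cong[OF R_eq[symmetric]]) auto
  ultimately show ?thesis by blast
qed

end

section \<open>Energy estimates\<close>

text \<open>The equation after projection, where \<open>Mt\<close> has disappeared. The variational
  inequality is kept for constant test pairs, each with its own exceptional null set; the arguments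
  below therefore use countably many pairs.\<close>

locale monotone_solution = sq_martingale M F I C
  for M :: "'a measure" and F and I :: "real \<Rightarrow> 'a \<Rightarrow> 'v::euclidean_space" and C +
  fixes A :: "('v \<times> 'v) set" and X Y :: "real \<Rightarrow> 'a \<Rightarrow> 'v" and P :: "'v \<Rightarrow> 'v"
  assumes C_lim: "(\<lambda>n. C (real n)) \<longlonglongrightarrow> 0"
    and maxmon: "maximal_monotone A" and S_ne: "zeros A \<noteq> {}"
    and X_prog: "progressive F X" and X_adapted: "\<And>t. 0 \<le> t \<Longrightarrow> X t \<in> borel_measurable (F t)"
    and X_cont: "\<And>\<omega>. \<omega> \<in> space M \<Longrightarrow> continuous_on {0..} (\<lambda>t. X t \<omega>)"
    and Y_cont: "\<And>\<omega>. \<omega> \<in> space M \<Longrightarrow> continuous_on {0..} (\<lambda>t. Y t \<omega>)"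
    and Y_zero: "\<And>\<omega>. \<omega> \<in> space M \<Longrightarrow> Y 0 \<omega> = 0"
    and X0_sq: "integrable M (\<lambda>\<omega>. (norm (X 0 \<omega>))\<^sup>2)"
    and P: "orthogonal_projection P"
    and P_dom: "\<And>x y. x \<in> closure (op_dom A) \<Longrightarrow> y \<in> closure (op_dom A) \<Longrightarrow> P (x - y) = x - y"
    and AE_dom: "AE \<omega> in M. \<forall>t\<ge>0. X t \<omega> \<in> closure (op_dom A)"
    and AE_bv: "AE \<omega> in M. \<forall>T\<ge>0. bounded_variation_on (\<lambda>t. Y t \<omega>) 0 T"
    and AE_eq: "AE \<omega> in M. \<forall>t\<ge>0. P (X t \<omega>) = P (X 0 \<omega>) - P (Y t \<omega>) + P (I t \<omega>)"
    and AE_mono: "\<And>u v. (u, v) \<in> A \<Longrightarrow> AE \<omega> in M. \<forall>a b. 0 \<le> a \<longrightarrow> a \<le> b \<longrightarrow>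
        rs_integral (\<lambda>t. X t \<omega> - u) (\<lambda>t. Y t \<omega>) a b \<ge> (\<integral>t\<in>{a..b}. (X t \<omega> - u) \<bullet> v \<partial>lborel)"
begin

interpretation P: orthogonal_projection P by (rule P)

lemma X_meas: "0 \<le> t \<Longrightarrow> X t \<in> borel_measurable M"
  using measF[OF X_adapted] .

definition good :: "'a \<Rightarrow> bool" where
  "good \<omega> \<longleftrightarrow> \<omega> \<in> space M \<and> (\<forall>t\<ge>0. X t \<omega> \<in> closure (op_dom A))
    \<and> (\<forall>T\<ge>0. bounded_variation_on (\<lambda>t. Y t \<omega>) 0 T)
    \<and> (\<forall>t\<ge>0. P (X t \<omega>) = P (X 0 \<omega>) - P (Y t \<omega>) + P (I t \<omega>))"

lemma AE_good: "AE \<omega> in M. good \<omega>"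
  using AE_dom AE_bv AE_eq AE_space unfolding good_def by eventually_elim (intro conjI)

lemma goodD:
  assumes "good \<omega>"
  shows "\<omega> \<in> space M" and "\<And>t. 0 \<le> t \<Longrightarrow> X t \<omega> \<in> closure (op_dom A)"
    and "\<And>T. 0 \<le> T \<Longrightarrow> bounded_variation_on (\<lambda>t. Y t \<omega>) 0 T"
    and "\<And>t. 0 \<le> t \<Longrightarrow> P (X t \<omega>) = P (X 0 \<omega>) - P (Y t \<omega>) + P (I t \<omega>)"
  using assms unfolding good_def by blast+

definition work :: "'v \<Rightarrow> 'a \<Rightarrow> real \<Rightarrow> real \<Rightarrow> real" where
  "work xs \<omega> s t = rs_integral (\<lambda>t. X t \<omega> - xs) (\<lambda>t. Y t \<omega>) s t"

text \<open>For a zero \<open>xs\<close> and on paths with \<open>good\<close>, this equals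
  \<open>P (X 0 \<omega>) - P (Y t \<omega>) - P xs\<close>, so its increments are those of
  \<open>- P Y\<close>.\<close>

definition V :: "'v \<Rightarrow> real \<Rightarrow> 'a \<Rightarrow> 'v" where
  "V xs t \<omega> = X t \<omega> - xs - P (I t \<omega>)"

text \<open>\<open>N xs \<omega> s t\<close> is the value of the stochastic integral of \<open>V xs\<close> with respect to \<open>I\<close> over
  \<open>{s..t}\<close>, see \<open>N_limit\<close>.\<close>
definition N :: "'v \<Rightarrow> 'a \<Rightarrow> real \<Rightarrow> real \<Rightarrow> real" where
  "N xs \<omega> s t = ((norm (X t \<omega> - xs))\<^sup>2 - (norm (X s \<omega> - xs))\<^sup>2
      - (norm (P (I t \<omega>)))\<^sup>2 + (norm (P (I s \<omega>)))\<^sup>2) / 2 + work xs \<omega> s t"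

lemma zero_dom: "xs \<in> zeros A \<Longrightarrow> xs \<in> closure (op_dom A)"
  using closure_subset by (force simp: zeros_def op_dom_def)

lemma PI_adapted: "0 \<le> t \<Longrightarrow> (\<lambda>\<omega>. P (I t \<omega>)) \<in> borel_measurable (F t)"
  using measurable_compose[OF I_adapted P.P_measurable] .

lemma V_adapted: "0 \<le> t \<Longrightarrow> V xs t \<in> borel_measurable (F t)"
  unfolding V_def[abs_def] by (intro borel_measurable_diff X_adapted PI_adapted borel_measurable_const)

lemma Z_cont: "\<omega> \<in> space M \<Longrightarrow> continuous_on {0..} (\<lambda>t. X t \<omega> - xs)"
  by (intro continuous_intros X_cont)

text \<open>Testing with the pair \<open>(xs, 0)\<close> makes the right side of the variational
  inequality vanish.\<close>

lemma AE_work_nonneg: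
  assumes "xs \<in> zeros A"
  shows "AE \<omega> in M. \<forall>s t. 0 \<le> s \<longrightarrow> s \<le> t \<longrightarrow> 0 \<le> work xs \<omega> s t"
proof -
  have "(xs, 0) \<in> A" using assms by (simp add: zeros_def)
  from AE_mono[OF this] show ?thesis
    by eventually_elim (simp add: set_lebesgue_integral_def work_def)
qed

context
  fixes xs :: 'v assumes xs: "xs \<in> zeros A"
begin

lemma work_add:
  assumes g: "good \<omega>" and st: "0 \<le> s" "s \<le> t" "t \<le> u"
  shows "work xs \<omega> s u = work xs \<omega> s t + work xs \<omega> t u"
proof -
  have \<omega>: "\<omega> \<in> space M" by (rule goodD(1)[OF g])
  have "bounded_variation_on (\<lambda>t. Y t \<omega>) 0 u" by (rule goodD(3)[OF g]) (use st in simp)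
  from bounded_variation_on_subinterval_left[OF this st(1)]
  show ?thesis unfolding work_def
    by (intro rs_integral_combine st continuous_on_subset[OF Z_cont[OF \<omega>]] continuous_on_subset[OF Y_cont[OF \<omega>]])
       (use st in auto)
qed

text \<open>The mesh parameter \<open>h\<close> has two uses: \<open>h = 1\<close> reaches all
  dyadic times after \<open>s\<close>, while \<open>h = t - s\<close> hits a prescribed endpoint
  \<open>t\<close> exactly.\<close>

lemma N_limit:
  assumes g: "good \<omega>" and s: "0 \<le> s" and h: "0 < h"
  shows "(\<lambda>n. dsum (V xs) s h n (j * 2 ^ (n - m)) \<omega>) \<longlonglongrightarrow> N xs \<omega> s (grid s h m j)"
proof -
  have \<omega>: "\<omega> \<in> space M" by (rule goodD(1)[OF g])
  have PZ: "P (X t \<omega> - xs) = X t \<omega> - xs" if "s \<le> t" for t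
    by (intro P_dom zero_dom[OF xs] goodD(2)[OF g]) (use s that in simp)
  have Veq: "V xs t \<omega> = P (X 0 \<omega>) - P (Y t \<omega>) - P xs" if "s \<le> t" for t
  proof -
    have "V xs t \<omega> = P (X t \<omega>) - P xs - P (I t \<omega>)"
      using PZ[OF that] by (simp add: V_def P.P_diff)
    moreover have "P (X t \<omega>) = P (X 0 \<omega>) - P (Y t \<omega>) + P (I t \<omega>)"
      by (rule goodD(4)[OF g]) (use s that in simp)
    ultimately show ?thesis by simp
  qed
  have "(\<lambda>n. dsum (V xs) s h n (j * 2 ^ (n - m)) \<omega>)
      \<longlonglongrightarrow> ((norm (X (grid s h m j) \<omega> - xs))\<^sup>2 - (norm (X s \<omega> - xs))\<^sup>2
          - (norm (P (I (grid s h m j) \<omega>)))\<^sup>2 + (norm (P (I s \<omega>)))\<^sup>2) / 2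
          + rs_integral (\<lambda>t. X t \<omega> - xs) (\<lambda>t. Y t \<omega>) s (grid s h m j)"
  proof (rule dsum_tendsto[where Z = "\<lambda>t. X t \<omega> - xs" and Y = "\<lambda>t. Y t \<omega>" and W = "V xs", OF P h])
    show "continuous_on {s..} (\<lambda>t. X t \<omega> - xs)" "continuous_on {s..} (\<lambda>t. Y t \<omega>)"
      using s by (auto intro: continuous_on_subset[OF Z_cont[OF \<omega>]] continuous_on_subset[OF Y_cont[OF \<omega>]])
    show "bounded_variation_on (\<lambda>t. Y t \<omega>) s T" if "s \<le> T" for T
      by (rule bounded_variation_on_subinterval_left[OF _ s]) (rule goodD(3)[OF g], use s that in simp)
    show "V xs t \<omega> = X t \<omega> - xs - P (I t \<omega>)" for t by (simp add: V_def)
    show "V xs t \<omega> - V xs u \<omega> = - P (Y t \<omega> - Y u \<omega>)" if "s \<le> u" "s \<le> t" for u t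
      using Veq[OF that(1)] Veq[OF that(2)] by (simp add: P.P_diff)
  qed (rule PZ)
  then show ?thesis by (simp add: N_def work_def)
qed

text \<open>Restates \<open>limit_bound\<close> in real numbers. What matters is that the estimate
  is linear in the bound \<open>c\<close> on \<open>V\<close>, while \<open>D\<close> does not
  depend on \<open>c\<close>.\<close>

lemma N_bound:
  assumes s: "0 \<le> s"
  shows "\<exists>D\<in>borel_measurable M. (\<integral>\<^sup>+\<omega>. D \<omega> \<partial>M) \<le> ennreal (4 * C s) \<and>
    (\<forall>\<omega> d m j c. good \<omega> \<longrightarrow> D \<omega> \<le> ennreal d \<longrightarrow> 0 \<le> d \<longrightarrow> 0 < c
       \<longrightarrow> (\<forall>u. s \<le> u \<longrightarrow> u \<le> grid s 1 m j \<longrightarrow> norm (V xs u \<omega>) \<le> c)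
       \<longrightarrow> \<bar>N xs \<omega> s (grid s 1 m j)\<bar> \<le> 2 * c * sqrt d)"
proof -
  obtain D where D: "D \<in> borel_measurable M" "(\<integral>\<^sup>+\<omega>. D \<omega> \<partial>M) \<le> ennreal (4 * C s)"
    "\<And>\<omega> j m c L. 0 < c \<Longrightarrow> (\<forall>u. s \<le> u \<longrightarrow> u \<le> grid s 1 m j \<longrightarrow> norm (V xs u \<omega>) \<le> c)
       \<Longrightarrow> (\<lambda>n. dsum (V xs) s 1 n (j * 2 ^ (n - m)) \<omega>) \<longlonglongrightarrow> L \<Longrightarrow> ennreal ((L / (2 * c))\<^sup>2) \<le> D \<omega>"
    using limit_bound[OF s zero_le_one V_adapted[of _ xs]] by blast
  show ?thesis
  proof (intro bexI[of _ D] conjI allI impI D(1,2))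
    fix \<omega> d m j c
    assume g: "good \<omega>" and d: "D \<omega> \<le> ennreal d" "0 \<le> d" and c: "(0::real) < c"
      and Vc: "\<forall>u. s \<le> u \<longrightarrow> u \<le> grid s 1 m j \<longrightarrow> norm (V xs u \<omega>) \<le> c"
    have "ennreal ((N xs \<omega> s (grid s 1 m j) / (2 * c))\<^sup>2) \<le> ennreal d"
      using D(3)[OF c Vc N_limit[OF g s zero_less_one]] d(1) by (rule order_trans)
    then have "(N xs \<omega> s (grid s 1 m j) / (2 * c))\<^sup>2 \<le> d" using d(2) by (simp add: ennreal_le_iff)
    then have "\<bar>N xs \<omega> s (grid s 1 m j) / (2 * c)\<bar> \<le> sqrt d"
      by (metis real_sqrt_abs real_sqrt_le_iff)
    then show "\<bar>N xs \<omega> s (grid s 1 m j)\<bar> \<le> 2 * c * sqrt d"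
      using c by (simp add: field_simps)
  qed
qed

end

lemma nn_finite_real:
  assumes D: "D \<in> borel_measurable M" "(\<integral>\<^sup>+\<omega>. D \<omega> \<partial>M) \<le> ennreal c"
  shows "integrable M (\<lambda>\<omega>. enn2real (D \<omega>))" "AE \<omega> in M. D \<omega> = ennreal (enn2real (D \<omega>))"
proof -
  have fin: "(\<integral>\<^sup>+\<omega>. D \<omega> \<partial>M) < \<infinity>" using D(2) by (auto intro: le_less_trans)
  then have "AE \<omega> in M. D \<omega> \<noteq> \<infinity>" by (intro nn_integral_PInf_AE D(1)) auto
  then show eq: "AE \<omega> in M. D \<omega> = ennreal (enn2real (D \<omega>))"
    by eventually_elim (simp add: less_top)
  show "integrable M (\<lambda>\<omega>. enn2real (D \<omega>))"
  proof (rule integrableI_bounded)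
    show "(\<lambda>\<omega>. enn2real (D \<omega>)) \<in> borel_measurable M" using D(1) by measurable
    have "(\<integral>\<^sup>+\<omega>. ennreal (norm (enn2real (D \<omega>))) \<partial>M) = (\<integral>\<^sup>+\<omega>. D \<omega> \<partial>M)"
      by (rule nn_integral_cong_AE) (use eq in eventually_elim, simp)
    then show "(\<integral>\<^sup>+\<omega>. ennreal (norm (enn2real (D \<omega>))) \<partial>M) < \<infinity>" using fin by simp
  qed
qed

lemma I_bounded:
  "\<exists>e. integrable M e \<and> (\<forall>\<omega>. 0 \<le> e \<omega>) \<and> (AE \<omega> in M. \<forall>t\<ge>0. (norm (I t \<omega>))\<^sup>2 \<le> e \<omega>)"
proof -
  obtain E where E: "E \<in> borel_measurable M" "(\<integral>\<^sup>+\<omega>. E \<omega> \<partial>M) \<le> ennreal (16 * DIM('v) * C 0)"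
    "\<And>\<omega> u. \<omega> \<in> space M \<Longrightarrow> 0 \<le> u \<Longrightarrow> ennreal ((norm (I u \<omega> - I 0 \<omega>))\<^sup>2) \<le> E \<omega>"
    using sup_bound[OF order_refl] by blast
  note e = nn_finite_real[OF E(1,2)]
  show ?thesis
  proof (intro exI[of _ "\<lambda>\<omega>. enn2real (E \<omega>)"] conjI allI e(1))
    show "AE \<omega> in M. \<forall>t\<ge>0. (norm (I t \<omega>))\<^sup>2 \<le> enn2real (E \<omega>)"
      using e(2) AE_space
    proof eventually_elim
      case (elim \<omega>)
      show ?case
      proof (intro allI impI)
        fix t :: real assume "0 \<le> t"
        then have "ennreal ((norm (I t \<omega>))\<^sup>2) \<le> ennreal (enn2real (E \<omega>))"
          using E(3)[of \<omega> t] elim I_zero by simp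
        then show "(norm (I t \<omega>))\<^sup>2 \<le> enn2real (E \<omega>)" by (simp add: ennreal_le_iff)
      qed
    qed
  qed simp
qed

text \<open>The bound is self-improving: the stochastic integral is estimated by the supremum \<open>z\<close> of
  \<open>norm (X t - xs)\<close> itself, but only linearly.\<close>
lemma Z_bounded:
  assumes xs: "xs \<in> zeros A"
  shows "\<exists>b. integrable M b \<and> (\<forall>\<omega>. 0 \<le> b \<omega>) \<and> (AE \<omega> in M. \<forall>t\<ge>0. (norm (X t \<omega> - xs))\<^sup>2 \<le> b \<omega>)"
proof -
  obtain e where e: "integrable M e" "\<And>\<omega>. 0 \<le> e \<omega>" "AE \<omega> in M. \<forall>t\<ge>0. (norm (I t \<omega>))\<^sup>2 \<le> e \<omega>"
    using I_bounded by blast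
  obtain D where D: "D \<in> borel_measurable M" "(\<integral>\<^sup>+\<omega>. D \<omega> \<partial>M) \<le> ennreal (4 * C 0)"
    "\<And>\<omega> d m j c. good \<omega> \<Longrightarrow> D \<omega> \<le> ennreal d \<Longrightarrow> 0 \<le> d \<Longrightarrow> 0 < c
       \<Longrightarrow> (\<forall>u. 0 \<le> u \<longrightarrow> u \<le> grid 0 1 m j \<longrightarrow> norm (V xs u \<omega>) \<le> c)
       \<Longrightarrow> \<bar>N xs \<omega> 0 (grid 0 1 m j)\<bar> \<le> 2 * c * sqrt d"
    using N_bound[OF xs order_refl] by blast
  define d where "d \<omega> = enn2real (D \<omega>)" for \<omega>
  have d: "integrable M d" "AE \<omega> in M. D \<omega> = ennreal (d \<omega>)" "\<And>\<omega>. 0 \<le> d \<omega>"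
    unfolding d_def using nn_finite_real[OF D(1,2)] by auto
  \<comment> \<open>With z, i, k as below, the energy inequality reads z^2 <= |Z_0|^2 + 4 (z + i +
    1) k + i^2, and Young's inequality bounds the product by z^2/2 + 2 i^2 + 12 k^2 + 2. Absorbing
    z^2/2 and doubling gives these coefficients.\<close>
  define b where "b \<omega> = 2 * (norm (X 0 \<omega> - xs))\<^sup>2 + 24 * d \<omega> + 6 * e \<omega> + 4" for \<omega>
  have "integrable M (\<lambda>\<omega>. (norm (X 0 \<omega> - xs))\<^sup>2)"
    by (rule integrable_square_diff[OF X_meas _ X0_sq]) auto
  then have "integrable M b" unfolding b_def using d(1) e(1) by simp
  moreover have "0 \<le> b \<omega>" for \<omega> unfolding b_def using d(3)[of \<omega>] e(2)[of \<omega>] by simp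
  moreover have "AE \<omega> in M. \<forall>t\<ge>0. (norm (X t \<omega> - xs))\<^sup>2 \<le> b \<omega>"
    using AE_good e(3) d(2) AE_work_nonneg[OF xs]
  proof eventually_elim
    case (elim \<omega>)
    then have \<omega>: "\<omega> \<in> space M" using goodD(1) by blast
    show ?case
    proof (intro allI impI)
      fix T :: real assume T: "0 \<le> T"
      have contT: "continuous_on {0..T} (\<lambda>t. norm (X t \<omega> - xs))"
        by (intro continuous_intros continuous_on_subset[OF X_cont[OF \<omega>]]) auto
      \<comment> \<open>On a compact interval the maximum \<open>z\<close> is finite, so z^2/2 may
        be subtracted; the resulting bound no longer depends on \<open>T\<close>.\<close>
      obtain t0 where t0: "t0 \<in> {0..T}" "\<And>t. t \<in> {0..T} \<Longrightarrow> norm (X t \<omega> - xs) \<le> norm (X t0 \<omega> - xs)"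
        using continuous_attains_sup[OF compact_Icc _ contT] T by auto
      define z where "z = norm (X t0 \<omega> - xs)"
      define i where "i = sqrt (e \<omega>)"
      define k where "k = sqrt (d \<omega>)"
      have zik: "0 \<le> z" "0 \<le> i" "0 \<le> k" "i\<^sup>2 = e \<omega>" "k\<^sup>2 = d \<omega>"
        using e(2) d(3) by (auto simp: z_def i_def k_def)
      have Ii: "norm (P (I t \<omega>)) \<le> i" if "0 \<le> t" for t
      proof -
        have "norm (I t \<omega>) \<le> i" unfolding i_def by (rule real_le_rsqrt) (use elim that in auto)
        then show ?thesis using P.P_norm_le order_trans by blast
      qed
      \<comment> \<open>The added 1 makes the bound positive, as \<open>N_bound\<close>
        requires.\<close>
      have Vb: "norm (V xs u \<omega>) \<le> z + i + 1" if "0 \<le> u" "u \<le> T" for u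
      proof -
        have "norm (V xs u \<omega>) \<le> norm (X u \<omega> - xs) + norm (P (I u \<omega>))"
          unfolding V_def by (rule norm_triangle_ineq4)
        then show ?thesis using t0(2)[of u] Ii[OF that(1)] that by (simp add: z_def)
      qed
      have dy: "(norm (X (grid 0 1 n j) \<omega> - xs))\<^sup>2 \<le> (norm (X 0 \<omega> - xs))\<^sup>2 + 4 * (z + i + 1) * k + i\<^sup>2"
        if le: "grid 0 1 n j \<le> T" for n j
      proof -
        let ?r = "grid 0 1 n j"
        have r0: "0 \<le> ?r" by (simp add: grid_def)
        have "\<bar>N xs \<omega> 0 ?r\<bar> \<le> 2 * (z + i + 1) * k" unfolding k_def
          by (rule D(3)) (use elim d(3) zik Vb le in auto)
        moreover have "0 \<le> work xs \<omega> 0 ?r" using elim r0 by blast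
        moreover have "(norm (P (I ?r \<omega>)))\<^sup>2 \<le> i\<^sup>2" by (rule power_mono[OF Ii[OF r0]]) simp
        moreover have "(norm (X ?r \<omega> - xs))\<^sup>2 = (norm (X 0 \<omega> - xs))\<^sup>2 + 2 * N xs \<omega> 0 ?r - 2 * work xs \<omega> 0 ?r
            + (norm (P (I ?r \<omega>)))\<^sup>2 - (norm (P (I 0 \<omega>)))\<^sup>2"
          by (simp add: N_def field_simps)
        ultimately show ?thesis using zero_le_power2[of "norm (P (I 0 \<omega>))"] by linarith
      qed
      have "(norm (X t0 \<omega> - xs))\<^sup>2 \<le> (norm (X 0 \<omega> - xs))\<^sup>2 + 4 * (z + i + 1) * k + i\<^sup>2"
      proof (rule dyadic_le_extend[where T = T and s = 0 and u = t0 and g = "\<lambda>t. (norm (X t \<omega> - xs))\<^sup>2"])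
        show "continuous_on {0..T} (\<lambda>t. (norm (X t \<omega> - xs))\<^sup>2)"
          by (intro continuous_intros contT)
      qed (use dy t0 in auto)
      \<comment> \<open>Three Young inequalities, for the products of \<open>k\<close> with
        \<open>z\<close>, \<open>i\<close> and 1; their shares of k^2 are 8, 2 and 2.\<close>
      moreover have "4 * (z + i + 1) * k \<le> z\<^sup>2 / 2 + 2 * i\<^sup>2 + 12 * k\<^sup>2 + 2"
      proof -
        have "0 \<le> (z - 4 * k)\<^sup>2 / 2 + 2 * (i - k)\<^sup>2 + 2 * (1 - k)\<^sup>2" by simp
        also have "\<dots> = z\<^sup>2 / 2 + 2 * i\<^sup>2 + 12 * k\<^sup>2 + 2 - 4 * (z + i + 1) * k"
          by (simp add: power2_eq_square field_simps)
        finally show ?thesis by simp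
      qed
      moreover have "(norm (X T \<omega> - xs))\<^sup>2 \<le> z\<^sup>2"
        unfolding z_def by (rule power_mono) (use t0(2)[of T] T in auto)
      ultimately show "(norm (X T \<omega> - xs))\<^sup>2 \<le> b \<omega>"
        unfolding b_def zik(4)[symmetric] zik(5)[symmetric] z_def by linarith
    qed
  qed
  ultimately show ?thesis by blast
qed

lemma V_bounded:
  assumes xs: "xs \<in> zeros A"
  shows "\<exists>b. integrable M b \<and> (\<forall>\<omega>. 0 \<le> b \<omega>) \<and> (AE \<omega> in M. \<forall>t\<ge>0. (norm (V xs t \<omega>))\<^sup>2 \<le> b \<omega>)"
proof -
  obtain e where e: "integrable M e" "\<And>\<omega>. 0 \<le> e \<omega>" "AE \<omega> in M. \<forall>t\<ge>0. (norm (I t \<omega>))\<^sup>2 \<le> e \<omega>"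
    using I_bounded by blast
  obtain b where b: "integrable M b" "\<And>\<omega>. 0 \<le> b \<omega>" "AE \<omega> in M. \<forall>t\<ge>0. (norm (X t \<omega> - xs))\<^sup>2 \<le> b \<omega>"
    using Z_bounded[OF xs] by blast
  have le: "(norm (V xs t \<omega>))\<^sup>2 \<le> 2 * (norm (X t \<omega> - xs))\<^sup>2 + 2 * (norm (I t \<omega>))\<^sup>2" for t \<omega>
  proof -
    have "norm (V xs t \<omega>) \<le> norm (X t \<omega> - xs) + norm (P (I t \<omega>))"
      unfolding V_def by (rule norm_triangle_ineq4)
    also have "\<dots> \<le> norm (X t \<omega> - xs) + norm (I t \<omega>)" by (intro add_left_mono P.P_norm_le)
    finally have "(norm (V xs t \<omega>))\<^sup>2 \<le> (norm (X t \<omega> - xs) + norm (I t \<omega>))\<^sup>2" by (rule power_mono) simp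
    also have "\<dots> \<le> 2 * (norm (X t \<omega> - xs))\<^sup>2 + 2 * (norm (I t \<omega>))\<^sup>2"
      using sum_squares_bound[of "norm (X t \<omega> - xs)" "norm (I t \<omega>)"] by (simp add: power2_sum)
    finally show ?thesis .
  qed
  have "AE \<omega> in M. \<forall>t\<ge>0. (norm (V xs t \<omega>))\<^sup>2 \<le> 2 * b \<omega> + 2 * e \<omega>"
    using b(3) e(3)
  proof eventually_elim
    case (elim \<omega>)
    show ?case
    proof (intro allI impI)
      fix t :: real assume "0 \<le> t"
      then show "(norm (V xs t \<omega>))\<^sup>2 \<le> 2 * b \<omega> + 2 * e \<omega>"
        using le[of t \<omega>] elim(1)[rule_format, of t] elim(2)[rule_format, of t] by linarith
    qed
  qed
  then show ?thesis using b e by (intro exI[of _ "\<lambda>\<omega>. 2 * b \<omega> + 2 * e \<omega>"]) simp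
qed

lemma Z_sq:
  assumes xs: "xs \<in> zeros A" and t: "0 \<le> t"
  shows "integrable M (\<lambda>\<omega>. (norm (X t \<omega> - xs))\<^sup>2)"
proof -
  obtain b where b: "integrable M b" "AE \<omega> in M. \<forall>t\<ge>0. (norm (X t \<omega> - xs))\<^sup>2 \<le> b \<omega>"
    using Z_bounded[OF xs] by blast
  show ?thesis
    by (rule integrable_power2_bound[OF b(1)]) (use X_meas[OF t] in simp, use b(2) in eventually_elim, use t in simp)
qed

text \<open>\<open>N\<close> has mean zero by \<open>limit_expectation_zero\<close>. Solving its
  definition for the Stieltjes integral turns this into an energy balance in which the martingale
  contributes the growth of the mean square of \<open>P I\<close>.\<close>

theorem energy_estimate:
  assumes xs: "xs \<in> zeros A" and st: "0 \<le> s" "s < t"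
  shows "(\<integral>\<^sup>+\<omega>. ennreal ((norm (X t \<omega> - xs))\<^sup>2) \<partial>M) + 2 * (\<integral>\<^sup>+\<omega>. ennreal (work xs \<omega> s t) \<partial>M)
      \<le> (\<integral>\<^sup>+\<omega>. ennreal ((norm (X s \<omega> - xs))\<^sup>2) \<partial>M) + ennreal (\<integral>\<omega>. (norm (I t \<omega> - I s \<omega>))\<^sup>2 \<partial>M)"
proof -
  have t: "0 \<le> t" "s \<le> t" using st by auto
  obtain a where a: "integrable M a" "AE \<omega> in M. \<forall>t\<ge>0. (norm (V xs t \<omega>))\<^sup>2 \<le> a \<omega>"
    using V_bounded[OF xs] by blast
  have h: "0 < t - s" using st by simp
  \<comment> \<open>A limit of measurable sums, hence measurable. It replaces \<open>N\<close>,
    whose Stieltjes part is defined path by path and brings no measurability of its own.\<close>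
  define L where "L \<omega> = lim (\<lambda>n. dsum (V xs) s (t - s) n (2 ^ n) \<omega>)" for \<omega>
  have gridt: "grid s (t - s) 0 1 = t" by (simp add: grid_def)
  have Vm: "V xs u \<in> borel_measurable M" if "0 \<le> u" for u using measF[OF V_adapted[OF that]] .
  have dm: "dsum (V xs) s (t - s) n k \<in> borel_measurable M" for n k
    unfolding dsum_def
    by (intro borel_measurable_sum borel_measurable_inner borel_measurable_diff Vm I_meas grid_nonneg)
       (use st in auto)
  have Lm: "L \<in> borel_measurable M" unfolding L_def[abs_def] by (rule borel_measurable_lim_metric[OF dm])
  have lim: "(\<lambda>n. dsum (V xs) s (t - s) n (2 ^ n) \<omega>) \<longlonglongrightarrow> N xs \<omega> s t" if "good \<omega>" for \<omega>
    using N_limit[OF xs that st(1) h, of 1 0] by (simp only: gridt mult_1 diff_zero)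
  have LN: "AE \<omega> in M. L \<omega> = N xs \<omega> s t"
    using AE_good by eventually_elim (simp add: L_def limI[OF lim])
  have Llim: "AE \<omega> in M. (\<lambda>n. dsum (V xs) s (t - s) n (2 ^ n) \<omega>) \<longlonglongrightarrow> L \<omega>"
    using AE_good by eventually_elim (simp add: L_def limI[OF lim] lim)
  have as: "AE \<omega> in M. \<forall>u\<ge>s. (norm (V xs u \<omega>))\<^sup>2 \<le> a \<omega>"
    using a(2) by eventually_elim (use st in auto)
  have L: "integrable M L" "(\<integral>\<omega>. L \<omega> \<partial>M) = 0"
    using limit_expectation_zero[OF st(1) less_imp_le[OF h] V_adapted a(1) as Lm Llim] by auto
  have PIm: "(\<lambda>\<omega>. P (I u \<omega>)) \<in> borel_measurable M" if "0 \<le> u" for u using measF[OF PI_adapted[OF that]] .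
  have PIsq: "integrable M (\<lambda>\<omega>. (norm (P (I u \<omega>)))\<^sup>2)" if "0 \<le> u" for u
    by (rule integrable_power2_bound[OF I_sq[OF that] PIm[OF that]]) (simp add: P.P_norm_le power_mono)
  \<comment> \<open>Since \<open>P (I s)\<close> is orthogonal to the increment of \<open>I\<close>,
    the left side is the mean square of the projected increment, which \<open>P\<close> can only
    have decreased.\<close>
  have PI_diff: "(\<integral>\<omega>. (norm (P (I t \<omega>)))\<^sup>2 \<partial>M) - (\<integral>\<omega>. (norm (P (I s \<omega>)))\<^sup>2 \<partial>M)
      \<le> (\<integral>\<omega>. (norm (I t \<omega> - I s \<omega>))\<^sup>2 \<partial>M)"
  proof -
    have dI: "(\<lambda>\<omega>. I t \<omega> - I s \<omega>) \<in> borel_measurable M" using I_meas t st by simp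
    have dsq: "integrable M (\<lambda>\<omega>. (norm (I t \<omega> - I s \<omega>))\<^sup>2)"
      by (intro integrable_square_diff I_meas I_sq t st)
    have i: "integrable M (\<lambda>\<omega>. P (I s \<omega>) \<bullet> (I t \<omega> - I s \<omega>))"
      by (rule integrable_square_inner[OF PIm[OF st(1)] dI PIsq[OF st(1)] dsq])
    have z: "(\<integral>\<omega>. P (I s \<omega>) \<bullet> (I t \<omega> - I s \<omega>) \<partial>M) = 0"
      by (rule I_orth[OF st(1) t(2) PI_adapted[OF st(1)] PIsq[OF st(1)]])
    have "(\<integral>\<omega>. (norm (P (I t \<omega>)))\<^sup>2 \<partial>M) - (\<integral>\<omega>. (norm (P (I s \<omega>)))\<^sup>2 \<partial>M)
        = (\<integral>\<omega>. (norm (P (I t \<omega>)))\<^sup>2 - (norm (P (I s \<omega>)))\<^sup>2 - 2 * (P (I s \<omega>) \<bullet> (I t \<omega> - I s \<omega>)) \<partial>M)"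
      using PIsq[OF t(1)] PIsq[OF st(1)] i z by simp
    also have "\<dots> \<le> (\<integral>\<omega>. (norm (I t \<omega> - I s \<omega>))\<^sup>2 \<partial>M)"
    proof (rule integral_mono)
      fix \<omega>
      have "(norm (P (I t \<omega>)))\<^sup>2 - (norm (P (I s \<omega>)))\<^sup>2 - 2 * (P (I s \<omega>) \<bullet> (I t \<omega> - I s \<omega>))
          = (norm (P (I t \<omega> - I s \<omega>)))\<^sup>2"
      proof -
        have "P (I s \<omega>) \<bullet> (I t \<omega> - I s \<omega>) = P (I s \<omega>) \<bullet> (P (I t \<omega>) - P (I s \<omega>))"
          using P.P_adj[of "P (I s \<omega>)" "I t \<omega> - I s \<omega>"] by (simp add: P.P_idem P.P_diff)
        then show ?thesis
          by (simp add: P.P_diff power2_norm_eq_inner inner_diff_left inner_diff_right inner_commute)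
      qed
      also have "\<dots> \<le> (norm (I t \<omega> - I s \<omega>))\<^sup>2" by (intro power_mono P.P_norm_le) simp
      finally show "(norm (P (I t \<omega>)))\<^sup>2 - (norm (P (I s \<omega>)))\<^sup>2 - 2 * (P (I s \<omega>) \<bullet> (I t \<omega> - I s \<omega>))
          \<le> (norm (I t \<omega> - I s \<omega>))\<^sup>2" .
    qed (use PIsq[OF t(1)] PIsq[OF st(1)] i dsq in auto)
    finally show ?thesis .
  qed
  \<comment> \<open>A measurable version of the Stieltjes integral, obtained by solving the
    definition of \<open>N\<close> with \<open>L\<close> in its place.\<close>
  define W where "W \<omega> = L \<omega> - ((norm (X t \<omega> - xs))\<^sup>2 - (norm (X s \<omega> - xs))\<^sup>2
      - (norm (P (I t \<omega>)))\<^sup>2 + (norm (P (I s \<omega>)))\<^sup>2) / 2" for \<omega>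
  have Wi: "integrable M W" unfolding W_def
    using L(1) Z_sq[OF xs t(1)] Z_sq[OF xs st(1)] PIsq[OF t(1)] PIsq[OF st(1)] by simp
  have Ww: "AE \<omega> in M. W \<omega> = work xs \<omega> s t"
    using LN by eventually_elim (simp add: W_def N_def)
  have W0: "AE \<omega> in M. 0 \<le> W \<omega>"
    using Ww AE_work_nonneg[OF xs] by eventually_elim (use st in auto)
  have "(\<integral>\<^sup>+\<omega>. ennreal (work xs \<omega> s t) \<partial>M) = (\<integral>\<^sup>+\<omega>. ennreal (W \<omega>) \<partial>M)"
    by (rule nn_integral_cong_AE) (use Ww in eventually_elim, simp)
  also have "\<dots> = ennreal (\<integral>\<omega>. W \<omega> \<partial>M)" by (rule nn_integral_eq_integral[OF Wi W0])
  finally have w: "(\<integral>\<^sup>+\<omega>. ennreal (work xs \<omega> s t) \<partial>M) = ennreal (\<integral>\<omega>. W \<omega> \<partial>M)" .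
  have Zn: "(\<integral>\<^sup>+\<omega>. ennreal ((norm (X u \<omega> - xs))\<^sup>2) \<partial>M) = ennreal (\<integral>\<omega>. (norm (X u \<omega> - xs))\<^sup>2 \<partial>M)" if "0 \<le> u" for u
    by (rule nn_integral_eq_integral[OF Z_sq[OF xs that]]) simp
  have Wint: "2 * (\<integral>\<omega>. W \<omega> \<partial>M) = (\<integral>\<omega>. (norm (X s \<omega> - xs))\<^sup>2 \<partial>M) - (\<integral>\<omega>. (norm (X t \<omega> - xs))\<^sup>2 \<partial>M)
      + ((\<integral>\<omega>. (norm (P (I t \<omega>)))\<^sup>2 \<partial>M) - (\<integral>\<omega>. (norm (P (I s \<omega>)))\<^sup>2 \<partial>M))"
    unfolding W_def using L Z_sq[OF xs t(1)] Z_sq[OF xs st(1)] PIsq[OF t(1)] PIsq[OF st(1)]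
    by (simp add: field_simps)
  have W0': "0 \<le> (\<integral>\<omega>. W \<omega> \<partial>M)" by (rule integral_nonneg_AE[OF W0])
  have "(\<integral>\<omega>. (norm (X t \<omega> - xs))\<^sup>2 \<partial>M) + 2 * (\<integral>\<omega>. W \<omega> \<partial>M)
      \<le> (\<integral>\<omega>. (norm (X s \<omega> - xs))\<^sup>2 \<partial>M) + (\<integral>\<omega>. (norm (I t \<omega> - I s \<omega>))\<^sup>2 \<partial>M)"
    using Wint PI_diff by linarith
  then have "ennreal ((\<integral>\<omega>. (norm (X t \<omega> - xs))\<^sup>2 \<partial>M) + 2 * (\<integral>\<omega>. W \<omega> \<partial>M))
      \<le> ennreal ((\<integral>\<omega>. (norm (X s \<omega> - xs))\<^sup>2 \<partial>M) + (\<integral>\<omega>. (norm (I t \<omega> - I s \<omega>))\<^sup>2 \<partial>M))"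
    by (rule ennreal_leI)
  then show ?thesis
    unfolding w Zn[OF t(1)] Zn[OF st(1)] using W0' by (simp add: ennreal_plus ennreal_mult)
qed

theorem sup_square_integrable:
  assumes xs: "xs \<in> zeros A"
  shows "(\<integral>\<^sup>+\<omega>. (SUP t\<in>{0..}. ennreal ((norm (X t \<omega> - xs))\<^sup>2)) \<partial>M) < \<infinity>"
proof -
  obtain b where b: "integrable M b" "AE \<omega> in M. \<forall>t\<ge>0. (norm (X t \<omega> - xs))\<^sup>2 \<le> b \<omega>"
    using Z_bounded[OF xs] by blast
  have "(\<integral>\<^sup>+\<omega>. (SUP t\<in>{0..}. ennreal ((norm (X t \<omega> - xs))\<^sup>2)) \<partial>M) \<le> (\<integral>\<^sup>+\<omega>. ennreal (norm (b \<omega>)) \<partial>M)"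
  proof (rule nn_integral_mono_AE)
    show "AE \<omega> in M. (SUP t\<in>{0..}. ennreal ((norm (X t \<omega> - xs))\<^sup>2)) \<le> ennreal (norm (b \<omega>))"
      using b(2) by eventually_elim (rule SUP_least, rule ennreal_leI, force)
  qed
  also have "\<dots> < \<infinity>" using b(1) by (simp add: integrable_iff_bounded)
  finally show ?thesis .
qed

end

section \<open>Long-time behaviour\<close>

text \<open>The approximate limit \<open>k\<close> may change with the tolerance, which suits the
  applications: there it depends on a starting time or on a nearby point.\<close>

lemma tendsto_at_top_CauchyI:
  fixes f :: "real \<Rightarrow> real"
  assumes "\<And>e. e > 0 \<Longrightarrow> \<exists>k T. \<forall>u\<ge>T. \<bar>f u - k\<bar> \<le> e"
  shows "\<exists>L. (f \<longlongrightarrow> L) at_top"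
proof -
  have "Cauchy (\<lambda>n. f (real n))"
  proof (rule metric_CauchyI)
    fix e :: real assume "e > 0"
    then obtain k T where kT: "\<And>u. u \<ge> T \<Longrightarrow> \<bar>f u - k\<bar> \<le> e / 3" using assms[of "e / 3"] by auto
    obtain N :: nat where N: "T \<le> real N" using real_arch_simple by blast
    have "dist (f (real m)) (f (real n)) < e" if "m \<ge> N" "n \<ge> N" for m n
    proof -
      have "\<bar>f (real m) - k\<bar> \<le> e / 3" "\<bar>f (real n) - k\<bar> \<le> e / 3"
        by (rule kT; use N that in \<open>simp add: order_trans[OF N]\<close>)+
      then show ?thesis using \<open>e > 0\<close> unfolding dist_real_def by linarith
    qed
    then show "\<exists>N. \<forall>m\<ge>N. \<forall>n\<ge>N. dist (f (real m)) (f (real n)) < e" by blast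
  qed
  then obtain L where L: "(\<lambda>n. f (real n)) \<longlonglongrightarrow> L" using Cauchy_convergent convergent_def by blast
  have "(f \<longlongrightarrow> L) at_top"
  proof (rule tendstoI)
    fix e :: real assume "e > 0"
    then obtain k T where kT: "\<And>u. u \<ge> T \<Longrightarrow> \<bar>f u - k\<bar> \<le> e / 3" using assms[of "e / 3"] by auto
    obtain N :: nat where N: "T \<le> real N" using real_arch_simple by blast
    have "\<bar>L - k\<bar> \<le> e / 3"
    proof (rule tendsto_upperbound)
      show "(\<lambda>n. \<bar>f (real n) - k\<bar>) \<longlonglongrightarrow> \<bar>L - k\<bar>" by (intro tendsto_intros L)
      show "\<forall>\<^sub>F n in sequentially. \<bar>f (real n) - k\<bar> \<le> e / 3"
        using eventually_ge_at_top[of N] by eventually_elim (rule kT, use N in simp)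
    qed simp
    show "\<forall>\<^sub>F u in at_top. dist (f u) L < e"
      using eventually_ge_at_top[of T]
    proof eventually_elim
      case (elim u)
      then show ?case using kT[OF elim] \<open>\<bar>L - k\<bar> \<le> e / 3\<close> \<open>e > 0\<close> unfolding dist_real_def by linarith
    qed
  qed
  then show ?thesis ..
qed

lemma cesaro_tendsto:
  fixes f :: "real \<Rightarrow> real"
  assumes cont: "continuous_on {0..} f" and lim: "(f \<longlongrightarrow> l) at_top"
  shows "((\<lambda>t. integral {0..t} f / t) \<longlongrightarrow> l) at_top"
proof (rule tendstoI)
  fix e :: real assume e: "e > 0"
  have "\<forall>\<^sub>F u in at_top. dist (f u) l < e / 2" using tendstoD[OF lim, of "e / 2"] e by simp
  then obtain T0 where T0: "\<And>u. u \<ge> T0 \<Longrightarrow> dist (f u) l < e / 2" by (auto simp: eventually_at_top_linorder)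
  define T where "T = max T0 0"
  have T: "T \<ge> 0" "\<And>u. u \<ge> T \<Longrightarrow> \<bar>f u - l\<bar> \<le> e / 2"
    using T0 by (auto simp: T_def dist_real_def less_imp_le)
  define K where "K = \<bar>integral {0..T} (\<lambda>u. f u - l)\<bar>"
  have ci: "continuous_on {a..b} (\<lambda>u. f u - l)" if "0 \<le> a" for a b
    by (intro continuous_intros continuous_on_subset[OF cont]) (use that in auto)
  show "\<forall>\<^sub>F t in at_top. dist (integral {0..t} f / t) l < e"
    using eventually_ge_at_top[of T] eventually_gt_at_top[of "2 * K / e"] eventually_gt_at_top[of 0]
  proof eventually_elim
    case (elim t)
    have fi: "f integrable_on {0..t}"
      by (intro integrable_continuous_interval continuous_on_subset[OF cont]) auto
    have "integral {0..t} (\<lambda>u. f u - l) = integral {0..t} f - t * l"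
      using elim by (subst Henstock_Kurzweil_Integration.integral_diff[OF fi]) auto
    then have eq: "integral {0..t} f / t - l = integral {0..t} (\<lambda>u. f u - l) / t"
      using elim by (simp add: field_simps)
    have "integral {0..T} (\<lambda>u. f u - l) + integral {T..t} (\<lambda>u. f u - l) = integral {0..t} (\<lambda>u. f u - l)"
      by (rule Henstock_Kurzweil_Integration.integral_combine)
         (use T elim ci[of 0 t] in \<open>auto intro!: integrable_continuous_interval\<close>)
    moreover have "norm (integral {T..t} (\<lambda>u. f u - l)) \<le> e / 2 * (t - T)"
      by (rule integral_bound) (use elim T ci[OF T(1)] in auto)
    ultimately have "\<bar>integral {0..t} (\<lambda>u. f u - l)\<bar> \<le> K + e / 2 * (t - T)"
      unfolding K_def real_norm_def by linarith
    also have "\<dots> \<le> K + e / 2 * t" using e T(1) by simp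
    also have "\<dots> < e * t" using elim e by (simp add: field_simps)
    finally show ?case using elim unfolding dist_real_def eq by (simp add: field_simps)
  qed
qed

text \<open>The hypothesis says that adding \<open>(x, 0)\<close> to the graph keeps it monotone, so
  by maximality the pair is already there.\<close>

lemma maximal_monotone_zeroI:
  fixes A :: "('v::real_inner \<times> 'v) set"
  assumes A: "maximal_monotone A" and le: "\<And>u v. (u, v) \<in> A \<Longrightarrow> (x - u) \<bullet> v \<le> 0"
  shows "x \<in> zeros A"
proof -
  have mono: "monotone_op A" and max: "\<And>B. monotone_op B \<Longrightarrow> A \<subseteq> B \<Longrightarrow> B = A"
    using A by (auto simp: maximal_monotone_def)
  have "monotone_op (insert (x, 0) A)"
    unfolding monotone_op_def
  proof (intro ballI, clarify)
    fix u v u' v' assume 1: "(u, v) \<in> insert (x, 0) A" and 2: "(u', v') \<in> insert (x, 0) A"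
    have c: "0 \<le> (u - x) \<bullet> v" if "(u, v) \<in> A" for u v
    proof -
      have "(u - x) \<bullet> v = - ((x - u) \<bullet> v)" by (simp add: inner_diff_left)
      then show ?thesis using le[OF that] by simp
    qed
    have d: "0 \<le> (u - u') \<bullet> (v - v')" if "(u, v) \<in> A" "(u', v') \<in> A" using mono that unfolding monotone_op_def by blast
    show "0 \<le> (u - u') \<bullet> (v - v')"
    proof (cases "(u, v) \<in> A")
      case True
      show ?thesis
      proof (cases "(u', v') \<in> A")
        case False
        then have "u' = x" "v' = 0" using 2 by auto
        then show ?thesis using c[OF True] by simp
      qed (use d True in simp)
    next
      case False
      then have uv: "u = x" "v = 0" using 1 by auto
      show ?thesis
      proof (cases "(u', v') \<in> A")
        case True
        then show ?thesis using le[OF True] uv by simp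
      next
        case False
        then have "u' = x" "v' = 0" using 2 by auto
        then show ?thesis using uv by simp
      qed
    qed
  qed
  then have "insert (x, 0) A = A" by (rule max) auto
  then have "(x, 0) \<in> A" by blast
  then show ?thesis by (simp add: zeros_def)
qed

lemma Liminf_zero_less:
  fixes S :: "nat \<Rightarrow> ennreal"
  assumes "liminf S = 0" "0 < e"
  shows "\<exists>n. S n < e"
proof (rule ccontr)
  assume "\<not> ?thesis"
  then have "\<forall>\<^sub>F n in sequentially. e \<le> S n" by (auto simp: not_less)
  then have "e \<le> liminf S" by (rule Liminf_bounded)
  with assms show False by simp
qed

context monotone_solution begin

interpretation P: orthogonal_projection P by (rule P)

text \<open>After a time \<open>n\<close>, the variation of \<open>norm (X t - xs) ^ 2\<close> plus
  twice the accumulated Stieltjes integral consists of \<open>N\<close> and of increments of the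
  squared norm of \<open>P I\<close>. Both become small with the majorants \<open>D n\<close> and
  \<open>E n\<close>. The accumulated integral is nondecreasing and bounded, so it converges by
  itself.\<close>

lemma AE_limit_and_work:
  assumes xs: "xs \<in> zeros A"
  shows "AE \<omega> in M. (\<exists>L. ((\<lambda>t. (norm (X t \<omega> - xs))\<^sup>2) \<longlongrightarrow> L) at_top) \<and> (\<exists>K. \<forall>t\<ge>0. work xs \<omega> 0 t \<le> K)"
proof -
  obtain a where a: "\<And>\<omega>. 0 \<le> a \<omega>" "AE \<omega> in M. \<forall>t\<ge>0. (norm (V xs t \<omega>))\<^sup>2 \<le> a \<omega>"
    using V_bounded[OF xs] by blast
  obtain e where e: "\<And>\<omega>. 0 \<le> e \<omega>" "AE \<omega> in M. \<forall>t\<ge>0. (norm (I t \<omega>))\<^sup>2 \<le> e \<omega>"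
    using I_bounded by blast
  have "\<exists>D. \<forall>n. D n \<in> borel_measurable M \<and> (\<integral>\<^sup>+\<omega>. D n \<omega> \<partial>M) \<le> ennreal (4 * C (real n)) \<and>
    (\<forall>\<omega> d m j c. good \<omega> \<longrightarrow> D n \<omega> \<le> ennreal d \<longrightarrow> 0 \<le> d \<longrightarrow> 0 < c
       \<longrightarrow> (\<forall>u. real n \<le> u \<longrightarrow> u \<le> grid (real n) 1 m j \<longrightarrow> norm (V xs u \<omega>) \<le> c)
       \<longrightarrow> \<bar>N xs \<omega> (real n) (grid (real n) 1 m j)\<bar> \<le> 2 * c * sqrt d)"
    by (rule choice, rule allI) (use N_bound[OF xs of_nat_0_le_iff] in blast)
  then obtain D where D: "\<And>n. D n \<in> borel_measurable M" "\<And>n. (\<integral>\<^sup>+\<omega>. D n \<omega> \<partial>M) \<le> ennreal (4 * C (real n))"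
    "\<And>n \<omega> d m j c. good \<omega> \<Longrightarrow> D n \<omega> \<le> ennreal d \<Longrightarrow> 0 \<le> d \<Longrightarrow> 0 < c
       \<Longrightarrow> (\<forall>u. real n \<le> u \<longrightarrow> u \<le> grid (real n) 1 m j \<longrightarrow> norm (V xs u \<omega>) \<le> c)
       \<Longrightarrow> \<bar>N xs \<omega> (real n) (grid (real n) 1 m j)\<bar> \<le> 2 * c * sqrt d"
    by blast
  have "\<exists>E. \<forall>n. E n \<in> borel_measurable M \<and> (\<integral>\<^sup>+\<omega>. E n \<omega> \<partial>M) \<le> ennreal (16 * DIM('v) * C (real n)) \<and>
    (\<forall>\<omega>\<in>space M. \<forall>u\<ge>real n. ennreal ((norm (I u \<omega> - I (real n) \<omega>))\<^sup>2) \<le> E n \<omega>)"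
    by (rule choice, rule allI) (use sup_bound[OF of_nat_0_le_iff] in blast)
  then obtain E where E: "\<And>n. E n \<in> borel_measurable M"
    "\<And>n. (\<integral>\<^sup>+\<omega>. E n \<omega> \<partial>M) \<le> ennreal (16 * DIM('v) * C (real n))"
    "\<And>n \<omega> u. \<omega> \<in> space M \<Longrightarrow> real n \<le> u \<Longrightarrow> ennreal ((norm (I u \<omega> - I (real n) \<omega>))\<^sup>2) \<le> E n \<omega>"
    by blast
  define S where "S n \<omega> = D n \<omega> + E n \<omega>" for n \<omega>
  have Sm: "S n \<in> borel_measurable M" for n unfolding S_def[abs_def] using D(1) E(1) by measurable
  have Sle: "(\<integral>\<^sup>+\<omega>. S n \<omega> \<partial>M) \<le> ennreal ((4 + 16 * DIM('v)) * C (real n))" for n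
  proof -
    have "(\<integral>\<^sup>+\<omega>. S n \<omega> \<partial>M) = (\<integral>\<^sup>+\<omega>. D n \<omega> \<partial>M) + (\<integral>\<^sup>+\<omega>. E n \<omega> \<partial>M)"
      unfolding S_def by (rule nn_integral_add[OF D(1) E(1)])
    also have "\<dots> \<le> ennreal (4 * C (real n)) + ennreal (16 * DIM('v) * C (real n))"
      by (intro add_mono D(2) E(2))
    also have "\<dots> = ennreal ((4 + 16 * DIM('v)) * C (real n))"
      using C_nonneg[of "real n"] by (simp add: ennreal_plus[symmetric] distrib_right del: ennreal_plus)
    finally show ?thesis .
  qed
  \<comment> \<open>Since \<open>C (real n)\<close> tends to 0, Fatou makes the lower limit of the
    majorants vanish almost surely. For each path and tolerance this yields one starting time at
    which both majorants are small, which is all that a Cauchy argument asks for.\<close>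
  have "(\<integral>\<^sup>+\<omega>. liminf (\<lambda>n. S n \<omega>) \<partial>M) \<le> liminf (\<lambda>n. \<integral>\<^sup>+\<omega>. S n \<omega> \<partial>M)" by (rule nn_integral_liminf[OF Sm])
  also have "\<dots> \<le> liminf (\<lambda>n. ennreal ((4 + 16 * DIM('v)) * C (real n)))"
    by (intro Liminf_mono always_eventually allI Sle)
  also have "\<dots> = ennreal (real (4 + 16 * DIM('v)) * 0)"
    by (intro lim_imp_Liminf tendsto_ennrealI tendsto_intros C_lim trivial_limit_sequentially)
  finally have "(\<integral>\<^sup>+\<omega>. liminf (\<lambda>n. S n \<omega>) \<partial>M) = 0" by simp
  moreover have "(\<lambda>\<omega>. liminf (\<lambda>n. S n \<omega>)) \<in> borel_measurable M" using Sm by measurable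
  ultimately have S0: "AE \<omega> in M. liminf (\<lambda>n. S n \<omega>) = 0" by (simp add: nn_integral_0_iff_AE)
  have D0: "AE \<omega> in M. D 0 \<omega> = ennreal (enn2real (D 0 \<omega>))"
    by (rule nn_finite_real(2)[OF D(1) D(2)])
  show ?thesis
    using S0 D0 AE_good a(2) e(2) AE_work_nonneg[OF xs]
  proof eventually_elim
    case (elim \<omega>)
    note g = elim(3)
    have \<omega>: "\<omega> \<in> space M" by (rule goodD(1)[OF g])
    define c where "c = sqrt (a \<omega>) + 1"
    define i where "i = sqrt (e \<omega>)"
    define Z2 where "Z2 t = (norm (X t \<omega> - xs))\<^sup>2" for t
    define R where "R t = work xs \<omega> 0 t" for t
    have c: "0 < c" and i: "0 \<le> i" using a(1)[of \<omega>] e(1)[of \<omega>] by (auto simp: c_def i_def add_nonneg_pos)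
    have Vc: "norm (V xs u \<omega>) \<le> c" if "0 \<le> u" for u
    proof -
      have "norm (V xs u \<omega>) \<le> sqrt (a \<omega>)" by (rule real_le_rsqrt) (use elim(4) that in auto)
      then show ?thesis by (simp add: c_def)
    qed
    have Ii: "norm (P (I u \<omega>)) \<le> i" if "0 \<le> u" for u
    proof -
      have "norm (I u \<omega>) \<le> i" unfolding i_def by (rule real_le_rsqrt) (use elim(5) that in auto)
      then show ?thesis using P.P_norm_le order_trans by blast
    qed
    have wn: "0 \<le> work xs \<omega> s t" if "0 \<le> s" "s \<le> t" for s t using elim(6) that by blast
    have R_diff: "R t = R s + work xs \<omega> s t" if "0 \<le> s" "s \<le> t" for s t
      unfolding R_def by (rule work_add[OF xs g order_refl that])
    have R_mono: "R s \<le> R t" if "0 \<le> s" "s \<le> t" for s t using R_diff[OF that] wn[OF that] by simp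
    define d where "d = enn2real (D 0 \<omega>)"
    have d: "0 \<le> d" "D 0 \<omega> \<le> ennreal d" using elim(2) unfolding d_def by (simp, metis order_refl)
    define K where "K = 2 * c * sqrt d + Z2 0 / 2 + i\<^sup>2 / 2"
    \<comment> \<open>Integers are grid points of level 0, so the bound on \<open>N\<close> started
      at time 0 applies to them; monotonicity of \<open>R\<close> covers the times in
      between.\<close>
    have R_nat: "R (real j) \<le> K" for j :: nat
    proof -
      have gr: "grid 0 1 0 j = real j" by (simp add: grid_def)
      have "\<bar>N xs \<omega> (real 0) (grid (real 0) 1 0 j)\<bar> \<le> 2 * c * sqrt d"
        by (rule D(3)[OF g d(2,1) c]) (use Vc in auto)
      then have "\<bar>N xs \<omega> 0 (real j)\<bar> \<le> 2 * c * sqrt d" by (simp only: gr of_nat_0)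
      moreover have "2 * R (real j) = 2 * N xs \<omega> 0 (real j) - Z2 (real j) + Z2 0
          + (norm (P (I (real j) \<omega>)))\<^sup>2 - (norm (P (I 0 \<omega>)))\<^sup>2"
        by (simp add: N_def R_def Z2_def field_simps)
      moreover have "(norm (P (I (real j) \<omega>)))\<^sup>2 \<le> i\<^sup>2" by (rule power_mono[OF Ii]) auto
      moreover have "0 \<le> Z2 (real j)" by (simp add: Z2_def)
      ultimately show ?thesis using zero_le_power2[of "norm (P (I 0 \<omega>))"] unfolding K_def by linarith
    qed
    have R_le: "R t \<le> K" if "0 \<le> t" for t
    proof -
      obtain j :: nat where "t \<le> real j" using real_arch_simple by blast
      then show ?thesis using R_mono[OF that, of "real j"] R_nat[of j] by simp
    qed
    define \<kappa> where "\<kappa> = (SUP t\<in>{0..}. R t)"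
    have bdd: "bdd_above (R ` {0..})" by (rule bdd_aboveI[of _ K]) (use R_le in auto)
    have R_near: "\<exists>T\<ge>0. \<forall>u\<ge>T. \<bar>R u - \<kappa>\<bar> \<le> \<eta>" if "\<eta> > 0" for \<eta>
    proof -
      have "\<exists>x\<in>R ` {0..}. \<kappa> - \<eta> < x"
        unfolding \<kappa>_def by (subst less_cSup_iff[symmetric]) (use bdd that in auto)
      then obtain T where T: "0 \<le> T" "\<kappa> - \<eta> < R T" by auto
      have "\<bar>R u - \<kappa>\<bar> \<le> \<eta>" if "u \<ge> T" for u
      proof -
        have "R u \<le> \<kappa>" unfolding \<kappa>_def by (rule cSUP_upper[OF _ bdd]) (use that T in auto)
        moreover have "R T \<le> R u" by (rule R_mono) (use T that in auto)
        ultimately show ?thesis using T by linarith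
      qed
      with T(1) show ?thesis by blast
    qed
    have Z2_cont: "continuous_on {0..} Z2"
      unfolding Z2_def by (intro continuous_intros X_cont[OF \<omega>])
    have "\<exists>L. (Z2 \<longlongrightarrow> L) at_top"
    proof (rule tendsto_at_top_CauchyI)
      fix \<eta>0 :: real assume "\<eta>0 > 0"
      define \<eta> where "\<eta> = \<eta>0 / 3"
      have \<eta>: "\<eta> > 0" using \<open>\<eta>0 > 0\<close> by (simp add: \<eta>_def)
      \<comment> \<open>Chosen so that the bound \<open>4 * c * q\<close> for \<open>2 * N\<close>
        and the bound \<open>2 * i * q\<close> for the squared norms of \<open>P I\<close> add up to
        \<open>\<eta>\<close>.\<close>
      define q where "q = \<eta> / (4 * c + 2 * i)"
      have q: "q > 0" "(4 * c + 2 * i) * q = \<eta>" using \<eta> c i by (auto simp: q_def)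
      have "\<exists>n. S n \<omega> < ennreal (q\<^sup>2)" by (rule Liminf_zero_less[OF elim(1)]) (use q in simp)
      then obtain n where n: "S n \<omega> < ennreal (q\<^sup>2)" by blast
      have "D n \<omega> \<le> S n \<omega>" "E n \<omega> \<le> S n \<omega>" unfolding S_def by simp_all
      then have Dn: "D n \<omega> \<le> ennreal (q\<^sup>2)" and En: "E n \<omega> \<le> ennreal (q\<^sup>2)"
        using n by (meson less_imp_le order_trans)+
      have dy: "\<bar>(Z2 u + 2 * R u) - (Z2 (real n) + 2 * R (real n))\<bar> \<le> \<eta>" if u: "u = grid (real n) 1 m j" for u m j
      proof -
        have un: "real n \<le> u" unfolding u by (rule grid_ge) simp
        have "\<bar>N xs \<omega> (real n) (grid (real n) 1 m j)\<bar> \<le> 2 * c * sqrt (q\<^sup>2)"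
          by (rule D(3)[OF g Dn _ c]) (use Vc in auto)
        then have Nu: "\<bar>N xs \<omega> (real n) u\<bar> \<le> 2 * c * q" using q(1) by (simp add: u)
        have "ennreal ((norm (I u \<omega> - I (real n) \<omega>))\<^sup>2) \<le> ennreal (q\<^sup>2)"
          using E(3)[OF \<omega> un] En by (rule order_trans)
        then have "(norm (I u \<omega> - I (real n) \<omega>))\<^sup>2 \<le> q\<^sup>2" by (simp add: ennreal_le_iff)
        then have Iq: "norm (I u \<omega> - I (real n) \<omega>) \<le> q" by (rule power2_le_imp_le) (use q in simp)
        have "\<bar>norm (P (I u \<omega>)) - norm (P (I (real n) \<omega>))\<bar> \<le> norm (P (I u \<omega>) - P (I (real n) \<omega>))"
          by (rule norm_triangle_ineq3)
        also have "\<dots> = norm (P (I u \<omega> - I (real n) \<omega>))" by (simp add: P.P_diff)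
        also have "\<dots> \<le> q" using P.P_norm_le Iq order_trans by blast
        finally have Pq: "\<bar>norm (P (I u \<omega>)) - norm (P (I (real n) \<omega>))\<bar> \<le> q" .
        have "(norm (P (I u \<omega>)))\<^sup>2 - (norm (P (I (real n) \<omega>)))\<^sup>2
            = (norm (P (I u \<omega>)) - norm (P (I (real n) \<omega>))) * (norm (P (I u \<omega>)) + norm (P (I (real n) \<omega>)))"
          by (simp add: power2_eq_square algebra_simps)
        also have "\<bar>\<dots>\<bar> \<le> q * (2 * i)"
          unfolding abs_mult by (rule mult_mono[OF Pq]) (use Ii[of u] Ii[of "real n"] un q in auto)
        finally have PI: "\<bar>(norm (P (I u \<omega>)))\<^sup>2 - (norm (P (I (real n) \<omega>)))\<^sup>2\<bar> \<le> q * (2 * i)" .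
        have "(Z2 u + 2 * R u) - (Z2 (real n) + 2 * R (real n))
            = 2 * N xs \<omega> (real n) u + ((norm (P (I u \<omega>)))\<^sup>2 - (norm (P (I (real n) \<omega>)))\<^sup>2)"
          using R_diff[OF of_nat_0_le_iff un] by (simp add: N_def Z2_def field_simps)
        also have "\<bar>\<dots>\<bar> \<le> 2 * (2 * c * q) + q * (2 * i)" using Nu PI by linarith
        also have "\<dots> = \<eta>" using q(2) by (simp add: algebra_simps)
        finally show ?thesis .
      qed
      obtain T where T: "T \<ge> 0" "\<And>u. u \<ge> T \<Longrightarrow> \<bar>R u - \<kappa>\<bar> \<le> \<eta>" using R_near[OF \<eta>] by blast
      \<comment> \<open>The value that \<open>Z2\<close> approaches up to \<open>\<eta>\<close> if
        the accumulated integral has reached its limit \<open>\<kappa>\<close>. Replacing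
        \<open>2 * R\<close> by \<open>2 * \<kappa>\<close> costs another \<open>2 * \<eta>\<close>,
        for a total of \<open>\<eta>0\<close>.\<close>
      define k where "k = Z2 (real n) + 2 * R (real n) - 2 * \<kappa>"
      \<comment> \<open>The added 1 puts \<open>u\<close> strictly beyond \<open>T\<close>, so that
        the dyadic points approaching it from below eventually exceed \<open>T\<close> too.\<close>
      have "\<bar>Z2 u - k\<bar> \<le> \<eta>0" if u: "u \<ge> max (real n) T + 1" for u
      proof -
        have nu: "real n \<le> u" using u by simp
        obtain j where j: "\<And>m. grid (real n) 1 m (j m) \<le> u" "(\<lambda>m. grid (real n) 1 m (j m)) \<longlonglongrightarrow> u"
          using dyadic_approx[OF nu] by blast
        show ?thesis
        proof (rule tendsto_upperbound)
          have "(\<lambda>m. Z2 (grid (real n) 1 m (j m))) \<longlonglongrightarrow> Z2 u"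
            by (rule continuous_on_tendsto_compose[OF Z2_cont j(2)])
               (use nu order_trans[OF of_nat_0_le_iff nu] in \<open>auto intro!: always_eventually simp: grid_def\<close>)
          then show "(\<lambda>m. \<bar>Z2 (grid (real n) 1 m (j m)) - k\<bar>) \<longlonglongrightarrow> \<bar>Z2 u - k\<bar>" by (intro tendsto_intros)
          have "\<forall>\<^sub>F m in sequentially. T < grid (real n) 1 m (j m)"
            using order_tendstoD(1)[OF j(2), of T] u by simp
          then show "\<forall>\<^sub>F m in sequentially. \<bar>Z2 (grid (real n) 1 m (j m)) - k\<bar> \<le> \<eta>0"
          proof eventually_elim
            case (elim m)
            have "\<bar>R (grid (real n) 1 m (j m)) - \<kappa>\<bar> \<le> \<eta>" by (rule T(2)) (use elim in simp)
            then show ?case using dy[OF refl, of m "j m"] unfolding k_def \<eta>_def by linarith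
          qed
        qed simp
      qed
      then show "\<exists>k T. \<forall>u\<ge>T. \<bar>Z2 u - k\<bar> \<le> \<eta>0" by blast
    qed
    then show ?case using R_le unfolding Z2_def R_def by blast
  qed
qed

lemma AE_limit:
  assumes xs: "xs \<in> zeros A"
  shows "AE \<omega> in M. \<exists>L. ((\<lambda>t. (norm (X t \<omega> - xs))\<^sup>2) \<longlongrightarrow> L) at_top"
  using AE_limit_and_work[OF xs] by eventually_elim simp

text \<open>The exceptional set of \<open>AE_limit\<close> depends on the zero. It is made common by
  passing to a countable dense set of zeros, and the general case follows because the distance is
  1-Lipschitz in \<open>xs\<close>.\<close>

theorem AE_limit_all:
  "AE \<omega> in M. \<forall>xs\<in>zeros A. \<exists>L. ((\<lambda>t. norm (X t \<omega> - xs)) \<longlongrightarrow> L) at_top"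
proof -
  obtain S where S: "countable S" "S \<subseteq> zeros A" "zeros A \<subseteq> closure S" using separable by blast
  have "AE \<omega> in M. \<forall>xs\<in>S. \<exists>L. ((\<lambda>t. (norm (X t \<omega> - xs))\<^sup>2) \<longlongrightarrow> L) at_top"
    by (rule AE_ball_countable'[OF AE_limit S(1)]) (use S(2) in auto)
  then show ?thesis
  proof eventually_elim
    case (elim \<omega>)
    show ?case
    proof
      fix xs assume "xs \<in> zeros A"
      then have xs: "xs \<in> closure S" using S(3) by auto
      show "\<exists>L. ((\<lambda>t. norm (X t \<omega> - xs)) \<longlongrightarrow> L) at_top"
      proof (rule tendsto_at_top_CauchyI)
        fix e :: real assume e: "e > 0"
        obtain y where y: "y \<in> S" "dist y xs < e / 2" using xs e by (meson closure_approachable half_gt_zero)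
        obtain L where "((\<lambda>t. (norm (X t \<omega> - y))\<^sup>2) \<longlongrightarrow> L) at_top" using elim y(1) by blast
        then have "((\<lambda>t. sqrt ((norm (X t \<omega> - y))\<^sup>2)) \<longlongrightarrow> sqrt L) at_top" by (rule tendsto_real_sqrt)
        then have "((\<lambda>t. norm (X t \<omega> - y)) \<longlongrightarrow> sqrt L) at_top" by simp
        from tendstoD[OF this, of "e / 2"] e obtain T
          where T: "\<And>u. u \<ge> T \<Longrightarrow> dist (norm (X u \<omega> - y)) (sqrt L) < e / 2" by (auto simp: eventually_at_top_linorder)
        have "\<bar>norm (X u \<omega> - xs) - sqrt L\<bar> \<le> e" if "u \<ge> T" for u
        proof -
          have "\<bar>norm (X u \<omega> - xs) - norm (X u \<omega> - y)\<bar> \<le> norm ((X u \<omega> - xs) - (X u \<omega> - y))"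
            by (rule norm_triangle_ineq3)
          also have "\<dots> = dist y xs" by (simp add: dist_norm)
          finally show ?thesis using T[OF that] y(2) unfolding dist_real_def by linarith
        qed
        then show "\<exists>k T. \<forall>u\<ge>T. \<bar>norm (X u \<omega> - xs) - k\<bar> \<le> e" by blast
      qed
    qed
  qed
qed

theorem expectation_limit:
  assumes xs: "xs \<in> zeros A"
  shows "((\<lambda>t. \<integral>\<^sup>+\<omega>. ennreal ((norm (X t \<omega> - xs))\<^sup>2) \<partial>M)
          \<longlongrightarrow> (\<integral>\<^sup>+\<omega>. ennreal (Lim at_top (\<lambda>t. (norm (X t \<omega> - xs))\<^sup>2)) \<partial>M)) at_top"
proof -
  obtain b where b: "integrable M b" "\<And>\<omega>. 0 \<le> b \<omega>" "AE \<omega> in M. \<forall>t\<ge>0. (norm (X t \<omega> - xs))\<^sup>2 \<le> b \<omega>"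
    using Z_bounded[OF xs] by blast
  \<comment> \<open>Dominated convergence along the reals asks for measurability at every real time,
    while \<open>X\<close> is controlled at nonnegative times; the clamp changes nothing near
    infinity.\<close>
  define f where "f t \<omega> = (norm (X (max 0 t) \<omega> - xs))\<^sup>2" for t \<omega>
  define L where "L \<omega> = lim (\<lambda>n. f (real n) \<omega>)" for \<omega>
  have fm: "f t \<in> borel_measurable M" for t
    unfolding f_def[abs_def] using X_meas[of "max 0 t"] by measurable
  have Lm: "L \<in> borel_measurable M" unfolding L_def[abs_def] by (rule borel_measurable_lim_metric[OF fm])
  have ev: "\<forall>\<^sub>F t in at_top. (norm (X t \<omega> - xs))\<^sup>2 = f t \<omega>" for \<omega>
    using eventually_ge_at_top[of 0] by eventually_elim (simp add: f_def max_absorb2)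
  have lim: "AE \<omega> in M. ((\<lambda>t. (norm (X t \<omega> - xs))\<^sup>2) \<longlongrightarrow> L \<omega>) at_top"
    using AE_limit[OF xs]
  proof eventually_elim
    case (elim \<omega>)
    then obtain l where l: "((\<lambda>t. (norm (X t \<omega> - xs))\<^sup>2) \<longlongrightarrow> l) at_top" by blast
    then have "((\<lambda>t. f t \<omega>) \<longlongrightarrow> l) at_top" using tendsto_cong[OF ev] by blast
    then have "(\<lambda>n. f (real n) \<omega>) \<longlonglongrightarrow> l" by (rule filterlim_compose[OF _ filterlim_real_sequentially])
    then show ?case using l limI unfolding L_def by blast
  qed
  have flim: "AE \<omega> in M. ((\<lambda>t. f t \<omega>) \<longlongrightarrow> L \<omega>) at_top"
    using lim by eventually_elim (use tendsto_cong[OF ev] in blast)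
  have bound: "\<forall>\<^sub>F t in at_top. AE \<omega> in M. norm (f t \<omega>) \<le> b \<omega>"
  proof (rule always_eventually, rule allI)
    fix t
    show "AE \<omega> in M. norm (f t \<omega>) \<le> b \<omega>" using b(3) by eventually_elim (simp add: f_def)
  qed
  have c: "((\<lambda>t. \<integral>\<omega>. f t \<omega> \<partial>M) \<longlongrightarrow> (\<integral>\<omega>. L \<omega> \<partial>M)) at_top"
    by (rule integral_dominated_convergence_at_top[OF Lm fm b(1) flim bound])
  have L0: "AE \<omega> in M. 0 \<le> L \<omega>"
    using lim by eventually_elim (rule tendsto_lowerbound, assumption, simp_all)
  have Li: "integrable M L"
  proof (rule Bochner_Integration.integrable_bound[OF b(1) Lm])
    show "AE \<omega> in M. norm (L \<omega>) \<le> norm (b \<omega>)"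
      using flim b(3) L0
    proof eventually_elim
      case (elim \<omega>)
      have "L \<omega> \<le> b \<omega>"
        by (rule tendsto_upperbound[OF elim(1)]) (use elim(2) in \<open>auto simp: f_def intro!: always_eventually\<close>)
      then show ?case using elim(3) by simp
    qed
  qed
  have "(\<integral>\<^sup>+\<omega>. ennreal (Lim at_top (\<lambda>t. (norm (X t \<omega> - xs))\<^sup>2)) \<partial>M) = (\<integral>\<^sup>+\<omega>. ennreal (L \<omega>) \<partial>M)"
    by (rule nn_integral_cong_AE) (use lim in eventually_elim, simp add: tendsto_Lim)
  also have "\<dots> = ennreal (\<integral>\<omega>. L \<omega> \<partial>M)" by (rule nn_integral_eq_integral[OF Li L0])
  finally have rhs: "(\<integral>\<^sup>+\<omega>. ennreal (Lim at_top (\<lambda>t. (norm (X t \<omega> - xs))\<^sup>2)) \<partial>M) = ennreal (\<integral>\<omega>. L \<omega> \<partial>M)" .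
  have "\<forall>\<^sub>F t in at_top. ennreal (\<integral>\<omega>. f t \<omega> \<partial>M) = (\<integral>\<^sup>+\<omega>. ennreal ((norm (X t \<omega> - xs))\<^sup>2) \<partial>M)"
    using eventually_ge_at_top[of 0]
  proof eventually_elim
    case (elim t)
    have "(\<integral>\<^sup>+\<omega>. ennreal ((norm (X t \<omega> - xs))\<^sup>2) \<partial>M) = ennreal (\<integral>\<omega>. (norm (X t \<omega> - xs))\<^sup>2 \<partial>M)"
      by (rule nn_integral_eq_integral[OF Z_sq[OF xs elim]]) simp
    then show ?case using elim by (simp add: f_def max_absorb2)
  qed
  from Lim_transform_eventually[OF tendsto_ennrealI[OF c] this] show ?thesis unfolding rhs .
qed

end

section \<open>Convergence of the time averages\<close>

lemma integral_inner_left: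
  fixes f :: "'n::euclidean_space \<Rightarrow> 'v::euclidean_space"
  assumes "f integrable_on S"
  shows "integral S (\<lambda>x. f x \<bullet> v) = integral S f \<bullet> v"
  using integral_linear[OF assms bounded_linear_inner_left[of v]] by (simp add: o_def)

text \<open>Cluster points \<open>p\<close>, \<open>q\<close> of the averages are zeros, so \<open>x t \<bullet> (p - q)\<close> converges; its limit is
  also that of its averages, hence equal to both \<open>p \<bullet> (p - q)\<close> and \<open>q \<bullet> (p - q)\<close>.\<close>
lemma opial_ergodic:
  fixes x :: "real \<Rightarrow> 'v::euclidean_space"
  assumes cont: "continuous_on {0..} x" and A: "maximal_monotone A" and ne: "zeros A \<noteq> {}"
    and dist_lim: "\<And>p. p \<in> zeros A \<Longrightarrow> \<exists>L. ((\<lambda>t. norm (x t - p)) \<longlongrightarrow> L) at_top"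
    and dense: "A \<subseteq> closure A0"
    and bound: "\<And>u v. (u, v) \<in> A0 \<Longrightarrow> \<exists>K. \<forall>t>0. integral {0..t} (\<lambda>s. (x s - u) \<bullet> v) \<le> K"
  shows "\<exists>p\<in>zeros A. ((\<lambda>t. (1 / t) *\<^sub>R integral {0..t} x) \<longlongrightarrow> p) at_top"
proof -
  define b where "b t = (1 / t) *\<^sub>R integral {0..t} x" for t
  have ci: "continuous_on {0..t} x" for t by (rule continuous_on_subset[OF cont]) auto
  have xi: "x integrable_on {0..t}" for t by (rule integrable_continuous_interval[OF ci])
  have b_inner: "b t \<bullet> v = integral {0..t} (\<lambda>s. x s \<bullet> v) / t" for t v
    by (simp add: b_def integral_inner_left[OF xi])
  have b_diff: "b t - p = (1 / t) *\<^sub>R integral {0..t} (\<lambda>s. x s - p)" if "t > 0" for t p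
  proof -
    have "integral {0..t} (\<lambda>s. x s - p) = integral {0..t} x - t *\<^sub>R p"
      using that by (subst Henstock_Kurzweil_Integration.integral_diff[OF xi]) auto
    then show ?thesis using that by (simp add: b_def scaleR_diff_right)
  qed
  obtain p0 where p0: "p0 \<in> zeros A" using ne by blast
  obtain L0 where L0: "((\<lambda>t. norm (x t - p0)) \<longlongrightarrow> L0) at_top" using dist_lim[OF p0] by blast
  \<comment> \<open>The averages of the convergent distance to \<open>p0\<close> converge too, so
    from some time on the averages of \<open>x\<close> stay in a ball, which supplies the
    compactness.\<close>
  have "continuous_on {0..} (\<lambda>t. norm (x t - p0))" by (intro continuous_intros cont)
  from cesaro_tendsto[OF this L0]
  have "((\<lambda>t. integral {0..t} (\<lambda>s. norm (x s - p0)) / t) \<longlongrightarrow> L0) at_top" .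
  from order_tendstoD(2)[OF this, of "L0 + 1"]
  have "\<forall>\<^sub>F t in at_top. integral {0..t} (\<lambda>s. norm (x s - p0)) / t < L0 + 1" by simp
  then obtain T0 where T0: "\<And>t. t \<ge> T0 \<Longrightarrow> integral {0..t} (\<lambda>s. norm (x s - p0)) / t < L0 + 1"
    unfolding eventually_at_top_linorder by blast
  define T where "T = max T0 1"
  have T: "T > 0" "\<And>t. t \<ge> T \<Longrightarrow> b t \<in> cball p0 (L0 + 1)"
  proof -
    show "T > 0" by (simp add: T_def)
    fix t assume t: "t \<ge> T"
    then have t0: "t > 0" "t \<ge> T0" by (auto simp: T_def)
    have "norm (integral {0..t} (\<lambda>s. x s - p0)) \<le> integral {0..t} (\<lambda>s. norm (x s - p0))"
      by (rule Henstock_Kurzweil_Integration.integral_norm_bound_integral)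
         (auto intro!: integrable_continuous_interval continuous_intros ci)
    then have "norm (b t - p0) \<le> integral {0..t} (\<lambda>s. norm (x s - p0)) / t"
      using t0 by (simp add: b_diff divide_right_mono)
    also have "\<dots> < L0 + 1" by (rule T0[OF t0(2)])
    finally show "b t \<in> cball p0 (L0 + 1)" by (simp add: dist_norm norm_minus_commute)
  qed
  \<comment> \<open>Dividing the bounded integrals by the time shows that a cluster point
    \<open>q\<close> satisfies \<open>(q - u) \<bullet> v \<le> 0\<close> for pairs in
    \<open>A0\<close>. The inequality is closed in the pair, so it extends to \<open>A\<close>, and
    maximality concludes.\<close>
  have cluster: "q \<in> zeros A" if r: "filterlim r at_top sequentially" and q: "(\<lambda>n. b (r n)) \<longlonglongrightarrow> q" for r :: "nat \<Rightarrow> real" and q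
  proof (rule maximal_monotone_zeroI[OF A])
    have A0: "(q - u) \<bullet> v \<le> 0" if uv: "(u, v) \<in> A0" for u v
    proof -
      obtain K where K: "\<And>t. t > 0 \<Longrightarrow> integral {0..t} (\<lambda>s. (x s - u) \<bullet> v) \<le> K" using bound[OF uv] by blast
      have le: "(b t - u) \<bullet> v \<le> K / t" if t: "t > 0" for t
      proof -
        have i: "(\<lambda>s. x s - u) integrable_on {0..t}" by (intro integrable_continuous_interval continuous_intros ci)
        show ?thesis using t K[OF t] by (simp add: b_diff[OF t] integral_inner_left[OF i] divide_right_mono)
      qed
      have "(\<lambda>n. K / r n) \<longlonglongrightarrow> 0"
        by (rule real_tendsto_divide_at_top[OF tendsto_const r])
      moreover have "(\<lambda>n. (b (r n) - u) \<bullet> v) \<longlonglongrightarrow> (q - u) \<bullet> v" by (intro tendsto_intros q)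
      moreover have "\<forall>\<^sub>F n in sequentially. (b (r n) - u) \<bullet> v \<le> K / r n"
      proof -
        have "\<forall>\<^sub>F n in sequentially. 0 < r n" using r unfolding filterlim_at_top_dense by blast
        then show ?thesis by eventually_elim (rule le)
      qed
      ultimately show ?thesis using tendsto_le[OF sequentially_bot] by blast
    qed
    have cl: "closed {p. (q - fst p) \<bullet> snd p \<le> 0}"
      by (intro closed_Collect_le continuous_intros)
    have "closure A0 \<subseteq> {p. (q - fst p) \<bullet> snd p \<le> 0}"
      by (rule closure_minimal[OF _ cl]) (use A0 in auto)
    then show "(q - u) \<bullet> v \<le> 0" if "(u, v) \<in> A" for u v using that dense by auto
  qed
  have unique: "q1 = q2"
    if 1: "filterlim r1 at_top sequentially" "(\<lambda>n. b (r1 n)) \<longlonglongrightarrow> q1"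
      and 2: "filterlim r2 at_top sequentially" "(\<lambda>n. b (r2 n)) \<longlonglongrightarrow> q2" for r1 r2 :: "nat \<Rightarrow> real" and q1 q2
  proof -
    obtain L1 where L1: "((\<lambda>t. norm (x t - q1)) \<longlongrightarrow> L1) at_top" using dist_lim[OF cluster[OF 1]] by blast
    obtain L2 where L2: "((\<lambda>t. norm (x t - q2)) \<longlongrightarrow> L2) at_top" using dist_lim[OF cluster[OF 2]] by blast
    \<comment> \<open>Polarisation expresses the pairing with \<open>q1 - q2\<close> through the two
      distances, both of which converge.\<close>
    have eq: "x t \<bullet> (q1 - q2) = ((norm (x t - q2))\<^sup>2 - (norm (x t - q1))\<^sup>2 - (norm q2)\<^sup>2 + (norm q1)\<^sup>2) / 2" for t
      by (simp add: power2_norm_eq_inner inner_diff_left inner_diff_right inner_commute)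
    have "((\<lambda>t. x t \<bullet> (q1 - q2)) \<longlongrightarrow> (L2\<^sup>2 - L1\<^sup>2 - (norm q2)\<^sup>2 + (norm q1)\<^sup>2) / 2) at_top"
      unfolding eq by (intro tendsto_intros L1 L2) simp_all
    from cesaro_tendsto[OF _ this]
    have l: "((\<lambda>t. b t \<bullet> (q1 - q2)) \<longlongrightarrow> (L2\<^sup>2 - L1\<^sup>2 - (norm q2)\<^sup>2 + (norm q1)\<^sup>2) / 2) at_top"
      unfolding b_inner by (simp add: continuous_intros cont)
    have "(\<lambda>n. b (r1 n) \<bullet> (q1 - q2)) \<longlonglongrightarrow> q1 \<bullet> (q1 - q2)" by (intro tendsto_intros 1)
    then have e1: "q1 \<bullet> (q1 - q2) = (L2\<^sup>2 - L1\<^sup>2 - (norm q2)\<^sup>2 + (norm q1)\<^sup>2) / 2"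
      using LIMSEQ_unique[OF _ filterlim_compose[OF l 1(1)]] by blast
    have "(\<lambda>n. b (r2 n) \<bullet> (q1 - q2)) \<longlonglongrightarrow> q2 \<bullet> (q1 - q2)" by (intro tendsto_intros 2)
    then have e2: "q2 \<bullet> (q1 - q2) = (L2\<^sup>2 - L1\<^sup>2 - (norm q2)\<^sup>2 + (norm q1)\<^sup>2) / 2"
      using LIMSEQ_unique[OF _ filterlim_compose[OF l 2(1)]] by blast
    have "(q1 - q2) \<bullet> (q1 - q2) = 0" using e1 e2 by (simp add: inner_diff_left)
    then show ?thesis by simp
  qed
  \<comment> \<open>The last clause lets a lower bound that holds along \<open>r\<close> pass to the
    selected times.\<close>
  have subseq: "\<exists>q r'. filterlim r' at_top sequentially \<and> (\<lambda>n. b (r' n)) \<longlonglongrightarrow> q \<and> (\<forall>n. \<exists>m. r' n = r m)"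
    if r: "\<And>n. real n + T \<le> r n" for r :: "nat \<Rightarrow> real"
  proof -
    have inb: "\<forall>n. b (r n) \<in> cball p0 (L0 + 1)"
    proof
      fix n
      show "b (r n) \<in> cball p0 (L0 + 1)" by (rule T(2)) (use r[of n] of_nat_0_le_iff[of n] in linarith)
    qed
    have "seq_compact (cball p0 (L0 + 1))" by (simp add: compact_imp_seq_compact)
    from this[unfolded seq_compact_def, THEN spec, THEN mp, OF inb]
    obtain q s where s: "strict_mono s" "((\<lambda>n. b (r n)) \<circ> s) \<longlonglongrightarrow> q" by blast
    have "filterlim (\<lambda>n. r (s n)) at_top sequentially"
    proof (rule filterlim_at_top_mono[OF filterlim_real_sequentially], rule always_eventually, rule allI)
      fix n
      have "real n \<le> real (s n)" using seq_suble[OF s(1), of n] by simp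
      then show "real n \<le> r (s n)" using r[of "s n"] T(1) by linarith
    qed
    then show ?thesis using s(2) by (intro exI[of _ q] exI[of _ "\<lambda>n. r (s n)"]) (auto simp: o_def)
  qed
  obtain p r0 where p: "filterlim r0 at_top sequentially" "(\<lambda>n. b (r0 n)) \<longlonglongrightarrow> p"
    using subseq[of "\<lambda>n. real n + T"] by auto
  have "(b \<longlongrightarrow> p) at_top"
  proof (rule ccontr)
    assume "\<not> ?thesis"
    then obtain e where e: "e > 0" "\<not> (\<forall>\<^sub>F t in at_top. dist (b t) p < e)" by (auto simp: tendsto_iff)
    have "\<forall>n. \<exists>t. real n + T \<le> t \<and> e \<le> dist (b t) p"
      using e(2) unfolding eventually_at_top_linorder by (metis not_le)
    then obtain r where r: "\<And>n. real n + T \<le> r n" "\<And>n. e \<le> dist (b (r n)) p" by metis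
    obtain q r' where q: "filterlim r' at_top sequentially" "(\<lambda>n. b (r' n)) \<longlonglongrightarrow> q" "\<And>n. \<exists>m. r' n = r m"
      using subseq[OF r(1)] by blast
    have "e \<le> dist q p"
    proof (rule tendsto_lowerbound)
      show "(\<lambda>n. dist (b (r' n)) p) \<longlonglongrightarrow> dist q p" by (intro tendsto_intros q)
      show "\<forall>\<^sub>F n in sequentially. e \<le> dist (b (r' n)) p"
        by (rule always_eventually) (metis q(3) r(2))
    qed simp
    moreover have "q = p" by (rule unique[OF q(1,2) p])
    ultimately show False using e(1) by simp
  qed
  then show ?thesis using cluster[OF p] unfolding b_def by blast
qed

context monotone_solution begin

interpretation P: orthogonal_projection P by (rule P)

definition avg :: "real \<Rightarrow> 'a \<Rightarrow> 'v" where
  "avg t \<omega> = (1 / t) *\<^sub>R integral {0..t} (\<lambda>s. X s \<omega>)"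

lemma avg_meas: "avg t \<in> borel_measurable M"
proof -
  have "(\<lambda>(\<omega>, s). indicator {0..} s *\<^sub>R X s \<omega>) \<in> borel_measurable (M \<Otimes>\<^sub>M lborel)"
    by (rule progressive_joint_measurable[OF X_prog])
  then have J: "(\<lambda>p. indicator {0..} (snd p) *\<^sub>R X (snd p) (fst p)) \<in> borel_measurable (M \<Otimes>\<^sub>M lborel)"
    by (simp only: case_prod_beta')
  have "(\<lambda>p. indicator {0..t} (snd p) :: real) \<in> borel_measurable (M \<Otimes>\<^sub>M lborel)"
    by (rule measurable_compose[OF measurable_snd borel_measurable_indicator]) simp
  from borel_measurable_scaleR[OF this J]
  have "case_prod (\<lambda>\<omega> s. indicator {0..t} s *\<^sub>R (indicator {0..} s *\<^sub>R X s \<omega>)) \<in> borel_measurable (M \<Otimes>\<^sub>M lborel)"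
    by (simp only: case_prod_beta')
  from lborel.borel_measurable_lebesgue_integral[OF this]
  have m: "(\<lambda>\<omega>. \<integral>s. indicator {0..t} s *\<^sub>R (indicator {0..} s *\<^sub>R X s \<omega>) \<partial>lborel) \<in> borel_measurable M" .
  have eq: "integral {0..t} (\<lambda>s. X s \<omega>) = (\<integral>s. indicator {0..t} s *\<^sub>R (indicator {0..} s *\<^sub>R X s \<omega>) \<partial>lborel)"
    if "\<omega> \<in> space M" for \<omega>
  proof -
    have "set_integrable lborel {0..t} (\<lambda>s. X s \<omega>)"
      unfolding set_integrable_def
      by (intro borel_integrable_compact compact_Icc continuous_on_subset[OF X_cont[OF that]]) auto
    from set_borel_integral_eq_integral(2)[OF this]
    have "integral {0..t} (\<lambda>s. X s \<omega>) = (\<integral>s. indicator {0..t} s *\<^sub>R X s \<omega> \<partial>lborel)"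
      by (simp add: set_lebesgue_integral_def)
    also have "\<dots> = (\<integral>s. indicator {0..t} s *\<^sub>R (indicator {0..} s *\<^sub>R X s \<omega>) \<partial>lborel)"
      by (rule Bochner_Integration.integral_cong) (auto simp: indicator_def)
    finally show ?thesis .
  qed
  have "(\<lambda>\<omega>. (1 / t) *\<^sub>R (\<integral>s. indicator {0..t} s *\<^sub>R (indicator {0..} s *\<^sub>R X s \<omega>) \<partial>lborel)) \<in> borel_measurable M"
    using m by (rule borel_measurable_scaleR[OF borel_measurable_const])
  then show ?thesis unfolding avg_def[abs_def] by (subst measurable_cong[OF arg_cong[OF eq]]) simp_all
qed

text \<open>Reduces to \<open>opial_ergodic\<close> on almost every path. Monotonicity bounds the
  time integral there by the Stieltjes integral of \<open>X - u\<close>; splitting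
  \<open>X - u\<close> at a zero \<open>xs\<close> leaves \<open>work\<close>, which stays bounded,
  and a boundary term in \<open>Y\<close>.\<close>

lemma AE_avg_converges: "AE \<omega> in M. \<exists>p\<in>zeros A. ((\<lambda>t. avg t \<omega>) \<longlongrightarrow> p) at_top"
proof -
  obtain xs where xs: "xs \<in> zeros A" using S_ne by blast
  obtain A0 where A0: "countable A0" "A0 \<subseteq> A" "A \<subseteq> closure A0" using separable by blast
  obtain b where b: "AE \<omega> in M. \<forall>t\<ge>0. (norm (X t \<omega> - xs))\<^sup>2 \<le> b \<omega>" using Z_bounded[OF xs] by blast
  obtain e where e: "AE \<omega> in M. \<forall>t\<ge>0. (norm (I t \<omega>))\<^sup>2 \<le> e \<omega>" using I_bounded by blast
  have mono: "AE \<omega> in M. \<forall>p\<in>A0. \<forall>s t. 0 \<le> s \<longrightarrow> s \<le> t \<longrightarrow>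
      rs_integral (\<lambda>t. X t \<omega> - fst p) (\<lambda>t. Y t \<omega>) s t \<ge> (\<integral>t\<in>{s..t}. (X t \<omega> - fst p) \<bullet> snd p \<partial>lborel)"
    by (rule AE_ball_countable'[OF AE_mono A0(1)]) (use A0(2) in auto)
  show ?thesis
    using AE_good AE_limit_all AE_limit_and_work[OF xs] mono b e
  proof eventually_elim
    case (elim \<omega>)
    note g = elim(1)
    have \<omega>: "\<omega> \<in> space M" by (rule goodD(1)[OF g])
    obtain K where K: "\<And>t. t \<ge> 0 \<Longrightarrow> work xs \<omega> 0 t \<le> K" using elim(3) by blast
    show ?case unfolding avg_def
    proof (rule opial_ergodic[OF X_cont[OF \<omega>] maxmon S_ne _ A0(3)])
      show "\<exists>L. ((\<lambda>t. norm (X t \<omega> - p)) \<longlongrightarrow> L) at_top" if "p \<in> zeros A" for p using elim(2) that by blast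
      fix u v assume uv: "(u, v) \<in> A0"
      then have uA: "u \<in> closure (op_dom A)"
        using A0(2) closure_subset[of "op_dom A"] by (force simp: op_dom_def)
      have Pu: "P (xs - u) = xs - u" by (rule P_dom[OF zero_dom[OF xs] uA])
      define K' where "K' = K + norm (xs - u) * (norm (X 0 \<omega> - xs) + sqrt (b \<omega>) + sqrt (e \<omega>))"
      have "integral {0..t} (\<lambda>s. (X s \<omega> - u) \<bullet> v) \<le> K'" if t: "t > 0" for t
      proof -
        have "set_integrable lborel {0..t} (\<lambda>s. (X s \<omega> - u) \<bullet> v)"
          unfolding set_integrable_def
          by (intro borel_integrable_compact compact_Icc continuous_intros continuous_on_subset[OF X_cont[OF \<omega>]]) auto
        from set_borel_integral_eq_integral(2)[OF this]
        have "integral {0..t} (\<lambda>s. (X s \<omega> - u) \<bullet> v) = (\<integral>s\<in>{0..t}. (X s \<omega> - u) \<bullet> v \<partial>lborel)" by simp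
        also have "\<dots> \<le> rs_integral (\<lambda>s. X s \<omega> - u) (\<lambda>s. Y s \<omega>) 0 t"
          using elim(4)[rule_format, OF uv, of 0 t] t by simp
        also have "rs_integral (\<lambda>s. X s \<omega> - u) (\<lambda>s. Y s \<omega>) 0 t
            = rs_integral (\<lambda>s. (X s \<omega> - xs) + (xs - u)) (\<lambda>s. Y s \<omega>) 0 t"
        proof -
          have "(\<lambda>s. X s \<omega> - u) = (\<lambda>s. (X s \<omega> - xs) + (xs - u))" by auto
          then show ?thesis by (simp only:)
        qed
        also have "\<dots> = work xs \<omega> 0 t + (xs - u) \<bullet> (Y t \<omega> - Y 0 \<omega>)"
          unfolding work_def
          by (rule rs_integral_add_const)
             (use t in \<open>auto intro!: continuous_on_subset[OF Z_cont[OF \<omega>]] continuous_on_subset[OF Y_cont[OF \<omega>]] goodD(3)[OF g]\<close>)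
        also have "\<dots> \<le> K'"
        proof -
          \<comment> \<open>As \<open>xs - u\<close> is fixed by \<open>P\<close>, only
            \<open>P (Y t \<omega>)\<close> matters. The projected equation expresses it through
            \<open>X\<close> and \<open>I\<close>, both bounded in time on this path.\<close>
          have "(xs - u) \<bullet> (Y t \<omega> - Y 0 \<omega>) = (xs - u) \<bullet> P (Y t \<omega>)"
            using P.P_adj[of "xs - u" "Y t \<omega>"] Pu by (simp add: Y_zero[OF \<omega>])
          also have "P (Y t \<omega>) = P ((X 0 \<omega> - xs) - (X t \<omega> - xs) + I t \<omega>)"
            using goodD(4)[OF g, of t] t by (simp add: P.P_diff linear_add[OF P.P_linear] algebra_simps)
          also have "(xs - u) \<bullet> \<dots> \<le> norm (xs - u) * norm (P ((X 0 \<omega> - xs) - (X t \<omega> - xs) + I t \<omega>))"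
            by (rule norm_cauchy_schwarz)
          also have "\<dots> \<le> norm (xs - u) * (norm (X 0 \<omega> - xs) + sqrt (b \<omega>) + sqrt (e \<omega>))"
          proof (rule mult_left_mono)
            have "norm (P ((X 0 \<omega> - xs) - (X t \<omega> - xs) + I t \<omega>)) \<le> norm ((X 0 \<omega> - xs) - (X t \<omega> - xs) + I t \<omega>)"
              by (rule P.P_norm_le)
            also have "\<dots> \<le> norm (X 0 \<omega> - xs) + norm (X t \<omega> - xs) + norm (I t \<omega>)"
              by (meson add_mono norm_triangle_ineq norm_triangle_ineq4 order_refl order_trans)
            also have "norm (X t \<omega> - xs) \<le> sqrt (b \<omega>)" by (rule real_le_rsqrt) (use elim(5) t in auto)
            also have "norm (I t \<omega>) \<le> sqrt (e \<omega>)" by (rule real_le_rsqrt) (use elim(6) t in auto)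
            finally show "norm (P ((X 0 \<omega> - xs) - (X t \<omega> - xs) + I t \<omega>)) \<le> norm (X 0 \<omega> - xs) + sqrt (b \<omega>) + sqrt (e \<omega>)"
              by simp
          qed simp
          finally show ?thesis using K[of t] t unfolding K'_def by simp
        qed
        finally show ?thesis .
      qed
      then show "\<exists>K. \<forall>t>0. integral {0..t} (\<lambda>s. (X s \<omega> - u) \<bullet> v) \<le> K" by blast
    qed
  qed
qed

lemma AE_avg_bounded:
  assumes b: "AE \<omega> in M. \<forall>t\<ge>0. (norm (X t \<omega> - xs))\<^sup>2 \<le> b \<omega>" and b0: "\<And>\<omega>. 0 \<le> b \<omega>"
  shows "AE \<omega> in M. \<forall>t>0. norm (avg t \<omega> - xs) \<le> sqrt (b \<omega>)"
  using b AE_space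
proof eventually_elim
  case (elim \<omega>)
  show ?case
  proof (intro allI impI)
    fix t :: real assume t: "t > 0"
    have ci: "continuous_on {0..t} (\<lambda>s. X s \<omega>)" by (rule continuous_on_subset[OF X_cont]) (use elim in auto)
    have xi: "(\<lambda>s. X s \<omega>) integrable_on {0..t}" by (rule integrable_continuous_interval[OF ci])
    have i: "integral {0..t} (\<lambda>s. X s \<omega> - xs) = integral {0..t} (\<lambda>s. X s \<omega>) - t *\<^sub>R xs"
      using t by (subst Henstock_Kurzweil_Integration.integral_diff[OF xi]) auto
    have "norm (integral {0..t} (\<lambda>s. X s \<omega> - xs)) \<le> sqrt (b \<omega>) * (t - 0)"
    proof (rule integral_bound)
      show "continuous_on {0..t} (\<lambda>s. X s \<omega> - xs)" by (intro continuous_intros ci)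
      show "norm (X s \<omega> - xs) \<le> sqrt (b \<omega>)" if "s \<in> {0..t}" for s
        by (rule real_le_rsqrt) (use elim that in auto)
    qed (use t in simp)
    moreover have "avg t \<omega> - xs = (1 / t) *\<^sub>R integral {0..t} (\<lambda>s. X s \<omega> - xs)"
      using t by (simp add: avg_def i scaleR_diff_right)
    ultimately show "norm (avg t \<omega> - xs) \<le> sqrt (b \<omega>)" using t by (simp add: field_simps)
  qed
qed

theorem ergodic_limit:
  "\<exists>Xs. Xs \<in> borel_measurable M \<and> integrable M (\<lambda>\<omega>. (norm (Xs \<omega>))\<^sup>2)
        \<and> (AE \<omega> in M. Xs \<omega> \<in> zeros A)
        \<and> (AE \<omega> in M. ((\<lambda>t. avg t \<omega>) \<longlongrightarrow> Xs \<omega>) at_top)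
        \<and> ((\<lambda>t. \<integral>\<^sup>+\<omega>. ennreal ((norm (avg t \<omega> - Xs \<omega>))\<^sup>2) \<partial>M) \<longlongrightarrow> 0) at_top"
proof -
  obtain xs where xs: "xs \<in> zeros A" using S_ne by blast
  obtain b where b: "integrable M b" "\<And>\<omega>. 0 \<le> b \<omega>" "AE \<omega> in M. \<forall>t\<ge>0. (norm (X t \<omega> - xs))\<^sup>2 \<le> b \<omega>"
    using Z_bounded[OF xs] by blast
  note avgb = AE_avg_bounded[OF b(3,2)]
  define Xs where "Xs \<omega> = lim (\<lambda>n. avg (real n) \<omega>)" for \<omega>
  have m: "Xs \<in> borel_measurable M" unfolding Xs_def[abs_def] by (rule borel_measurable_lim_metric[OF avg_meas])
  have both: "AE \<omega> in M. Xs \<omega> \<in> zeros A \<and> ((\<lambda>t. avg t \<omega>) \<longlongrightarrow> Xs \<omega>) at_top"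
    using AE_avg_converges
  proof eventually_elim
    case (elim \<omega>)
    then obtain p where p: "p \<in> zeros A" "((\<lambda>t. avg t \<omega>) \<longlongrightarrow> p) at_top" by blast
    have "(\<lambda>n. avg (real n) \<omega>) \<longlonglongrightarrow> p" by (rule filterlim_compose[OF p(2) filterlim_real_sequentially])
    then have "Xs \<omega> = p" unfolding Xs_def by (rule limI)
    with p show ?case by simp
  qed
  have lim: "AE \<omega> in M. ((\<lambda>t. avg t \<omega>) \<longlongrightarrow> Xs \<omega>) at_top" using both by eventually_elim simp
  have Xb: "AE \<omega> in M. norm (Xs \<omega> - xs) \<le> sqrt (b \<omega>)"
    using avgb lim
  proof eventually_elim
    case (elim \<omega>)
    show ?case
    proof (rule tendsto_upperbound)
      show "((\<lambda>t. norm (avg t \<omega> - xs)) \<longlongrightarrow> norm (Xs \<omega> - xs)) at_top" by (intro tendsto_intros elim)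
      show "\<forall>\<^sub>F t in at_top. norm (avg t \<omega> - xs) \<le> sqrt (b \<omega>)"
        using eventually_gt_at_top[of 0] by eventually_elim (use elim in blast)
    qed simp
  qed
  have sq: "integrable M (\<lambda>\<omega>. (norm (Xs \<omega> - xs + xs))\<^sup>2)"
  proof (rule integrable_square_add)
    show "integrable M (\<lambda>\<omega>. (norm (Xs \<omega> - xs))\<^sup>2)"
    proof (rule integrable_power2_bound[OF b(1)])
      show "AE \<omega> in M. (norm (Xs \<omega> - xs))\<^sup>2 \<le> b \<omega>"
        using Xb
      proof eventually_elim
        case (elim \<omega>)
        then have "(norm (Xs \<omega> - xs))\<^sup>2 \<le> (sqrt (b \<omega>))\<^sup>2" by (rule power_mono) simp
        then show ?case using b(2)[of \<omega>] by simp
      qed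
    qed (use m in simp)
  qed (use m in simp_all)
  define f where "f t \<omega> = (norm (avg t \<omega> - Xs \<omega>))\<^sup>2" for t \<omega>
  have fm: "f t \<in> borel_measurable M" for t
    unfolding f_def[abs_def] using avg_meas[of t] m by measurable
  \<comment> \<open>Both the averages and their limit lie within \<open>sqrt (b \<omega>)\<close> of
    \<open>xs\<close>, hence within twice that of each other; this gives the majorant
    \<open>4 * b\<close>.\<close>
  have fb: "AE \<omega> in M. norm (f t \<omega>) \<le> 4 * b \<omega>" if t: "t > 0" for t
    using avgb Xb
  proof eventually_elim
    case (elim \<omega>)
    have "norm (avg t \<omega> - Xs \<omega>) \<le> norm (avg t \<omega> - xs) + norm (Xs \<omega> - xs)"
      using norm_triangle_ineq4[of "avg t \<omega> - xs" "Xs \<omega> - xs"] by simp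
    also have "\<dots> \<le> 2 * sqrt (b \<omega>)" using elim t by fastforce
    finally have "(norm (avg t \<omega> - Xs \<omega>))\<^sup>2 \<le> (2 * sqrt (b \<omega>))\<^sup>2" by (rule power_mono) simp
    then show ?case using b(2)[of \<omega>] by (simp add: f_def power_mult_distrib)
  qed
  have flim: "AE \<omega> in M. ((\<lambda>t. f t \<omega>) \<longlongrightarrow> 0) at_top"
    using lim
  proof eventually_elim
    case (elim \<omega>)
    have "((\<lambda>t. f t \<omega>) \<longlongrightarrow> (norm (Xs \<omega> - Xs \<omega>))\<^sup>2) at_top" unfolding f_def by (intro tendsto_intros elim)
    then show ?case by simp
  qed
  have bound: "\<forall>\<^sub>F t in at_top. AE \<omega> in M. norm (f t \<omega>) \<le> 4 * b \<omega>"
    using eventually_gt_at_top[of 0] by eventually_elim (rule fb)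
  have b4: "integrable M (\<lambda>\<omega>. 4 * b \<omega>)" using b(1) by simp
  have zm: "(\<lambda>_. 0) \<in> borel_measurable M" by simp
  have "((\<lambda>t. \<integral>\<omega>. f t \<omega> \<partial>M) \<longlongrightarrow> (\<integral>\<omega>. 0 \<partial>M)) at_top"
    by (rule integral_dominated_convergence_at_top[OF zm fm b4 flim bound])
  then have "((\<lambda>t. ennreal (\<integral>\<omega>. f t \<omega> \<partial>M)) \<longlongrightarrow> ennreal 0) at_top"
    by (intro tendsto_ennrealI) simp
  moreover have "\<forall>\<^sub>F t in at_top. ennreal (\<integral>\<omega>. f t \<omega> \<partial>M) = (\<integral>\<^sup>+\<omega>. ennreal ((norm (avg t \<omega> - Xs \<omega>))\<^sup>2) \<partial>M)"
    using eventually_gt_at_top[of 0]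
  proof eventually_elim
    case (elim t)
    have "integrable M (f t)"
      by (rule Bochner_Integration.integrable_bound[OF b4 fm]) (use fb[OF elim] in eventually_elim, use b(2) in simp)
    then show ?case unfolding f_def by (rule nn_integral_eq_integral[symmetric]) simp
  qed
  ultimately have "((\<lambda>t. \<integral>\<^sup>+\<omega>. ennreal ((norm (avg t \<omega> - Xs \<omega>))\<^sup>2) \<partial>M) \<longlongrightarrow> 0) at_top"
    using Lim_transform_eventually by fastforce
  moreover have "AE \<omega> in M. Xs \<omega> \<in> zeros A" using both by eventually_elim simp
  ultimately show ?thesis using m sq lim by (intro exI[of _ Xs]) simp
qed

end

section \<open>Application to the stochastic equation\<close>

lemma (in filtered_space) progressive_adapted:
  assumes "progressive F Z" "0 \<le> t"
  shows "Z t \<in> borel_measurable (F t)"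
proof -
  have "(\<lambda>(s, \<omega>). Z s \<omega>) \<in> borel_measurable (restrict_space borel {0..t} \<Otimes>\<^sub>M F t)"
    using assms by (simp add: progressive_def)
  moreover have "Pair t \<in> measurable (F t) (restrict_space borel {0..t} \<Otimes>\<^sub>M F t)"
    by (rule measurable_Pair1') (use assms(2) in \<open>simp add: space_restrict_space\<close>)
  ultimately have "(\<lambda>\<omega>. (\<lambda>(s, \<omega>). Z s \<omega>) (t, \<omega>)) \<in> borel_measurable (F t)"
    by (rule measurable_compose[rotated])
  then show ?thesis by simp
qed

text \<open>Subspaces of a finite-dimensional space are closed, so the span already contains the
  differences of limit points. This matters because \<open>X\<close> stays in the closure of the
  domain only.\<close>

lemma diff_closure_mem_span:
  fixes D :: "'v::euclidean_space set"
  assumes "x \<in> closure D" "y \<in> closure D"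
  shows "x - y \<in> span {u - v | u v. u \<in> D \<and> v \<in> D}"
proof -
  obtain f g where f: "\<And>n. f n \<in> D" "f \<longlonglongrightarrow> x" and g: "\<And>n. g n \<in> D" "g \<longlonglongrightarrow> y"
    using assms unfolding closure_sequential by blast
  have "closed (span {u - v | u v. u \<in> D \<and> v \<in> D})" by (intro closed_subspace subspace_span)
  moreover have "f n - g n \<in> span {u - v | u v. u \<in> D \<and> v \<in> D}" for n
    using f(1) g(1) by (intro span_base) blast
  ultimately show ?thesis using tendsto_diff[OF f(2) g(2)] by (rule closed_sequentially)
qed

text \<open>In (a) the dissipation term stands on the left because subtraction in
  \<open>ennreal\<close> truncates; by \<open>AE_work_nonneg\<close> the Stieltjes integral is
  almost surely nonnegative, so the conversion keeps its value. In (c) the value of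
  \<open>Lim\<close> is the true limit on the almost sure event where the limit exists.\<close>

theorem theorem4p2:
  fixes M :: "'a measure" and F :: "real \<Rightarrow> 'a measure"
    and B :: "real \<Rightarrow> 'a \<Rightarrow> real^'l"
    and A :: "((real^'d) \<times> (real^'d)) set"
    and \<sigma> :: "'a \<Rightarrow> real \<Rightarrow> real^'d \<Rightarrow> real^'l^'d"
    and \<kappa> :: "real \<Rightarrow> real"
    and X0 :: "'a \<Rightarrow> real^'d"
    and X Y Mt :: "real \<Rightarrow> 'a \<Rightarrow> real^'d"
  assumes prob: "prob_space M"
    and filt: "filtration_usual M F"
    and BM: "brownian_motion M F B"
    and maxmon: "maximal_monotone A"
    and S_ne: "zeros A \<noteq> {}"
    and sig_prog: "\<And>x. progressive F (\<lambda>t \<omega>. \<sigma> \<omega> t x)"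
    and kappa_meas: "\<kappa> \<in> borel_measurable lborel"
    and kappa_L2loc: "\<And>T. T \<ge> 0 \<Longrightarrow> set_integrable lborel {0..T} (\<lambda>t. (\<kappa> t)\<^sup>2)"
    and sig_lip: "\<And>\<omega> t x y. \<omega> \<in> space M \<Longrightarrow> t \<ge> 0 \<Longrightarrow>
                    norm (\<sigma> \<omega> t x - \<sigma> \<omega> t y) \<le> \<kappa> t * norm (x - y)"
    and sig_inf: "(\<integral>\<^sup>+\<omega>. (\<integral>\<^sup>+t\<in>{0..}. (sigma_inf \<sigma> \<omega> t)\<^sup>2 \<partial>lborel) \<partial>M) < \<infinity>"
    and X0_meas: "X0 \<in> borel_measurable (F 0)"
    and X0_L2: "integrable M (\<lambda>\<omega>. (norm (X0 \<omega>))\<^sup>2)"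
    and X0_dom: "\<And>\<omega>. \<omega> \<in> space M \<Longrightarrow> X0 \<omega> \<in> closure (op_dom A)"
    and sol: "sde_solution M F B A \<sigma> X0 X Y Mt"
  shows
    \<comment> \<open>(a)\<close>
    "(\<forall>xs\<in>zeros A. \<forall>s t. 0 \<le> s \<longrightarrow> s < t \<longrightarrow>
        (\<integral>\<^sup>+\<omega>. ennreal ((norm (X t \<omega> - xs))\<^sup>2) \<partial>M)
          + 2 * (\<integral>\<^sup>+\<omega>. ennreal (rs_integral (\<lambda>\<tau>. X \<tau> \<omega> - xs) (\<lambda>\<tau>. Y \<tau> \<omega>) s t) \<partial>M)
        \<le> (\<integral>\<^sup>+\<omega>. ennreal ((norm (X s \<omega> - xs))\<^sup>2) \<partial>M)
          + (\<integral>\<^sup>+\<omega>. (\<integral>\<^sup>+\<tau>\<in>{s..t}. (sigma_inf \<sigma> \<omega> \<tau>)\<^sup>2 \<partial>lborel) \<partial>M))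
   \<and> \<comment> \<open>(b)\<close>
     (\<forall>xs\<in>zeros A. (\<integral>\<^sup>+\<omega>. (SUP t\<in>{0..}. ennreal ((norm (X t \<omega> - xs))\<^sup>2)) \<partial>M) < \<infinity>)
   \<and> \<comment> \<open>(c)\<close>
     (AE \<omega> in M. \<forall>xs\<in>zeros A. \<exists>L. ((\<lambda>t. norm (X t \<omega> - xs)) \<longlongrightarrow> L) at_top)
   \<and> (\<forall>xs\<in>zeros A.
        ((\<lambda>t. \<integral>\<^sup>+\<omega>. ennreal ((norm (X t \<omega> - xs))\<^sup>2) \<partial>M)
          \<longlongrightarrow> (\<integral>\<^sup>+\<omega>. ennreal (Lim at_top (\<lambda>t. (norm (X t \<omega> - xs))\<^sup>2)) \<partial>M)) at_top)
   \<and> \<comment> \<open>(d)\<close>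
     (\<exists>Xs :: 'a \<Rightarrow> real^'d. Xs \<in> borel_measurable M
        \<and> integrable M (\<lambda>\<omega>. (norm (Xs \<omega>))\<^sup>2)
        \<and> (AE \<omega> in M. Xs \<omega> \<in> zeros A)
        \<and> (AE \<omega> in M. ((\<lambda>t. (1 / t) *\<^sub>R integral {0..t} (\<lambda>s. X s \<omega>)) \<longlongrightarrow> Xs \<omega>) at_top)
        \<and> ((\<lambda>t. \<integral>\<^sup>+\<omega>. ennreal ((norm ((1 / t) *\<^sub>R integral {0..t} (\<lambda>s. X s \<omega>) - Xs \<omega>))\<^sup>2) \<partial>M)
            \<longlongrightarrow> 0) at_top)"
proof -
  interpret filtered_space M F
    using prob filt by (simp add: filtered_space_def filtered_space_axioms_def)
  let ?H = "\<lambda>t \<omega>. \<sigma> \<omega> t (X t \<omega>)"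
  note conj = sol[unfolded sde_solution_def]
  have X_paths: "continuous_paths M X" by (rule conj[THEN conjunct1])
  note conj = conj[THEN conjunct2]
  have Y_paths: "continuous_paths M Y" by (rule conj[THEN conjunct1])
  note conj = conj[THEN conjunct2, THEN conjunct2]
  have X_prog: "progressive F X" by (rule conj[THEN conjunct1])
  note conj = conj[THEN conjunct2, THEN conjunct2, THEN conjunct2]
  have zero: "Y 0 \<omega> = 0" "Mt 0 \<omega> = 0" if "\<omega> \<in> space M" for \<omega>
    using conj[THEN conjunct1] that by simp_all
  note conj = conj[THEN conjunct2]
  have dom: "AE \<omega> in M. \<forall>t\<ge>0. X t \<omega> \<in> closure (op_dom A)" by (rule conj[THEN conjunct1])
  note conj = conj[THEN conjunct2]
  have H_prog: "progressive F ?H" by (rule conj[THEN conjunct1])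
  note conj = conj[THEN conjunct2, THEN conjunct2]
  have bv: "AE \<omega> in M. \<forall>T\<ge>0. bounded_variation_on (\<lambda>t. Y t \<omega>) 0 T" by (rule conj[THEN conjunct1])
  note conj = conj[THEN conjunct2]
  note conj_mono = conj[THEN conjunct1]
  note conj = conj[THEN conjunct2, THEN conjunct2]
  have Mt_orth: "AE \<omega> in M. \<forall>t\<ge>0. \<forall>x\<in>op_dom A. \<forall>y\<in>op_dom A. inner (Mt t \<omega>) (x - y) = 0"
    by (rule conj[THEN conjunct1])
  from conj[THEN conjunct2]
  obtain I where ito: "ito_integral M F B ?H I"
    and eq: "AE \<omega> in M. \<forall>t\<ge>0. X t \<omega> = X0 \<omega> - Y t \<omega> + Mt t \<omega> + I t \<omega>" by blast
  note conj = ito[unfolded ito_integral_def]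
  note I_adapted = conj[THEN conjunct1]
  note conj = conj[THEN conjunct2]
  note I_paths = conj[THEN conjunct1]
  note conj = conj[THEN conjunct2]
  note I_zero = conj[THEN conjunct1, rule_format]
  note conj = conj[THEN conjunct2]
  note I_lm = conj[THEN conjunct1]
  note I_lm2 = conj[THEN conjunct2, THEN conjunct2, rule_format]
  have H_le: "(\<integral>\<^sup>+\<omega>. (\<integral>\<^sup>+t\<in>S. ennreal ((norm (?H t \<omega>))\<^sup>2) \<partial>lborel) \<partial>M)
      \<le> (\<integral>\<^sup>+\<omega>. (\<integral>\<^sup>+t\<in>S. (sigma_inf \<sigma> \<omega> t)\<^sup>2 \<partial>lborel) \<partial>M)" for S
  proof (intro nn_integral_mono mult_right_mono)
    fix \<omega> t
    have "ennreal (norm (?H t \<omega>)) \<le> sigma_inf \<sigma> \<omega> t"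
      unfolding sigma_inf_def by (rule SUP_upper) simp
    then have "(ennreal (norm (?H t \<omega>)))\<^sup>2 \<le> (sigma_inf \<sigma> \<omega> t)\<^sup>2" by (rule power_mono) simp
    then show "ennreal ((norm (?H t \<omega>))\<^sup>2) \<le> (sigma_inf \<sigma> \<omega> t)\<^sup>2" by (simp add: ennreal_power)
  qed simp
  have fin: "(\<integral>\<^sup>+\<omega>. (\<integral>\<^sup>+t\<in>{0..}. ennreal ((norm (?H t \<omega>))\<^sup>2) \<partial>lborel) \<partial>M) < \<infinity>"
    using H_le sig_inf by (rule le_less_trans)
  obtain C where C: "sq_martingale M F I C" "(\<lambda>n. C (real n)) \<longlonglongrightarrow> 0"
    "\<And>s t. 0 \<le> s \<Longrightarrow> s \<le> t \<Longrightarrow> ennreal (\<integral>\<omega>. (norm (I t \<omega> - I s \<omega>))\<^sup>2 \<partial>M)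
          \<le> (\<integral>\<^sup>+\<omega>. (\<integral>\<^sup>+\<tau>\<in>{s..t}. ennreal ((norm (?H \<tau> \<omega>))\<^sup>2) \<partial>lborel) \<partial>M)"
    using ito_square_integrable[OF H_prog I_adapted I_paths I_zero I_lm I_lm2 fin] by blast
  define S where "S = span {u - v | u v. u \<in> op_dom A \<and> v \<in> op_dom A}"
  have sub: "subspace S" unfolding S_def by (rule subspace_span)
  obtain P where P: "orthogonal_projection P" "\<And>x. x \<in> S \<Longrightarrow> P x = x"
    "\<And>x. \<forall>y\<in>S. x \<bullet> y = 0 \<Longrightarrow> P x = 0"
    by (rule orthogonal_projection_exists[OF sub]) (rule that)
  interpret P: orthogonal_projection P by (rule P(1))
  \<comment> \<open>Orthogonality to the differences of domain points extends linearly to their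
    span, and \<open>P\<close> annihilates whatever is orthogonal to the span.\<close>
  have PM: "P m = 0" if "\<forall>x\<in>op_dom A. \<forall>y\<in>op_dom A. inner m (x - y) = 0" for m
  proof (rule P(3), rule ballI)
    fix y assume "y \<in> S"
    then show "m \<bullet> y = 0" unfolding S_def
    proof (induction y rule: span_induct_alt)
      case (step c x y)
      then have "m \<bullet> x = 0" using that by blast
      then show ?case using step by (simp add: inner_add_right)
    qed simp
  qed
  have X_init: "AE \<omega> in M. X 0 \<omega> = X0 \<omega>"
    using eq AE_space
  proof eventually_elim
    case (elim \<omega>)
    then show ?case using zero[of \<omega>] I_zero[of \<omega>] by simp
  qed
  have eqP: "AE \<omega> in M. \<forall>t\<ge>0. P (X t \<omega>) = P (X 0 \<omega>) - P (Y t \<omega>) + P (I t \<omega>)"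
    using eq Mt_orth X_init
  proof eventually_elim
    case (elim \<omega>)
    show ?case
    proof (intro allI impI)
      fix t :: real assume t: "0 \<le> t"
      have m: "P (Mt t \<omega>) = 0" by (rule PM) (use elim(2) t in blast)
      have "X t \<omega> = X 0 \<omega> - Y t \<omega> + Mt t \<omega> + I t \<omega>" using elim(1)[rule_format, OF t] elim(3) by simp
      then have "P (X t \<omega>) = P (X 0 \<omega> - Y t \<omega> + Mt t \<omega> + I t \<omega>)" by (rule arg_cong)
      then show "P (X t \<omega>) = P (X 0 \<omega>) - P (Y t \<omega>) + P (I t \<omega>)"
        by (simp only: linear_add[OF P.P_linear] P.P_diff m add_0_right)
    qed
  qed
  interpret Q: sq_martingale M F I C by (rule C(1))
  interpret sol: monotone_solution M F I C A X Y P
  proof unfold_locales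
    show X_ad: "X t \<in> borel_measurable (F t)" if "0 \<le> t" for t by (rule progressive_adapted[OF X_prog that])
    show "integrable M (\<lambda>\<omega>. (norm (X 0 \<omega>))\<^sup>2)"
    proof (rule integrable_cong_AE_imp[OF X0_L2])
      have "X 0 \<in> borel_measurable M" by (rule measF[OF X_ad]) simp
      then show "(\<lambda>\<omega>. (norm (X 0 \<omega>))\<^sup>2) \<in> borel_measurable M" by measurable
      show "AE \<omega> in M. (norm (X0 \<omega>))\<^sup>2 = (norm (X 0 \<omega>))\<^sup>2" using X_init by eventually_elim simp
    qed
    show "P (x - y) = x - y" if "x \<in> closure (op_dom A)" "y \<in> closure (op_dom A)" for x y
      by (rule P(2)) (use diff_closure_mem_span[OF that] in \<open>simp add: S_def\<close>)
    show "AE \<omega> in M. \<forall>a b. 0 \<le> a \<longrightarrow> a \<le> b \<longrightarrow>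
        rs_integral (\<lambda>t. X t \<omega> - u) (\<lambda>t. Y t \<omega>) a b \<ge> (\<integral>t\<in>{a..b}. (X t \<omega> - u) \<bullet> v \<partial>lborel)"
      if "(u, v) \<in> A" for u v
    proof -
      \<comment> \<open>Constant processes are continuous and adapted, so every pair of the graph is
        an admissible test pair.\<close>
      have "continuous_paths M (\<lambda>_ _. w)" "adapted F (\<lambda>_ _. w)" for w :: "real^'d"
        by (simp_all add: continuous_paths_def adapted_def)
      then show ?thesis
        using conj_mono[THEN spec, of "\<lambda>_ _. u", THEN spec, of "\<lambda>_ _. v"] that by simp
    qed
    show "continuous_on {0..} (\<lambda>t. X t \<omega>)" "continuous_on {0..} (\<lambda>t. Y t \<omega>)" if "\<omega> \<in> space M" for \<omega>
      using X_paths Y_paths that by (simp_all add: continuous_paths_def)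
    show "Y 0 \<omega> = 0" if "\<omega> \<in> space M" for \<omega> by (rule zero(1)[OF that])
  qed (fact C(2) maxmon S_ne X_prog dom bv eqP)+
  have a: "(\<integral>\<^sup>+\<omega>. ennreal ((norm (X t \<omega> - xs))\<^sup>2) \<partial>M)
          + 2 * (\<integral>\<^sup>+\<omega>. ennreal (rs_integral (\<lambda>\<tau>. X \<tau> \<omega> - xs) (\<lambda>\<tau>. Y \<tau> \<omega>) s t) \<partial>M)
        \<le> (\<integral>\<^sup>+\<omega>. ennreal ((norm (X s \<omega> - xs))\<^sup>2) \<partial>M)
          + (\<integral>\<^sup>+\<omega>. (\<integral>\<^sup>+\<tau>\<in>{s..t}. (sigma_inf \<sigma> \<omega> \<tau>)\<^sup>2 \<partial>lborel) \<partial>M)"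
    if xs: "xs \<in> zeros A" and st: "0 \<le> s" "s < t" for xs s t
  proof -
    have "ennreal (\<integral>\<omega>. (norm (I t \<omega> - I s \<omega>))\<^sup>2 \<partial>M)
        \<le> (\<integral>\<^sup>+\<omega>. (\<integral>\<^sup>+\<tau>\<in>{s..t}. (sigma_inf \<sigma> \<omega> \<tau>)\<^sup>2 \<partial>lborel) \<partial>M)"
      using C(3)[of s t] st H_le[of "{s..t}"] by (meson less_imp_le order_trans)
    with sol.energy_estimate[OF xs st, unfolded sol.work_def] show ?thesis
      by (meson add_left_mono order_trans)
  qed
  show ?thesis
    using a sol.sup_square_integrable sol.AE_limit_all sol.expectation_limit
      sol.ergodic_limit[unfolded sol.avg_def] by blast
qed

end
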